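(* Let $c_o,f_o,\xi>0$, $\alpha\in(-\pi/2,\pi/2)$, $\xi_o>-\xi\cos\alpha$, and set $\alpha_o=\xi_o/\xi$. Let $W(\tau,\omega)$ be the Wigner transform of the signal recorded, in front of the perfect mirror $\{z=0\}$ and with noise source spectrum $\hat F(\omega)=f_o|\omega|$, by the observer with trajectory $$T(\tau)=\frac{\xi}{c_o}\sinh\Big(\frac{c_o\tau}{\xi}\Big),\qquad \boldsymbol{X}(\tau)=(0,0,\xi_o)+\xi\cosh\Big(\frac{c_o\tau}{\xi}\Big)(\sin\alpha,0,\cos\alpha).$$ Then $$W(\tau,\omega)=W_o(\omega)\Big[1-R\Big(\frac{c_o\tau}{\xi},\frac{\xi\omega}{c_o}\Big)\Big],\qquad W_o(\omega)=\frac{f_o|\omega|}{4\pi}\Big(1+\frac{2}{e^{2\pi\xi|\omega|/c_o}-1}\Big),$$ where, with $$A=\sin^2\alpha,\quad B(\eta)=-2\alpha_o\cos\alpha\cosh\eta,\quad C(\eta)=-1-\alpha_o^2-\cos^2\alpha\sinh^2\eta,$$ the correction $R$ is as follows. (i) If $\alpha\neq0$, then with $C_\pm(\eta)=\dfrac{-B(\eta)\pm\sqrt{B^2(\eta)-4AC(\eta)}}{2A}$, $$R(\eta,\nu)=\frac{\tanh(\pi\nu)}{\nu\tanh(2\pi\nu)}\,\frac{\sin[2\nu\,\mathrm{argcosh}(C_+(\eta))]}{\sqrt{B^2(\eta)-4AC(\eta)}\sqrt{C_+^2(\eta)-1}}+\frac{\tanh(\pi\nu)}{\nu\sinh(2\pi\nu)}\,\frac{\sin[2\nu\,\mathrm{argcosh}(|C_-(\eta)|)]}{\sqrt{B^2(\eta)-4AC(\eta)}\sqrt{C_-^2(\eta)-1}}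 .$$ (ii) If $\alpha=0$, then $$R(\eta,\nu)=\begin{cases}\dfrac{\tanh(\pi\nu)}{\tanh(2\pi\nu)}\,\dfrac{\sin[2\nu\,\mathrm{argcosh}(|C(\eta)/B(\eta)|)]}{\nu\sqrt{C^2(\eta)-B^2(\eta)}} & \text{if }\alpha_o\in(-1,0),\\[3mm] \dfrac{\tanh(\pi\nu)}{\sinh(2\pi\nu)}\,\dfrac{\sin[2\nu\,\mathrm{argcosh}(|C(\eta)/B(\eta)|)]}{\nu\sqrt{C^2(\eta)-B^2(\eta)}} & \text{if }\alpha_o\in(0,+\infty),\\[3mm] 0 & \text{if }\alpha_o=0.\end{cases}$$ (Expressions of the form $0/0$, at $\nu=0$, at $C_-(\eta)=-1$, or at $|C(\eta)/B(\eta)|=1$, are understood by continuity. When $\alpha=0$ and $\alpha_o=0$ the identity for $W$ is on $\omega\neq0$.)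
   Context: Write $\boldsymbol{x}^{\rm s}=(x,y,-z)$ for $\boldsymbol{x}=(x,y,z)\in\mathbb{R}^3$, and $\mathrm{sinc}(s)=\sin(s)/s$, $\mathrm{sinc}(0)=1$. The field $u(t,\boldsymbol{x})$ in the half-space $z>0$ solves the wave equation $c_o^{-2}\partial_t^2u-\Delta u=n$ with Dirichlet condition $u=0$ on the plane $z=0$ and with distant stationary noise sources $n$ of power spectral density $\hat F$ (sources on a half-sphere of radius $L\to\infty$); it is a zero-mean random field with covariance $$\langle u(t,\boldsymbol{x})u(t',\boldsymbol{x}')\rangle=\frac{1}{8\pi^2}\int_{\mathbb{R}}\hat F(\omega)\Big[\mathrm{sinc}\Big(\frac{\omega}{c_o}|\boldsymbol{x}-\boldsymbol{x}'|\Big)-\mathrm{sinc}\Big(\frac{\omega}{c_o}|\boldsymbol{x}^{\rm s}-\boldsymbol{x}'|\Big)\Big]e^{i\omega(t-t')}\,d\omega .$$ The recorded signal is $U(\tau)=u(T(\tau),\boldsymbol{X}(\tau))$, where $\tau\in\mathbb{R}$ is the proper time of the observer, and its Wigner transform is $$W(\tau,\omega)=\int_{\mathbb{R}}\Big\langle U(\tau+\tfrac{\tau'}{2})U(\tau-\tfrac{\tau'}{2})\Big\rangle e^{i\omega\tau'}\,d\tau' .$$ For the non-integrable spectrum $\hat F(\omega)=f_o|\omega|$, the autocorrelation is understood, for fixed $\tau$, as the limit $\epsilon\to0^+$, in the sense of tempered distributions in $\tau'$, of the autocorrelation with spectrum $f_o|\omega|e^{-\epsilon|\omega|}$, and $W(\tau,\cdot)$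 as its Fourier transform (a distribution in $\omega$). $\mathrm{argcosh}:[1,\infty)\to[0,\infty)$ is the inverse of $\cosh$. *)

theory Defs
  imports "HOL-Probability.Probability"
begin

section \<open>The noise field in front of the mirror and the recorded signal\<close>

definition mirror_image :: "real^3 \<Rightarrow> real^3" where
  "mirror_image x = vector [x $ 1, x $ 2, - (x $ 3)]"

text \<open>
  A random field on the half-space \<open>z > 0\<close> enters only through its first two moments, so a
  noise field is a zero-mean, square-integrable family of real random variables with the
  prescribed covariance; \<open>F\<close> is the power spectral density of the sources.
\<close>

definition mirror_noise_field ::
  "real \<Rightarrow> (real \<Rightarrow> real) \<Rightarrow> 'w measure \<Rightarrow> (real \<Rightarrow> real^3 \<Rightarrow> 'w \<Rightarrow> real) \<Rightarrow> bool" where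
  "mirror_noise_field c F M u \<longleftrightarrow>
     prob_space M \<and>
     (\<forall>t x. x $ 3 > 0 \<longrightarrow>
        u t x \<in> borel_measurable M \<and>
        integrable M (\<lambda>w. (u t x w)\<^sup>2) \<and>
        prob_space.expectation M (u t x) = 0) \<and>
     (\<forall>t x t' x'. x $ 3 > 0 \<longrightarrow> x' $ 3 > 0 \<longrightarrow>
        complex_of_real (prob_space.expectation M (\<lambda>w. u t x w * u t' x' w)) =
          1 / (8 * pi\<^sup>2) *
          (\<integral>\<omega>. complex_of_real
                 (F \<omega> * (sinc (\<omega> / c * norm (x - x'))
                       - sinc (\<omega> / c * norm (mirror_image x - x'))))
               * exp (\<i> * \<omega> * (t - t')) \<partial>lborel))"

definition recorded_signal ::
  "(real \<Rightarrow> real^3 \<Rightarrow> 'w \<Rightarrow> real) \<Rightarrow> (real \<Rightarrow> real) \<Rightarrow> (real \<Rightarrow> real^3) \<Rightarrow> real \<Rightarrow> 'w \<Rightarrow> real" where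
  "recorded_signal u T X \<tau> = u (T \<tau>) (X \<tau>)"

definition autocorrelation :: "'w measure \<Rightarrow> (real \<Rightarrow> 'w \<Rightarrow> real) \<Rightarrow> real \<Rightarrow> real \<Rightarrow> real" where
  "autocorrelation M U \<tau> \<tau>' =
     prob_space.expectation M (\<lambda>w. U (\<tau> + \<tau>' / 2) w * U (\<tau> - \<tau>' / 2) w)"

definition observer_time :: "real \<Rightarrow> real \<Rightarrow> real \<Rightarrow> real" where
  "observer_time c \<xi> \<tau> = \<xi> / c * sinh (c * \<tau> / \<xi>)"

definition observer_position :: "real \<Rightarrow> real \<Rightarrow> real \<Rightarrow> real \<Rightarrow> real \<Rightarrow> real^3" where
  "observer_position c \<xi> \<xi>\<^sub>o \<alpha> \<tau> =
     vector [0, 0, \<xi>\<^sub>o] + (\<xi> * cosh (c * \<tau> / \<xi>)) *\<^sub>R vector [sin \<alpha>, 0, cos \<alpha>]"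


section \<open>Tempered distributions on the real line\<close>

definition iter_deriv :: "nat \<Rightarrow> (real \<Rightarrow> complex) \<Rightarrow> real \<Rightarrow> complex" where
  "iter_deriv n = (\<lambda>\<phi> x. vector_derivative \<phi> (at x)) ^^ n"

definition schwartz :: "(real \<Rightarrow> complex) \<Rightarrow> bool" where
  "schwartz \<phi> \<longleftrightarrow>
     (\<forall>n x. iter_deriv n \<phi> differentiable (at x)) \<and>
     (\<forall>k n. bounded (range (\<lambda>x. x ^ k *\<^sub>R iter_deriv n \<phi> x)))"

definition schwartz_seminorm :: "nat \<Rightarrow> nat \<Rightarrow> (real \<Rightarrow> complex) \<Rightarrow> real" where
  "schwartz_seminorm k n \<phi> = (SUP x. norm (x ^ k *\<^sub>R iter_deriv n \<phi> x))"

text \<open>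
  Distributions are functionals on all functions, of which only the values on Schwartz
  functions are meaningful.
\<close>

definition tempered_distribution :: "((real \<Rightarrow> complex) \<Rightarrow> complex) \<Rightarrow> bool" where
  "tempered_distribution D \<longleftrightarrow>
     (\<forall>\<phi> \<psi> a b. schwartz \<phi> \<longrightarrow> schwartz \<psi> \<longrightarrow>
        D (\<lambda>x. a * \<phi> x + b * \<psi> x) = a * D \<phi> + b * D \<psi>) \<and>
     (\<exists>K N. \<forall>\<phi>. schwartz \<phi> \<longrightarrow>
        norm (D \<phi>) \<le> K * (\<Sum>k\<le>N. \<Sum>n\<le>N. schwartz_seminorm k n \<phi>))"

definition tempered_limit ::
  "('i \<Rightarrow> real \<Rightarrow> complex) \<Rightarrow> ((real \<Rightarrow> complex) \<Rightarrow> complex) \<Rightarrow> 'i filter \<Rightarrow> bool" where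
  "tempered_limit g D \<F> \<longleftrightarrow>
     tempered_distribution D \<and>
     (\<forall>\<phi>. schwartz \<phi> \<longrightarrow>
        (\<forall>\<^sub>F i in \<F>. integrable lborel (\<lambda>s. g i s * \<phi> s)) \<and>
        ((\<lambda>i. \<integral>s. g i s * \<phi> s \<partial>lborel) \<longlongrightarrow> D \<phi>) \<F>)"

definition fourier :: "(real \<Rightarrow> complex) \<Rightarrow> real \<Rightarrow> complex" where
  "fourier \<phi> s = (\<integral>\<omega>. \<phi> \<omega> * exp (\<i> * \<omega> * s) \<partial>lborel)"

text \<open>
  Equality of a distribution with a function on an open set \<open>\<Omega>\<close>: it is tested on the
  Schwartz functions whose support lies in \<open>\<Omega>\<close>, hence on all of them if \<open>\<Omega> = UNIV\<close>.
\<close>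

definition equals_function_on ::
  "((real \<Rightarrow> complex) \<Rightarrow> complex) \<Rightarrow> (real \<Rightarrow> real) \<Rightarrow> real set \<Rightarrow> bool" where
  "equals_function_on D h \<Omega> \<longleftrightarrow>
     (\<forall>\<phi>. schwartz \<phi> \<longrightarrow> closure {\<omega>. \<phi> \<omega> \<noteq> 0} \<subseteq> \<Omega> \<longrightarrow>
        integrable lborel (\<lambda>\<omega>. complex_of_real (h \<omega>) * \<phi> \<omega>) \<and>
        D \<phi> = (\<integral>\<omega>. complex_of_real (h \<omega>) * \<phi> \<omega> \<partial>lborel))"


section \<open>The Wigner transform\<close>

text \<open>
  \<open>U \<epsilon>\<close> is the signal recorded for the regularised spectrum, defined on \<open>M \<epsilon>\<close>. The
  autocorrelation at fixed \<open>\<tau>\<close> is the tempered limit as \<open>\<epsilon> \<rightarrow> 0+\<close>, and \<open>W\<close> is its Fourier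
  transform in \<open>\<tau>'\<close>, with sign \<open>exp (i \<omega> \<tau>')\<close>, defined by duality.
\<close>

definition is_wigner_transform ::
  "(real \<Rightarrow> 'w measure) \<Rightarrow> (real \<Rightarrow> real \<Rightarrow> 'w \<Rightarrow> real) \<Rightarrow> real
     \<Rightarrow> ((real \<Rightarrow> complex) \<Rightarrow> complex) \<Rightarrow> bool" where
  "is_wigner_transform M U \<tau> W \<longleftrightarrow>
     tempered_distribution W \<and>
     (\<exists>D. tempered_limit (\<lambda>\<epsilon> \<tau>'. complex_of_real (autocorrelation (M \<epsilon>) (U \<epsilon>) \<tau> \<tau>'))
            D (at_right 0) \<and>
          (\<forall>\<phi>. schwartz \<phi> \<longrightarrow> W \<phi> = D (fourier \<phi>)))"


section \<open>The spectrum and its correction\<close>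

text \<open>
  Extension by continuity of a formula that is meaningful on \<open>S\<close>.
\<close>

definition extend_by_continuity ::
  "'a::topological_space set \<Rightarrow> ('a \<Rightarrow> real) \<Rightarrow> 'a \<Rightarrow> real" where
  "extend_by_continuity S f p = (if p \<in> S then f p else Lim (at p within S) f)"

definition W\<^sub>o :: "real \<Rightarrow> real \<Rightarrow> real \<Rightarrow> real \<Rightarrow> real" where
  "W\<^sub>o c f \<xi> = extend_by_continuity {\<omega>. \<omega> \<noteq> 0}
     (\<lambda>\<omega>. f * \<bar>\<omega>\<bar> / (4 * pi) * (1 + 2 / (exp (2 * pi * \<xi> * \<bar>\<omega>\<bar> / c) - 1)))"

definition coeff_A :: "real \<Rightarrow> real" where
  "coeff_A \<alpha> = (sin \<alpha>)\<^sup>2"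

definition coeff_B :: "real \<Rightarrow> real \<Rightarrow> real \<Rightarrow> real" where
  "coeff_B \<alpha> \<alpha>\<^sub>o \<eta> = - 2 * \<alpha>\<^sub>o * cos \<alpha> * cosh \<eta>"

definition coeff_C :: "real \<Rightarrow> real \<Rightarrow> real \<Rightarrow> real" where
  "coeff_C \<alpha> \<alpha>\<^sub>o \<eta> = - 1 - \<alpha>\<^sub>o\<^sup>2 - (cos \<alpha>)\<^sup>2 * (sinh \<eta>)\<^sup>2"

definition discr :: "real \<Rightarrow> real \<Rightarrow> real \<Rightarrow> real" where
  "discr \<alpha> \<alpha>\<^sub>o \<eta> = (coeff_B \<alpha> \<alpha>\<^sub>o \<eta>)\<^sup>2 - 4 * coeff_A \<alpha> * coeff_C \<alpha> \<alpha>\<^sub>o \<eta>"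

definition C_plus :: "real \<Rightarrow> real \<Rightarrow> real \<Rightarrow> real" where
  "C_plus \<alpha> \<alpha>\<^sub>o \<eta> = (- coeff_B \<alpha> \<alpha>\<^sub>o \<eta> + sqrt (discr \<alpha> \<alpha>\<^sub>o \<eta>)) / (2 * coeff_A \<alpha>)"

definition C_minus :: "real \<Rightarrow> real \<Rightarrow> real \<Rightarrow> real" where
  "C_minus \<alpha> \<alpha>\<^sub>o \<eta> = (- coeff_B \<alpha> \<alpha>\<^sub>o \<eta> - sqrt (discr \<alpha> \<alpha>\<^sub>o \<eta>)) / (2 * coeff_A \<alpha>)"

text \<open>
  For \<open>\<alpha>\<^sub>o > - cos \<alpha>\<close> one has \<open>C_plus > 1\<close> and \<open>C_minus \<le> -1\<close> if \<open>\<alpha> \<noteq> 0\<close>, and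
  \<open>\<bar>C / B\<bar> \<ge> 1\<close> if \<open>\<alpha> = 0\<close> and \<open>\<alpha>\<^sub>o \<noteq> 0\<close>. Hence the formulas below have nonzero
  denominators on the sets given to \<^const>\<open>extend_by_continuity\<close>; off these sets, at
  \<open>\<nu> = 0\<close>, \<open>C_minus = -1\<close> or \<open>\<bar>C / B\<bar> = 1\<close>, they are of the form \<open>0 / 0\<close>.
\<close>

definition R_oblique :: "real \<Rightarrow> real \<Rightarrow> real \<times> real \<Rightarrow> real" where
  "R_oblique \<alpha> \<alpha>\<^sub>o = extend_by_continuity {(\<eta>, \<nu>). \<nu> \<noteq> 0 \<and> C_minus \<alpha> \<alpha>\<^sub>o \<eta> \<noteq> - 1}
     (\<lambda>(\<eta>, \<nu>).
        tanh (pi * \<nu>) / (\<nu> * tanh (2 * pi * \<nu>)) *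
          (sin (2 * \<nu> * arcosh (C_plus \<alpha> \<alpha>\<^sub>o \<eta>)) /
            (sqrt (discr \<alpha> \<alpha>\<^sub>o \<eta>) * sqrt ((C_plus \<alpha> \<alpha>\<^sub>o \<eta>)\<^sup>2 - 1))) +
        tanh (pi * \<nu>) / (\<nu> * sinh (2 * pi * \<nu>)) *
          (sin (2 * \<nu> * arcosh \<bar>C_minus \<alpha> \<alpha>\<^sub>o \<eta>\<bar>) /
            (sqrt (discr \<alpha> \<alpha>\<^sub>o \<eta>) * sqrt ((C_minus \<alpha> \<alpha>\<^sub>o \<eta>)\<^sup>2 - 1))))"

definition R_normal :: "real \<Rightarrow> real \<times> real \<Rightarrow> real" where
  "R_normal \<alpha>\<^sub>o = extend_by_continuity
     {(\<eta>, \<nu>). \<nu> \<noteq> 0 \<and> \<bar>coeff_C 0 \<alpha>\<^sub>o \<eta> / coeff_B 0 \<alpha>\<^sub>o \<eta>\<bar> \<noteq> 1}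
     (\<lambda>(\<eta>, \<nu>).
        if \<alpha>\<^sub>o \<in> {-1<..<0} then
          tanh (pi * \<nu>) / tanh (2 * pi * \<nu>) *
            (sin (2 * \<nu> * arcosh \<bar>coeff_C 0 \<alpha>\<^sub>o \<eta> / coeff_B 0 \<alpha>\<^sub>o \<eta>\<bar>) /
              (\<nu> * sqrt ((coeff_C 0 \<alpha>\<^sub>o \<eta>)\<^sup>2 - (coeff_B 0 \<alpha>\<^sub>o \<eta>)\<^sup>2)))
        else if \<alpha>\<^sub>o > 0 then
          tanh (pi * \<nu>) / sinh (2 * pi * \<nu>) *
            (sin (2 * \<nu> * arcosh \<bar>coeff_C 0 \<alpha>\<^sub>o \<eta> / coeff_B 0 \<alpha>\<^sub>o \<eta>\<bar>) /
              (\<nu> * sqrt ((coeff_C 0 \<alpha>\<^sub>o \<eta>)\<^sup>2 - (coeff_B 0 \<alpha>\<^sub>o \<eta>)\<^sup>2)))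
        else 0)"

definition R_corr :: "real \<Rightarrow> real \<Rightarrow> real \<Rightarrow> real \<Rightarrow> real" where
  "R_corr \<alpha> \<alpha>\<^sub>o \<eta> \<nu> = (if \<alpha> \<noteq> 0 then R_oblique \<alpha> \<alpha>\<^sub>o (\<eta>, \<nu>) else R_normal \<alpha>\<^sub>o (\<eta>, \<nu>))"

end

theory Submission
  imports Defs "HOL-Real_Asymp.Real_Asymp"
begin

text \<open>
  Write \<open>k = 2 \<xi> / c\<^sub>o\<close>, \<open>\<eta> = c\<^sub>o \<tau> / \<xi>\<close> and \<open>\<tau>' = k s\<close>. For the regularised spectrum
  \<open>f\<^sub>o |\<omega>| exp (- \<epsilon> |\<omega>|)\<close> the frequency integral in the covariance is elementary: two points at
  squared distance \<open>r\<close>, measured in units of time, and time lag \<open>d\<close> contribute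
  \<open>Re (2 / (r - (d - i \<epsilon>)\<^sup>2))\<close>, the function \<open>regularized_kernel \<epsilon> r d\<close>
  (\<open>power_spectrum_integral\<close>). Along the trajectory \<open>r - d\<^sup>2\<close> is \<open>- k\<^sup>2 sinh\<^sup>2 s\<close> for the direct
  path and \<open>- k\<^sup>2 P (cosh s)\<close> for the path reflected by the mirror, with
  \<open>P x = A x\<^sup>2 + B x + C\<close> (\<open>observer_geometry\<close>, \<open>mirror_quadratic\<close>). As \<open>\<epsilon> \<rightarrow> 0\<close> the kernels tend to
  \<open>2 / (r - d\<^sup>2)\<close>, which is singular at the double zero \<open>s = 0\<close> of the direct term and at the
  simple zeros \<open>cosh s = C\<^sub>+\<close> of the mirror term, where light emitted at one of the two instants
  returns at the other one. The direct term yields \<open>W\<^sub>o\<close>, the mirror term \<open>W\<^sub>o R\<close>.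

  For both limits the integral of the kernel against a test function \<open>\<phi>\<close> is regrouped into an
  integral over \<open>s > 0\<close> of a finite combination of values \<open>\<phi> (x\<^sub>j s)\<close> that is bounded, uniformly in
  \<open>\<epsilon>\<close>, by a multiple of \<open>exp (- s)\<close> (\<open>spectral_limit_of_kernel\<close>). At the double zero this
  is achieved by subtracting \<open>2 \<phi> 0 cosh s\<close>, which costs nothing because the kernel times
  \<open>cosh s\<close> has integral zero (\<open>direct_kernel_null_integral\<close>). At a simple zero the integral is
  folded about the zero, where the two singular halves cancel up to a bounded remainder
  (\<open>paired_kernel_bound\<close>). The limit distribution is then an explicit functional; applied to the
  Fourier transform of \<open>\<phi>\<close> it is evaluated by Fubini, so that its spectrum at \<open>\<omega>\<close> is the same
  combination with the oscillation \<open>exp (i \<omega> x)\<close> in place of \<open>\<phi>\<close>.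

  It remains to compute real integrals with kernels \<open>1 / sinh\<^sup>2 s\<close> and, after splitting \<open>1 / P\<close>
  into partial fractions, \<open>1 / (cosh s - cosh a)\<close> and \<open>1 / (cosh s + cosh b)\<close>. The last two are
  differences of translates, up to a constant factor, of the Planck factor \<open>1 / (exp s - 1)\<close> and the Fermi factor
  \<open>1 / (exp s + 1)\<close>, and an integration by parts turns the first one into a Planck factor as
  well. Everything thus follows from
  \<open>\<integral> sin (\<mu> s) / (exp s - 1) ds = (\<pi> / 2) coth (\<pi> \<mu>) - 1 / (2 \<mu>)\<close> over \<open>s > 0\<close>
  (\<open>planck_sine\<close>): expanding the Planck factor geometrically gives the partial fractions of
  \<open>coth\<close>, which come from the reflection formula of the Gamma function (\<open>sums_coth\<close>). This is where
  the thermal factor of \<open>W\<^sub>o\<close> has its origin.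

  If \<open>\<alpha> = 0\<close> and \<open>\<xi>\<^sub>o = 0\<close>, then \<open>P\<close> is constant, the mirror term tends to a constant function of
  \<open>\<tau>'\<close>, and its Fourier transform is a Dirac mass at \<open>\<omega> = 0\<close> (\<open>constant_spectral_limit\<close>). The
  values of \<open>R\<close> that are understood by continuity are those of \<open>sin (\<mu> b) / sinh b\<close> at \<open>b = 0\<close>.
\<close>

section \<open>Integration over the positive half-line\<close>

text \<open>
  A measure of its own, so that the theorems on the Bochner integral apply without
  indicator functions.
\<close>

definition half_line :: "real measure" where
  "half_line = restrict_space lborel {0<..}"

lemma space_half_line [simp]: "space half_line = {0<..}"
  by (simp add: half_line_def space_restrict_space)

lemma sigma_finite_half_line: "sigma_finite_measure half_line"
  unfolding half_line_def
  by (rule sigma_finite_measure_restrict_space) (auto intro: sigma_finite_lborel)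

lemma measurable_half_line [measurable (raw)]:
  "f \<in> borel_measurable borel \<Longrightarrow> f \<in> borel_measurable half_line"
  unfolding half_line_def by (intro measurable_restrict_space1) simp

lemma half_line_cong: "(\<And>s. s > 0 \<Longrightarrow> f s = g s) \<Longrightarrow> (\<integral>s. f s \<partial>half_line) = (\<integral>s. g s \<partial>half_line)"
  by (rule Bochner_Integration.integral_cong) auto

lemma integrable_half_line_iff:
  fixes f :: "real \<Rightarrow> 'a::{banach, second_countable_topology}"
  shows "integrable half_line f \<longleftrightarrow> integrable lborel (\<lambda>s. indicator {0<..} s *\<^sub>R f s)"
  unfolding half_line_def by (subst integrable_restrict_space) auto

lemma integral_half_line:
  fixes f :: "real \<Rightarrow> 'a::{banach, second_countable_topology}"
  shows "(\<integral>s. f s \<partial>half_line) = (\<integral>s. indicator {0<..} s *\<^sub>R f s \<partial>lborel)"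
  unfolding half_line_def by (subst integral_restrict_space) auto

lemma AE_half_line:
  assumes "\<And>s. s > 0 \<Longrightarrow> s \<noteq> a \<Longrightarrow> P s"
  shows "AE s in half_line. P s"
proof -
  have "AE s in lborel. s \<in> {0<..} \<longrightarrow> P s"
    by (rule AE_mp[OF AE_lborel_singleton[of a]]) (use assms in auto)
  then show ?thesis
    unfolding half_line_def by (subst AE_restrict_space_iff) auto
qed

lemma integrable_half_line_exp: 
  assumes "d > 0" shows "integrable half_line (\<lambda>s. C * exp (- d * s))"
proof -
  have "integrable lborel (\<lambda>x. indicator {0<..} x *\<^sub>R exp (- (x * d)))"
    using integrable_I0i_exp_mscale[OF assms] by (simp add: set_integrable_def)
  then show ?thesis
    by (auto simp: integrable_half_line_iff mult.commute)
qed

lemma integrable_half_line_bound: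
  fixes f :: "real \<Rightarrow> 'a::{banach, second_countable_topology}"
  assumes "f \<in> borel_measurable half_line" "d > 0" "\<And>s. s > 0 \<Longrightarrow> norm (f s) \<le> C * exp (- d * s)"
  shows "integrable half_line f"
proof (rule Bochner_Integration.integrable_bound[OF integrable_half_line_exp[OF assms(2), of C] assms(1)])
  show "AE s in half_line. norm (f s) \<le> norm (C * exp (- d * s))"
    using assms(3) by (intro AE_half_line[of 0]) (auto intro: order_trans[OF _ abs_ge_self])
qed

lemma half_line_FTC:
  fixes f F :: "real \<Rightarrow> 'a::euclidean_space"
  assumes F: "\<And>s. s > 0 \<Longrightarrow> (F has_vector_derivative f s) (at s)"
    and f: "\<And>s. s > 0 \<Longrightarrow> isCont f s"
    and int: "integrable half_line f"
    and A: "(F \<longlongrightarrow> A) (at_right 0)" and B: "(F \<longlongrightarrow> B) at_top"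
  shows "(\<integral>s. f s \<partial>half_line) = B - A"
proof -
  have "(LBINT s=0..\<infinity>. f s) = B - A"
  proof (rule interval_integral_FTC_integrable[where F=F])
    show "set_integrable lborel (einterval 0 \<infinity>) f"
      using int by (simp add: integrable_half_line_iff set_integrable_def zero_ereal_def)
    show "((F \<circ> real_of_ereal) \<longlongrightarrow> A) (at_right 0)"
      using A unfolding zero_ereal_def ereal_tendsto_simps by simp
    show "((F \<circ> real_of_ereal) \<longlongrightarrow> B) (at_left \<infinity>)"
      using B by (simp add: ereal_tendsto_simps)
  qed (use F f in auto)
  then show ?thesis
    by (simp add: integral_half_line interval_lebesgue_integral_0_infty set_lebesgue_integral_def)
qed

lemma integral_lborel_fold:
  fixes f :: "real \<Rightarrow> 'a::{banach, second_countable_topology}"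
  assumes [measurable]: "f \<in> borel_measurable borel"
  shows "integrable lborel f \<longleftrightarrow> integrable half_line f \<and> integrable half_line (\<lambda>s. f (- s))"
    and "integrable lborel f \<Longrightarrow>
           (\<integral>s. f s \<partial>lborel) = (\<integral>s. f s + f (- s) \<partial>half_line)"
proof -
  let ?p = "\<lambda>s. indicator {0<..} s *\<^sub>R f s" and ?n = "\<lambda>s. indicator {..<0} s *\<^sub>R f s"
  have refl: "(\<lambda>s. indicator {..<0::real} (0 + - 1 * s) *\<^sub>R f (0 + - 1 * s)) = (\<lambda>s. indicator {0<..} s *\<^sub>R f (- s))"
    by (auto simp: fun_eq_iff indicator_def)
  have in_iff: "integrable lborel ?n \<longleftrightarrow> integrable half_line (\<lambda>s. f (- s))"
    unfolding integrable_half_line_iff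
    by (subst lborel_integrable_real_affine_iff[of "-1" ?n 0, symmetric]) (use refl in simp_all)
  have in_eq: "(\<integral>s. ?n s \<partial>lborel) = (\<integral>s. f (- s) \<partial>half_line)"
    unfolding integral_half_line
    by (subst lborel_integral_real_affine[of "-1" ?n 0]) (use refl in simp_all)
  have ae: "AE s in lborel. f s = ?p s + ?n s"
    by (rule AE_mp[OF AE_lborel_singleton[of 0]]) (auto simp: indicator_def)
  show iff: "integrable lborel f \<longleftrightarrow> integrable half_line f \<and> integrable half_line (\<lambda>s. f (- s))"
  proof safe
    assume f: "integrable lborel f"
    show "integrable half_line f"
      unfolding integrable_half_line_iff using integrable_mult_indicator[OF _ f, of "{0<..}"] by simp
    show "integrable half_line (\<lambda>s. f (- s))"
      unfolding in_iff[symmetric] using integrable_mult_indicator[OF _ f, of "{..<0}"] by simp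
  next
    assume "integrable half_line f" "integrable half_line (\<lambda>s. f (- s))"
    then have "integrable lborel (\<lambda>s. ?p s + ?n s)"
      by (intro Bochner_Integration.integrable_add) (auto simp: in_iff integrable_half_line_iff)
    then show "integrable lborel f"
      by (rule Bochner_Integration.integrable_cong_AE_imp) (use ae in auto)
  qed
  assume f: "integrable lborel f"
  have i: "integrable lborel ?p" "integrable lborel ?n"
    using f iff in_iff by (auto simp: integrable_half_line_iff)
  have "(\<integral>s. f s \<partial>lborel) = (\<integral>s. ?p s + ?n s \<partial>lborel)"
    by (rule integral_cong_AE) (use ae in auto)
  also have "\<dots> = (\<integral>s. ?p s \<partial>lborel) + (\<integral>s. ?n s \<partial>lborel)"
    using i by (rule Bochner_Integration.integral_add)
  also have "\<dots> = (\<integral>s. f s + f (- s) \<partial>half_line)"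
    unfolding in_eq using f iff by (subst Bochner_Integration.integral_add) (auto simp: integral_half_line)
  finally show "(\<integral>s. f s \<partial>lborel) = (\<integral>s. f s + f (- s) \<partial>half_line)" .
qed

lemma exp_minus_linear_tendsto_0:
  fixes d a b :: real
  assumes "d > 0" shows "((\<lambda>s. exp (- (d * s)) * (s * a + b)) \<longlongrightarrow> 0) at_top"
proof -
  have "((\<lambda>s. exp (- (d * s)) * s) \<longlongrightarrow> 0) at_top" "((\<lambda>s. exp (- (d * s))) \<longlongrightarrow> 0) at_top"
    using assms by real_asymp+
  then have "((\<lambda>s. exp (- (d * s)) * s * a + exp (- (d * s)) * b) \<longlongrightarrow> 0 * a + 0 * b) at_top"
    by (intro tendsto_intros)
  then show ?thesis by (simp add: algebra_simps)
qed

lemma laplace_exp: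
  fixes z :: complex assumes z: "Re z > 0"
  shows "integrable half_line (\<lambda>s. exp (- (of_real s * z)))" 
    and "(\<integral>s. exp (- (of_real s * z)) \<partial>half_line) = 1 / z"
proof -
  have z0: "z \<noteq> 0" using z by auto
  show i: "integrable half_line (\<lambda>s. exp (- (of_real s * z)))"
    by (rule integrable_half_line_bound[where d="Re z" and C=1]) (use z in \<open>auto simp: mult.commute\<close>)
  have lim: "((\<lambda>s. - exp (- (of_real s * z)) / z) \<longlongrightarrow> 0) at_top"
  proof (rule tendsto_norm_zero_cancel)
    have "((\<lambda>s. exp (- (Re z * s)) * (s * 0 + 1 / norm z)) \<longlongrightarrow> 0) at_top"
      using z by (rule exp_minus_linear_tendsto_0)
    then show "((\<lambda>s. norm (- exp (- (of_real s * z)) / z)) \<longlongrightarrow> 0) at_top"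
      by (simp add: norm_divide mult.commute)
  qed
  have "(\<integral>s. exp (- (of_real s * z)) \<partial>half_line) = 0 - (- 1 / z)"
  proof (rule half_line_FTC[where F="\<lambda>s. - exp (- (of_real s * z)) / z"])
    show "((\<lambda>s. - exp (- (of_real s * z)) / z) \<longlongrightarrow> - 1 / z) (at_right 0)"
      by (rule tendsto_eq_intros refl | use z0 in simp)+
  next
    show "((\<lambda>s. - exp (- (of_real s * z)) / z) has_vector_derivative exp (- (of_real s * z))) (at s)" for s
      by (rule has_vector_derivative_real_field[where f="\<lambda>w. - exp (- (w * z)) / z"])
         (use z0 in \<open>auto intro!: derivative_eq_intros\<close>)
  qed (use i lim in \<open>auto intro!: continuous_intros\<close>)
  then show "(\<integral>s. exp (- (of_real s * z)) \<partial>half_line) = 1 / z" by simp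
qed

lemma laplace_id_exp:
  fixes z :: complex assumes z: "Re z > 0"
  shows "integrable half_line (\<lambda>s. of_real s * exp (- (of_real s * z)))" 
    and "(\<integral>s. of_real s * exp (- (of_real s * z)) \<partial>half_line) = 1 / z\<^sup>2"
proof -
  have z0: "z \<noteq> 0" using z by auto
  have b: "s * exp (- (Re z * s)) \<le> (2 / Re z) * exp (- (Re z / 2) * s)" if "s > 0" for s
  proof -
    have "Re z / 2 * s \<le> exp (Re z / 2 * s)"
      using exp_ge_add_one_self[of "Re z / 2 * s"] by linarith
    then have "s \<le> 2 / Re z * exp (Re z / 2 * s)" using z by (simp add: field_simps)
    then have "s * exp (- (Re z * s)) \<le> (2 / Re z * exp (Re z / 2 * s)) * exp (- (Re z * s))"
      by (rule mult_right_mono) simp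
    also have "\<dots> = (2 / Re z) * exp (- (Re z / 2) * s)" by (simp flip: exp_add)
    finally show ?thesis .
  qed
  show i: "integrable half_line (\<lambda>s. of_real s * exp (- (of_real s * z)))"
    by (rule integrable_half_line_bound[where d="Re z/2" and C="2 / Re z"])
       (use z b in \<open>auto simp: norm_mult mult.commute\<close>)
  let ?F = "\<lambda>s. - exp (- (of_real s * z)) * (of_real s / z + 1 / z\<^sup>2)"
  have lim: "(?F \<longlongrightarrow> 0) at_top"
  proof (rule Lim_null_comparison)
    show "((\<lambda>s. exp (- (Re z * s)) * (s * (1 / norm z) + 1 / norm z ^ 2)) \<longlongrightarrow> 0) at_top"
      using z by (rule exp_minus_linear_tendsto_0)
    have "norm (?F s) \<le> exp (- (Re z * s)) * (s / norm z + 1 / norm z ^ 2)" if "s > 0" for s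
      using that norm_triangle_ineq[of "of_real s / z" "1 / z\<^sup>2"]
      by (auto simp: norm_mult norm_divide norm_power mult.commute)
    then show "eventually (\<lambda>s. norm (?F s) \<le> exp (- (Re z * s)) * (s * (1 / norm z) + 1 / norm z ^ 2)) at_top"
      by (intro eventually_mono[OF eventually_gt_at_top[of 0]]) simp
  qed
  have "(\<integral>s. of_real s * exp (- (of_real s * z)) \<partial>half_line) = 0 - (- 1 / z\<^sup>2)"
  proof (rule half_line_FTC[where F="?F"])
    show "(?F \<longlongrightarrow> - 1 / z\<^sup>2) (at_right 0)"
      by (rule tendsto_eq_intros refl | use z0 in simp)+
  next
    show "(?F has_vector_derivative of_real s * exp (- (of_real s * z))) (at s)" for s
      by (rule has_vector_derivative_real_field[where f="\<lambda>w. - exp (- (w * z)) * (w / z + 1 / z\<^sup>2)"])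
         (use z0 in \<open>auto intro!: derivative_eq_intros simp: power2_eq_square divide_simps algebra_simps\<close>)
  qed (use i lim in \<open>auto intro!: continuous_intros\<close>)
  then show "(\<integral>s. of_real s * exp (- (of_real s * z)) \<partial>half_line) = 1 / z\<^sup>2" by simp
qed

section \<open>The covariance for the regularised spectrum\<close>

text \<open>
  This is \<open>Re (2 / (r - (d - i \<epsilon>)\<^sup>2))\<close>: the squared distance \<open>r\<close> and the time lag \<open>d\<close>, with the
  cutoff \<open>\<epsilon>\<close> as an imaginary time. The denominator is \<open>|r - (d - i \<epsilon>)\<^sup>2|\<^sup>2\<close>.
\<close>

definition regularized_kernel :: "real \<Rightarrow> real \<Rightarrow> real \<Rightarrow> real" where
  "regularized_kernel \<epsilon> r d =
     2 * (\<epsilon>\<^sup>2 + r - d\<^sup>2) / ((\<epsilon>\<^sup>2 + r - d\<^sup>2)\<^sup>2 + 4 * \<epsilon>\<^sup>2 * d\<^sup>2)"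

lemma regularized_kernel_denominator:
  fixes \<epsilon> r d :: real
  shows "(\<epsilon>\<^sup>2 + r - d\<^sup>2)\<^sup>2 + 4 * \<epsilon>\<^sup>2 * d\<^sup>2 = (r - d\<^sup>2)\<^sup>2 + \<epsilon> ^ 4 + 2 * \<epsilon>\<^sup>2 * (r + d\<^sup>2)"
  by (simp add: power2_eq_square power4_eq_xxxx algebra_simps)

lemma regularized_kernel_factored:
  fixes \<epsilon> \<rho> d :: real
  shows "(\<epsilon>\<^sup>2 + \<rho>\<^sup>2 - d\<^sup>2)\<^sup>2 + 4 * \<epsilon>\<^sup>2 * d\<^sup>2 = (\<epsilon>\<^sup>2 + (\<rho> + d)\<^sup>2) * (\<epsilon>\<^sup>2 + (\<rho> - d)\<^sup>2)"
  by (simp add: power2_eq_square algebra_simps)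

lemma abs_sinc_le_1: "\<bar>sinc x\<bar> \<le> 1"
  using abs_sin_x_le_abs_x[of x] by (auto simp: abs_divide divide_le_eq_1)

lemma power_spectrum_integrable:
  fixes \<epsilon> \<rho> d :: real
  assumes "\<epsilon> > 0"
  shows "integrable lborel (\<lambda>\<omega>. complex_of_real (\<bar>\<omega>\<bar> * exp (- \<epsilon> * \<bar>\<omega>\<bar>) * sinc (\<omega> * \<rho>)) * exp (\<i> * \<omega> * d))"
    (is "integrable lborel ?F")
proof -
  have [measurable]: "?F \<in> borel_measurable borel"
    by measurable
  have "integrable half_line (\<lambda>s. complex_of_real s * exp (- (of_real s * of_real \<epsilon>)))"
    using assms by (intro laplace_id_exp) simp
  then have i: "integrable half_line (\<lambda>s. s * exp (- \<epsilon> * s))"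
    by (subst complex_of_real_integrable_eq[symmetric]) (simp add: exp_of_real[symmetric] mult.commute)
  have b: "norm (?F s) \<le> \<bar>s\<bar> * exp (- \<epsilon> * \<bar>s\<bar>)" for s
    using mult_left_mono[OF abs_sinc_le_1[of "s * \<rho>"], of "\<bar>s\<bar> * exp (- \<epsilon> * \<bar>s\<bar>)"]
    by (simp add: norm_mult abs_mult del: mult_eq_0_iff) 
  define F where "F = ?F"
  have [measurable]: "F \<in> borel_measurable borel" and b: "norm (F s) \<le> \<bar>s\<bar> * exp (- \<epsilon> * \<bar>s\<bar>)" for s
    using b by (simp_all only: F_def \<open>?F \<in> borel_measurable borel\<close>)
  have "integrable half_line F" "integrable half_line (\<lambda>s. F (- s))"
  proof -
    have "norm (F s) \<le> norm (s * exp (- \<epsilon> * s))" "norm (F (- s)) \<le> norm (s * exp (- \<epsilon> * s))" if "s > 0" for s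
      using b[of s] b[of "- s"] that by (simp_all add: abs_mult)
    then show "integrable half_line F" "integrable half_line (\<lambda>s. F (- s))"
      by (auto intro!: Bochner_Integration.integrable_bound[OF i] AE_half_line[of 0])
  qed
  then have "integrable lborel F"
    by (subst integral_lborel_fold) simp_all
  then show ?thesis unfolding F_def .
qed

text \<open>
  With the factor \<open>|\<omega>|\<close> the cardinal sine becomes a sine, and folding \<open>\<omega>\<close> to the half-line
  leaves Laplace transforms of exponentials at the points \<open>\<epsilon> \<plusminus> i (\<rho> \<plusminus> d)\<close>. For \<open>\<rho> = 0\<close>, that is
  for coinciding points, the factor \<open>\<omega>\<close> remains and gives \<open>1 / (\<epsilon> \<plusminus> i d)\<^sup>2\<close>.
\<close>

lemma power_spectrum_integral:
  fixes \<epsilon> \<rho> d :: real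
  assumes "\<epsilon> > 0"
  shows "(\<integral>\<omega>. complex_of_real (\<bar>\<omega>\<bar> * exp (- \<epsilon> * \<bar>\<omega>\<bar>) * sinc (\<omega> * \<rho>)) * exp (\<i> * \<omega> * d) \<partial>lborel)
           = complex_of_real (regularized_kernel \<epsilon> (\<rho>\<^sup>2) d)"
    (is "integral\<^sup>L lborel ?F = _")
proof -
  have [measurable]: "?F \<in> borel_measurable borel"
    by measurable
  define E where "E = (\<lambda>z s. exp (- (complex_of_real s * z)))"
  define z where "z = (\<lambda>x. Complex \<epsilon> x)"
  have zp: "Re (z x) > 0" "z x \<noteq> 0" for x using assms by (auto simp: z_def complex_eq_iff)
  have inv: "1 / z (- x) - 1 / z x = 2 * \<i> * x / of_real (\<epsilon>\<^sup>2 + x\<^sup>2)" for x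
  proof -
    have "\<epsilon>\<^sup>2 + x\<^sup>2 \<noteq> 0" using assms by (metis add_pos_nonneg less_irrefl zero_le_power2 zero_less_power)
    then show ?thesis
      by (simp add: z_def complex_eq_iff Re_divide Im_divide power2_eq_square)
  qed
  have Eint: "integrable half_line (E (z x))" "(\<integral>s. E (z x) s \<partial>half_line) = 1 / z x" for x
    unfolding E_def using laplace_exp[OF zp(1)] by auto
  have "integral\<^sup>L lborel ?F = (\<integral>s. ?F s + ?F (- s) \<partial>half_line)"
    by (rule integral_lborel_fold(2)) (use power_spectrum_integrable[OF assms] in auto)
  also have "\<dots> = complex_of_real (regularized_kernel \<epsilon> (\<rho>\<^sup>2) d)"
  proof (cases "\<rho> = 0")
    case True
    have "(\<integral>s. ?F s + ?F (- s) \<partial>half_line) = (\<integral>s. of_real s * E (z d) s + of_real s * E (z (- d)) s \<partial>half_line)"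
      by (rule half_line_cong)
         (auto simp: True E_def z_def Complex_eq exp_of_real[symmetric] exp_add[symmetric] exp_diff[symmetric] algebra_simps)
    also have "\<dots> = 1 / (z d)\<^sup>2 + 1 / (z (- d))\<^sup>2"
      using laplace_id_exp[OF zp(1)[of d]] laplace_id_exp[OF zp(1)[of "-d"]] unfolding E_def
      by (subst Bochner_Integration.integral_add) simp_all
    also have "\<dots> = of_real (regularized_kernel \<epsilon> (\<rho>\<^sup>2) d)"
    proof -
      have eq: "(z d)\<^sup>2 * (z (-d))\<^sup>2 = of_real ((\<epsilon>\<^sup>2 + \<rho>\<^sup>2 - d\<^sup>2)\<^sup>2 + 4 * \<epsilon>\<^sup>2 * d\<^sup>2)"
        unfolding True z_def Complex_eq by (simp add: power2_eq_square algebra_simps complex_eq_iff)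
      have "1 / (z d)\<^sup>2 + 1 / (z (- d))\<^sup>2 = ((z d)\<^sup>2 + (z (-d))\<^sup>2) / ((z d)\<^sup>2 * (z (-d))\<^sup>2)"
        using zp(2) by (simp add: add_divide_distrib)
      also have "(z d)\<^sup>2 + (z (-d))\<^sup>2 = of_real (2 * (\<epsilon>\<^sup>2 + \<rho>\<^sup>2 - d\<^sup>2))"
        unfolding True z_def Complex_eq by (simp add: power2_eq_square algebra_simps complex_eq_iff)
      finally show ?thesis unfolding eq regularized_kernel_def by simp
    qed
    finally show ?thesis .
  next
    case False
    have "(\<integral>s. ?F s + ?F (- s) \<partial>half_line) =
        (\<integral>s. (1 / (2 * \<i> * \<rho>)) * ((E (z (- (\<rho> + d))) s - E (z (\<rho> + d)) s) + (E (z (- (\<rho> - d))) s - E (z (\<rho> - d)) s)) \<partial>half_line)"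
    proof (rule half_line_cong)
      fix s :: real assume s: "s > 0"
      have "?F s + ?F (- s) = of_real (exp (- \<epsilon> * s)) * of_real (sin (s * \<rho>)) / of_real \<rho> * (exp (\<i> * s * d) + exp (- (\<i> * s * d)))"
        using s False by (simp add: algebra_simps)
      also have "of_real (sin (s * \<rho>)) = (exp (\<i> * s * \<rho>) - exp (- (\<i> * s * \<rho>))) / (2 * \<i>)"
        by (simp add: sin_of_real[symmetric] sin_exp_eq mult.assoc)
      also have "of_real (exp (- \<epsilon> * s)) * ((exp (\<i> * s * \<rho>) - exp (- (\<i> * s * \<rho>))) / (2 * \<i>)) / of_real \<rho> * (exp (\<i> * s * d) + exp (- (\<i> * s * d)))
        = (1 / (2 * \<i> * \<rho>)) * (exp (- \<epsilon> * s) * exp (\<i> * s * \<rho>) * exp (\<i> * s * d) - exp (- \<epsilon> * s) * exp (- (\<i> * s * \<rho>)) * exp (- (\<i> * s * d))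
            + (exp (- \<epsilon> * s) * exp (\<i> * s * \<rho>) * exp (- (\<i> * s * d)) - exp (- \<epsilon> * s) * exp (- (\<i> * s * \<rho>)) * exp (\<i> * s * d)))"
        by (simp add: exp_of_real[symmetric] algebra_simps add_divide_distrib diff_divide_distrib)
      also have "\<dots> = (1 / (2 * \<i> * \<rho>)) * ((E (z (- (\<rho> + d))) s - E (z (\<rho> + d)) s) + (E (z (- (\<rho> - d))) s - E (z (\<rho> - d)) s))"
        unfolding E_def z_def Complex_eq exp_add[symmetric] exp_of_real[symmetric] by (simp add: algebra_simps)
      finally show "?F s + ?F (- s) = \<dots>" .
    qed
    also have "\<dots> = (1 / (2 * \<i> * \<rho>)) * ((1 / z (- (\<rho> + d)) - 1 / z (\<rho> + d)) + (1 / z (- (\<rho> - d)) - 1 / z (\<rho> - d)))"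
      by (simp add: Bochner_Integration.integral_add Bochner_Integration.integral_diff Eint del: minus_add_distrib minus_diff_eq)
    also have "\<dots> = of_real ((1 / \<rho>) * ((\<rho> + d) / (\<epsilon>\<^sup>2 + (\<rho> + d)\<^sup>2) + (\<rho> - d) / (\<epsilon>\<^sup>2 + (\<rho> - d)\<^sup>2)))"
      unfolding inv using False by (simp add: field_simps)
    also have "(1 / \<rho>) * ((\<rho> + d) / (\<epsilon>\<^sup>2 + (\<rho> + d)\<^sup>2) + (\<rho> - d) / (\<epsilon>\<^sup>2 + (\<rho> - d)\<^sup>2)) = regularized_kernel \<epsilon> (\<rho>\<^sup>2) d"
    proof -
      have nz: "\<epsilon>\<^sup>2 + (\<rho> + d)\<^sup>2 \<noteq> 0" "\<epsilon>\<^sup>2 + (\<rho> - d)\<^sup>2 \<noteq> 0"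
        using assms by (metis add_pos_nonneg less_irrefl zero_le_power2 zero_less_power)+
      have "(\<rho> + d) / (\<epsilon>\<^sup>2 + (\<rho> + d)\<^sup>2) + (\<rho> - d) / (\<epsilon>\<^sup>2 + (\<rho> - d)\<^sup>2)
        = ((\<rho> + d) * (\<epsilon>\<^sup>2 + (\<rho> - d)\<^sup>2) + (\<rho> - d) * (\<epsilon>\<^sup>2 + (\<rho> + d)\<^sup>2)) / ((\<epsilon>\<^sup>2 + (\<rho> + d)\<^sup>2) * (\<epsilon>\<^sup>2 + (\<rho> - d)\<^sup>2))"
        using nz by (simp add: add_frac_eq)
      also have "(\<rho> + d) * (\<epsilon>\<^sup>2 + (\<rho> - d)\<^sup>2) + (\<rho> - d) * (\<epsilon>\<^sup>2 + (\<rho> + d)\<^sup>2) = \<rho> * (2 * (\<epsilon>\<^sup>2 + \<rho>\<^sup>2 - d\<^sup>2))"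
        by (simp add: power2_eq_square algebra_simps)
      finally show ?thesis
        unfolding regularized_kernel_def regularized_kernel_factored using False by simp
    qed
    finally show ?thesis .
  qed
  finally show ?thesis .
qed

text \<open>
  In the expanded denominator all terms are nonnegative if \<open>r \<ge> 0\<close>. The last bound is uniform in
  \<open>\<epsilon>\<close> and provides the dominating functions as \<open>\<epsilon> \<rightarrow> 0\<close>; the bound by \<open>2 / \<epsilon>\<^sup>2\<close> gives
  integrability against test functions at fixed \<open>\<epsilon>\<close>.
\<close>

lemma regularized_kernel_bounds:
  fixes \<epsilon> r d :: real
  assumes e: "\<epsilon> > 0" and r: "r \<ge> 0"
  shows "(r - d\<^sup>2)\<^sup>2 + 2 * \<epsilon>\<^sup>2 * (r + d\<^sup>2) \<le> (\<epsilon>\<^sup>2 + r - d\<^sup>2)\<^sup>2 + 4 * \<epsilon>\<^sup>2 * d\<^sup>2"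
    and "\<bar>regularized_kernel \<epsilon> r d\<bar> \<le> 2 / \<epsilon>\<^sup>2"
    and "r \<noteq> d\<^sup>2 \<Longrightarrow> \<bar>regularized_kernel \<epsilon> r d\<bar> \<le> 2 / \<bar>r - d\<^sup>2\<bar>"
proof -
  let ?D = "(\<epsilon>\<^sup>2 + r - d\<^sup>2)\<^sup>2 + 4 * \<epsilon>\<^sup>2 * d\<^sup>2" and ?u = "\<epsilon>\<^sup>2 + r - d\<^sup>2"
  note eq = regularized_kernel_denominator[of \<epsilon> r d]
  have p: "2 * \<epsilon>\<^sup>2 * (r + d\<^sup>2) \<ge> 0" "\<epsilon> ^ 4 > 0" using r e by auto
  show "(r - d\<^sup>2)\<^sup>2 + 2 * \<epsilon>\<^sup>2 * (r + d\<^sup>2) \<le> ?D" unfolding eq using p by simp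
  have D: "?D > 0" unfolding eq using p zero_le_power2[of "r - d\<^sup>2"] by linarith
  have u: "?u\<^sup>2 \<le> ?D" using e by simp
  have q: "(r - d\<^sup>2)\<^sup>2 \<le> ?D" unfolding eq using p by linarith
  have e4: "(\<epsilon>\<^sup>2)\<^sup>2 \<le> ?D" unfolding eq using p zero_le_power2[of "r - d\<^sup>2"] by simp
  have main: "\<bar>regularized_kernel \<epsilon> r d\<bar> \<le> 2 / v" if "v > 0" "v\<^sup>2 \<le> ?D" for v
  proof -
    have "2 * (\<bar>?u\<bar> * v) \<le> \<bar>?u\<bar>\<^sup>2 + v\<^sup>2" using sum_squares_bound[of "\<bar>?u\<bar>" v] by (simp add: mult.assoc)
    then have "\<bar>?u\<bar> * v \<le> ?D" using u that(2) unfolding power2_abs by linarith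
    then show ?thesis using D that(1)
      unfolding regularized_kernel_def abs_divide abs_mult by (simp add: pos_divide_le_eq pos_le_divide_eq field_simps)
  qed
  show "\<bar>regularized_kernel \<epsilon> r d\<bar> \<le> 2 / \<epsilon>\<^sup>2" using main[of "\<epsilon>\<^sup>2"] e4 e by simp
  show "\<bar>regularized_kernel \<epsilon> r d\<bar> \<le> 2 / \<bar>r - d\<^sup>2\<bar>" if "r \<noteq> d\<^sup>2"
    using main[of "\<bar>r - d\<^sup>2\<bar>"] q that by simp
qed

lemma regularized_kernel_tendsto:
  assumes "r \<noteq> d\<^sup>2"
  shows "((\<lambda>\<epsilon>. regularized_kernel \<epsilon> r d) \<longlongrightarrow> 2 / (r - d\<^sup>2)) (at_right 0)"
proof -
  have "((\<lambda>\<epsilon>. regularized_kernel \<epsilon> r d) \<longlongrightarrow> 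
     2 * (0\<^sup>2 + r - d\<^sup>2) / ((0\<^sup>2 + r - d\<^sup>2)\<^sup>2 + 4 * 0\<^sup>2 * d\<^sup>2)) (at_right 0)"
    unfolding regularized_kernel_def using assms by (intro tendsto_intros) auto
  moreover have "2 * (0\<^sup>2 + r - d\<^sup>2) / ((0\<^sup>2 + r - d\<^sup>2)\<^sup>2 + 4 * 0\<^sup>2 * d\<^sup>2) = 2 / (r - d\<^sup>2)"
    using assms by (simp add: power2_eq_square divide_simps)
  ultimately show ?thesis by simp
qed

section \<open>Test functions\<close>

lemma iter_deriv_0 [simp]: "iter_deriv 0 \<phi> = \<phi>"
  by (simp add: iter_deriv_def)

lemma iter_deriv_Suc: "iter_deriv (Suc n) \<phi> = (\<lambda>x. vector_derivative (iter_deriv n \<phi>) (at x))"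
  by (simp add: iter_deriv_def)

lemma schwartz_has_vector_derivative:
  assumes "schwartz \<phi>"
  shows "(iter_deriv n \<phi> has_vector_derivative iter_deriv (Suc n) \<phi> x) (at x)"
  using assms by (simp add: schwartz_def iter_deriv_Suc vector_derivative_works[symmetric])

lemma schwartz_continuous:
  assumes "schwartz \<phi>" shows "isCont (iter_deriv n \<phi>) x"
  using schwartz_has_vector_derivative[OF assms] has_vector_derivative_continuous by blast

lemma schwartz_measurable:
  assumes "schwartz \<phi>" shows "iter_deriv n \<phi> \<in> borel_measurable borel"
  using schwartz_continuous[OF assms]
  by (intro borel_measurable_continuous_onI continuous_at_imp_continuous_on) auto

lemma schwartz_seminorm_upper:
  assumes "schwartz \<phi>"
  shows "norm (x ^ k *\<^sub>R iter_deriv n \<phi> x) \<le> schwartz_seminorm k n \<phi>"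
proof -
  have "bounded (range (\<lambda>x. x ^ k *\<^sub>R iter_deriv n \<phi> x))"
    using assms by (auto simp: schwartz_def)
  then have "bdd_above (range (\<lambda>x. norm (x ^ k *\<^sub>R iter_deriv n \<phi> x)))"
    unfolding bounded_iff bdd_above_def by blast
  then show ?thesis unfolding schwartz_seminorm_def by (rule cSUP_upper[rotated]) simp
qed

text \<open>
  A single seminorm that dominates all those used below: derivatives up to the second order
  of test functions, and the decay \<open>1 / (1 + x\<^sup>2)\<^sup>2\<close>.
\<close>

definition schwartz_size :: "(real \<Rightarrow> complex) \<Rightarrow> real" where
  "schwartz_size \<phi> = (\<Sum>k\<le>4. \<Sum>n\<le>4. schwartz_seminorm k n \<phi>)"

lemma schwartz_size_upper:
  assumes "schwartz \<phi>" "k \<le> 4" "n \<le> 4"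
  shows "norm (x ^ k *\<^sub>R iter_deriv n \<phi> x) \<le> schwartz_size \<phi>"
proof -
  have nn: "0 \<le> schwartz_seminorm k n \<phi>" for k n
    using schwartz_seminorm_upper[OF assms(1), of 0 k n] norm_ge_zero order_trans by blast
  have "schwartz_seminorm k n \<phi> \<le> (\<Sum>n\<le>4. schwartz_seminorm k n \<phi>)"
    using assms nn by (intro member_le_sum) auto
  also have "\<dots> \<le> schwartz_size \<phi>"
    unfolding schwartz_size_def using assms nn
    by (intro member_le_sum[where f="\<lambda>k. \<Sum>n\<le>4. schwartz_seminorm k n \<phi>"] sum_nonneg) auto
  finally show ?thesis using schwartz_seminorm_upper[OF assms(1), of x k n] by linarith
qed

lemma integrable_inverse_square: "integrable lborel (\<lambda>x::real. C * (1 / (1 + x\<^sup>2)))"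
proof (rule integrable_mult_right)
  show "integrable lborel (\<lambda>x::real. 1 / (1 + x\<^sup>2))"
    using integrable_inverse_1_plus_square by (simp add: set_integrable_def inverse_eq_divide)
qed

lemma schwartz_decay:
  assumes "schwartz \<phi>" "n \<le> 4"
  shows "(1 + x\<^sup>2) * norm (iter_deriv n \<phi> x) \<le> 4 * schwartz_size \<phi> * (1 / (1 + x\<^sup>2))"
proof -
  let ?p = "norm (iter_deriv n \<phi> x)"
  have "?p \<le> schwartz_size \<phi>" "x\<^sup>2 * ?p \<le> schwartz_size \<phi>" "x ^ 4 * ?p \<le> schwartz_size \<phi>"
    using schwartz_size_upper[OF assms(1) _ assms(2), of 0 x] schwartz_size_upper[OF assms(1) _ assms(2), of 2 x]
      schwartz_size_upper[OF assms(1) _ assms(2), of 4 x] by simp_all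
  moreover have "((1 + x\<^sup>2) * ?p) * (1 + x\<^sup>2) = ?p + 2 * (x\<^sup>2 * ?p) + x ^ 4 * ?p"
    by (simp add: power2_eq_square power4_eq_xxxx algebra_simps)
  ultimately have "((1 + x\<^sup>2) * ?p) * (1 + x\<^sup>2) \<le> 4 * schwartz_size \<phi>" by linarith
  then have "(1 + x\<^sup>2) * ?p \<le> 4 * schwartz_size \<phi> / (1 + x\<^sup>2)"
    by (subst pos_le_divide_eq) (auto intro: add_pos_nonneg)
  then show ?thesis by simp
qed

lemma schwartz_moment_integrable:
  assumes "schwartz \<phi>" "n \<le> 4"
  shows "integrable lborel (\<lambda>x. (1 + x\<^sup>2) *\<^sub>R iter_deriv n \<phi> x)"
proof (rule Bochner_Integration.integrable_bound[OF integrable_inverse_square[of "4 * schwartz_size \<phi>"]])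
  show "(\<lambda>x. (1 + x\<^sup>2) *\<^sub>R iter_deriv n \<phi> x) \<in> borel_measurable lborel"
    using schwartz_measurable[OF assms(1)] by measurable
  have "norm ((1 + x\<^sup>2) *\<^sub>R iter_deriv n \<phi> x) \<le> 4 * schwartz_size \<phi> * (1 / (1 + x\<^sup>2))" for x
    using schwartz_decay[OF assms, of x] by (simp add: abs_of_nonneg)
  then show "AE x in lborel. norm ((1 + x\<^sup>2) *\<^sub>R iter_deriv n \<phi> x) \<le> norm (4 * schwartz_size \<phi> * (1 / (1 + x\<^sup>2)))"
    unfolding real_norm_def by (intro AE_I2 order_trans[OF _ abs_ge_self])
qed

lemma schwartz_integrable_times:
  fixes h :: "real \<Rightarrow> complex"
  assumes "schwartz \<phi>" "n \<le> 4" "h \<in> borel_measurable borel" "\<And>x. norm (h x) \<le> K * (1 + x\<^sup>2)"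
  shows "integrable lborel (\<lambda>x. h x * iter_deriv n \<phi> x)"
proof (rule Bochner_Integration.integrable_bound)
  show "integrable lborel (\<lambda>x. K *\<^sub>R ((1 + x\<^sup>2) *\<^sub>R iter_deriv n \<phi> x))"
    using schwartz_moment_integrable[OF assms(1,2)] by (rule integrable_scaleR_right)
  show "(\<lambda>x. h x * iter_deriv n \<phi> x) \<in> borel_measurable lborel"
    using schwartz_measurable[OF assms(1)] assms(3) by measurable
  have "norm (h x * iter_deriv n \<phi> x) \<le> norm (K *\<^sub>R ((1 + x\<^sup>2) *\<^sub>R iter_deriv n \<phi> x))" for x
  proof -
    have "norm (h x * iter_deriv n \<phi> x) \<le> K * (1 + x\<^sup>2) * norm (iter_deriv n \<phi> x)"
      unfolding norm_mult by (intro mult_right_mono assms) simp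
    also have "\<dots> \<le> \<bar>K\<bar> * (1 + x\<^sup>2) * norm (iter_deriv n \<phi> x)"
      by (intro mult_right_mono) (auto intro: mult_right_mono)
    finally show ?thesis by (simp add: abs_mult abs_of_nonneg)
  qed
  then show "AE x in lborel. norm (h x * iter_deriv n \<phi> x) \<le> norm (K *\<^sub>R ((1 + x\<^sup>2) *\<^sub>R iter_deriv n \<phi> x))"
    by simp
qed

lemma schwartz_norm_moment_integrable:
  assumes "schwartz \<phi>"
  shows "integrable lborel (\<lambda>x. (1 + x\<^sup>2) * norm (\<phi> x))"
  using integrable_norm[OF schwartz_moment_integrable[OF assms, of 0]] by (simp add: abs_of_nonneg)

text \<open>
  The part of the Schwartz topology that the kernels see. Unlike the Schwartz space, this class
  contains the oscillations \<open>exp (i \<omega> x)\<close>, with the bound \<open>1 + \<omega>\<^sup>2\<close>; hence one estimate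
  controls the limit \<open>\<epsilon> \<rightarrow> 0\<close> on test functions and the growth of the spectrum in \<open>\<omega>\<close>.
\<close>

definition C2_bounded :: "(real \<Rightarrow> complex) \<Rightarrow> real \<Rightarrow> bool" where
  "C2_bounded \<phi> B \<longleftrightarrow> (\<exists>\<phi>' \<phi>''. \<forall>x.
     (\<phi> has_vector_derivative \<phi>' x) (at x) \<and> (\<phi>' has_vector_derivative \<phi>'' x) (at x) \<and>
     norm (\<phi> x) \<le> B \<and> norm (\<phi>' x) \<le> B \<and> norm (\<phi>'' x) \<le> B)"

lemma schwartz_C2_bounded:
  assumes "schwartz \<phi>" shows "C2_bounded \<phi> (schwartz_size \<phi>)"
  unfolding C2_bounded_def
proof (intro exI allI conjI)
  fix x
  show "(\<phi> has_vector_derivative iter_deriv 1 \<phi> x) (at x)"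
    "(iter_deriv 1 \<phi> has_vector_derivative iter_deriv 2 \<phi> x) (at x)"
    using schwartz_has_vector_derivative[OF assms, of 0 x] schwartz_has_vector_derivative[OF assms, of 1 x]
    by (simp_all add: numeral_2_eq_2)
  show "norm (\<phi> x) \<le> schwartz_size \<phi>" "norm (iter_deriv 1 \<phi> x) \<le> schwartz_size \<phi>"
    "norm (iter_deriv 2 \<phi> x) \<le> schwartz_size \<phi>"
    using schwartz_size_upper[OF assms, of 0 0 x] schwartz_size_upper[OF assms, of 0 1 x]
      schwartz_size_upper[OF assms, of 0 2 x] by simp_all
qed

lemma oscillation_C2_bounded: "C2_bounded (\<lambda>x. exp (\<i> * of_real \<omega> * of_real x)) (1 + \<omega>\<^sup>2)"
proof -
  have 1: "\<bar>\<omega>\<bar> \<le> 1 + \<omega>\<^sup>2"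
    using sum_squares_bound[of "\<bar>\<omega>\<bar>" 1] abs_ge_zero[of \<omega>] unfolding power2_abs one_power2 by linarith
  have d: "((\<lambda>x. c * exp (\<i> * of_real \<omega> * of_real x)) has_vector_derivative \<i> * of_real \<omega> * c * exp (\<i> * of_real \<omega> * of_real x)) (at x)"
    for c x
    by (rule has_vector_derivative_real_field[where f="\<lambda>w. c * exp (\<i> * of_real \<omega> * w)"])
       (auto intro!: derivative_eq_intros)
  show ?thesis
    unfolding C2_bounded_def
    using d[of 1] d[of "\<i> * of_real \<omega>"] 1
    by (intro exI[of _ "\<lambda>x. \<i> * of_real \<omega> * exp (\<i> * of_real \<omega> * of_real x)"]
          exI[of _ "\<lambda>x. \<i> * of_real \<omega> * (\<i> * of_real \<omega>) * exp (\<i> * of_real \<omega> * of_real x)"])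
       (auto simp: norm_mult power2_eq_square)
qed

section \<open>Limits of kernels and their spectra\<close>

text \<open>
  The Fourier transform of the limit is the function \<open>h\<close> plus \<open>m\<close> times the Dirac mass at \<open>0\<close>.
\<close>

definition spectral_limit :: "(real \<Rightarrow> real \<Rightarrow> real) \<Rightarrow> (real \<Rightarrow> complex) \<Rightarrow> complex \<Rightarrow> bool" where
  "spectral_limit g h m \<longleftrightarrow>
     (\<exists>D. tempered_limit (\<lambda>\<epsilon> s. complex_of_real (g \<epsilon> s)) D (at_right 0) \<and>
          (\<forall>\<phi>. schwartz \<phi> \<longrightarrow> D (fourier \<phi>) = (\<integral>\<omega>. h \<omega> * \<phi> \<omega> \<partial>lborel) + m * \<phi> 0)) \<and>
     h \<in> borel_measurable borel \<and> (\<exists>K. \<forall>\<omega>. norm (h \<omega>) \<le> K * (1 + \<omega>\<^sup>2))"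

lemma spectral_limit_diff:
  assumes 1: "spectral_limit g1 h1 m1" and 2: "spectral_limit g2 h2 m2"
  shows "spectral_limit (\<lambda>\<epsilon> s. C * (g1 \<epsilon> s - g2 \<epsilon> s)) (\<lambda>\<omega>. of_real C * (h1 \<omega> - h2 \<omega>)) (of_real C * (m1 - m2))"
proof -
  obtain D1 K1 where D1: "tempered_limit (\<lambda>\<epsilon> s. complex_of_real (g1 \<epsilon> s)) D1 (at_right 0)"
    "\<And>\<phi>. schwartz \<phi> \<Longrightarrow> D1 (fourier \<phi>) = (\<integral>\<omega>. h1 \<omega> * \<phi> \<omega> \<partial>lborel) + m1 * \<phi> 0"
    and [measurable]: "h1 \<in> borel_measurable borel" and K1: "\<And>\<omega>. norm (h1 \<omega>) \<le> K1 * (1 + \<omega>\<^sup>2)"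
    using 1 unfolding spectral_limit_def by blast
  obtain D2 K2 where D2: "tempered_limit (\<lambda>\<epsilon> s. complex_of_real (g2 \<epsilon> s)) D2 (at_right 0)"
    "\<And>\<phi>. schwartz \<phi> \<Longrightarrow> D2 (fourier \<phi>) = (\<integral>\<omega>. h2 \<omega> * \<phi> \<omega> \<partial>lborel) + m2 * \<phi> 0"
    and [measurable]: "h2 \<in> borel_measurable borel" and K2: "\<And>\<omega>. norm (h2 \<omega>) \<le> K2 * (1 + \<omega>\<^sup>2)"
    using 2 unfolding spectral_limit_def by blast
  let ?D = "\<lambda>\<phi>. of_real C * (D1 \<phi> - D2 \<phi>)"
  have td: "tempered_distribution ?D"
  proof -
    have t: "tempered_distribution D1" "tempered_distribution D2"
      using D1 D2 by (auto simp: tempered_limit_def)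
    obtain A1 N1 where A1: "\<And>\<phi>. schwartz \<phi> \<Longrightarrow> norm (D1 \<phi>) \<le> A1 * (\<Sum>k\<le>N1. \<Sum>n\<le>N1. schwartz_seminorm k n \<phi>)"
      using t(1) unfolding tempered_distribution_def by blast
    obtain A2 N2 where A2: "\<And>\<phi>. schwartz \<phi> \<Longrightarrow> norm (D2 \<phi>) \<le> A2 * (\<Sum>k\<le>N2. \<Sum>n\<le>N2. schwartz_seminorm k n \<phi>)"
      using t(2) unfolding tempered_distribution_def by blast
    define N where "N = max N1 N2"
    have mono: "A * (\<Sum>k\<le>M. \<Sum>n\<le>M. schwartz_seminorm k n \<phi>) \<le> \<bar>A\<bar> * (\<Sum>k\<le>N. \<Sum>n\<le>N. schwartz_seminorm k n \<phi>)"
      if "schwartz \<phi>" "M \<le> N" for A M \<phi>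
    proof -
      have nn: "0 \<le> schwartz_seminorm k n \<phi>" for k n
        using schwartz_seminorm_upper[OF that(1), of 0 k n] norm_ge_zero order_trans by blast
      have "(\<Sum>k\<le>M. \<Sum>n\<le>M. schwartz_seminorm k n \<phi>) \<le> (\<Sum>k\<le>M. \<Sum>n\<le>N. schwartz_seminorm k n \<phi>)"
        using that nn by (intro sum_mono sum_mono2) auto
      also have "\<dots> \<le> (\<Sum>k\<le>N. \<Sum>n\<le>N. schwartz_seminorm k n \<phi>)"
        using that nn by (intro sum_mono2 sum_nonneg) auto
      finally have "\<bar>A\<bar> * (\<Sum>k\<le>M. \<Sum>n\<le>M. schwartz_seminorm k n \<phi>) \<le> \<bar>A\<bar> * (\<Sum>k\<le>N. \<Sum>n\<le>N. schwartz_seminorm k n \<phi>)"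
        by (intro mult_left_mono) auto
      moreover have "A * (\<Sum>k\<le>M. \<Sum>n\<le>M. schwartz_seminorm k n \<phi>) \<le> \<bar>A\<bar> * (\<Sum>k\<le>M. \<Sum>n\<le>M. schwartz_seminorm k n \<phi>)"
        using nn by (intro mult_right_mono sum_nonneg) auto
      ultimately show ?thesis by linarith
    qed
    have "norm (?D \<phi>) \<le> \<bar>C\<bar> * (\<bar>A1\<bar> + \<bar>A2\<bar>) * (\<Sum>k\<le>N. \<Sum>n\<le>N. schwartz_seminorm k n \<phi>)" if "schwartz \<phi>" for \<phi>
    proof -
      have "norm (D1 \<phi> - D2 \<phi>) \<le> (\<bar>A1\<bar> + \<bar>A2\<bar>) * (\<Sum>k\<le>N. \<Sum>n\<le>N. schwartz_seminorm k n \<phi>)"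
        using norm_triangle_ineq4[of "D1 \<phi>" "D2 \<phi>"] A1[OF that] A2[OF that]
          mono[OF that, of N1 A1] mono[OF that, of N2 A2] by (simp add: N_def distrib_right)
      then show ?thesis by (simp add: norm_mult mult.assoc mult_left_mono)
    qed
    moreover have "?D (\<lambda>x. a * \<phi> x + b * \<psi> x) = a * ?D \<phi> + b * ?D \<psi>" if "schwartz \<phi>" "schwartz \<psi>" for \<phi> \<psi> a b
      using t that unfolding tempered_distribution_def by (simp add: algebra_simps)
    ultimately show ?thesis unfolding tempered_distribution_def by blast
  qed
  have tl: "tempered_limit (\<lambda>\<epsilon> s. complex_of_real (C * (g1 \<epsilon> s - g2 \<epsilon> s))) ?D (at_right 0)"
    unfolding tempered_limit_def
  proof (intro conjI allI impI td)
    fix \<phi> assume \<phi>: "schwartz \<phi>"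
    have i: "\<forall>\<^sub>F i in at_right 0. integrable lborel (\<lambda>s. of_real (g1 i s) * \<phi> s) \<and> integrable lborel (\<lambda>s. of_real (g2 i s) * \<phi> s)"
      using D1(1) D2(1) \<phi> unfolding tempered_limit_def by (auto intro: eventually_conj)
    have eq: "(\<lambda>s. complex_of_real (C * (g1 i s - g2 i s)) * \<phi> s) = (\<lambda>s. of_real C * (of_real (g1 i s) * \<phi> s - of_real (g2 i s) * \<phi> s))" for i
      by (simp add: fun_eq_iff algebra_simps)
    show "\<forall>\<^sub>F i in at_right 0. integrable lborel (\<lambda>s. complex_of_real (C * (g1 i s - g2 i s)) * \<phi> s)"
      unfolding eq using i by eventually_elim auto
    have "((\<lambda>i. of_real C * ((\<integral>s. of_real (g1 i s) * \<phi> s \<partial>lborel) - (\<integral>s. of_real (g2 i s) * \<phi> s \<partial>lborel))) \<longlongrightarrow> ?D \<phi>) (at_right 0)"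
      using D1(1) D2(1) \<phi> unfolding tempered_limit_def by (intro tendsto_intros) auto
    then show "((\<lambda>i. \<integral>s. complex_of_real (C * (g1 i s - g2 i s)) * \<phi> s \<partial>lborel) \<longlongrightarrow> ?D \<phi>) (at_right 0)"
      by (rule Lim_transform_eventually) (use i in eventually_elim, unfold eq, auto)
  qed
  have "?D (fourier \<phi>) = (\<integral>\<omega>. of_real C * (h1 \<omega> - h2 \<omega>) * \<phi> \<omega> \<partial>lborel) + of_real C * (m1 - m2) * \<phi> 0" if \<phi>: "schwartz \<phi>" for \<phi>
  proof -
    have "integrable lborel (\<lambda>\<omega>. h1 \<omega> * \<phi> \<omega>)" "integrable lborel (\<lambda>\<omega>. h2 \<omega> * \<phi> \<omega>)"
      using schwartz_integrable_times[OF \<phi>, of 0 h1] schwartz_integrable_times[OF \<phi>, of 0 h2] K1 K2 by auto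
    then have "(\<integral>\<omega>. of_real C * (h1 \<omega> * \<phi> \<omega> - h2 \<omega> * \<phi> \<omega>) \<partial>lborel) = of_real C * ((\<integral>\<omega>. h1 \<omega> * \<phi> \<omega> \<partial>lborel) - (\<integral>\<omega>. h2 \<omega> * \<phi> \<omega> \<partial>lborel))"
      by simp
    then show ?thesis using D1(2)[OF \<phi>] D2(2)[OF \<phi>] by (simp add: algebra_simps)
  qed
  moreover have "norm (of_real C * (h1 \<omega> - h2 \<omega>)) \<le> (\<bar>C\<bar> * (K1 + K2)) * (1 + \<omega>\<^sup>2)" for \<omega>
  proof -
    have "norm (h1 \<omega> - h2 \<omega>) \<le> (K1 + K2) * (1 + \<omega>\<^sup>2)"
      using norm_triangle_ineq4[of "h1 \<omega>" "h2 \<omega>"] K1[of \<omega>] K2[of \<omega>] by (simp add: distrib_right)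
    then show ?thesis by (simp add: norm_mult mult.assoc mult_left_mono)
  qed
  ultimately show ?thesis
    unfolding spectral_limit_def using tl by (intro conjI) (blast, measurable, blast)
qed

lemma C2_bounded_continuous: "C2_bounded \<phi> B \<Longrightarrow> isCont \<phi> x"
  unfolding C2_bounded_def using has_vector_derivative_continuous by blast

lemma C2_bounded_measurable: "C2_bounded \<phi> B \<Longrightarrow> \<phi> \<in> borel_measurable borel"
  using C2_bounded_continuous
  by (intro borel_measurable_continuous_onI continuous_at_imp_continuous_on) auto

text \<open>
  The transform \<open>fourier \<phi>\<close> is a superposition of oscillations with weights \<open>\<phi> \<omega>\<close>; by Fubini the
  functional may be applied to the oscillations first. The bound has integrable dependence on \<open>s\<close>
  and quadratic growth in \<open>\<omega>\<close>, which the decay of \<open>\<phi>\<close> compensates.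
\<close>

lemma kernel_duality:
  fixes N :: "real measure" and c0 x :: "'j \<Rightarrow> real \<Rightarrow> real"
  assumes N: "sigma_finite_measure N"
    and c0 [measurable]: "\<And>j. c0 j \<in> borel_measurable N" and x [measurable]: "\<And>j. x j \<in> borel_measurable N"
    and b: "integrable N b"
    and bound: "AE s in N. \<forall>\<omega>. norm (\<Sum>j\<in>J. c0 j s *\<^sub>R exp (\<i> * of_real \<omega> * of_real (x j s))) \<le> b s * (1 + \<omega>\<^sup>2)"
    and \<phi>: "schwartz \<phi>"
  shows "(\<integral>s. (\<Sum>j\<in>J. c0 j s *\<^sub>R fourier \<phi> (x j s)) \<partial>N) =
    (\<integral>\<omega>. (\<integral>s. (\<Sum>j\<in>J. c0 j s *\<^sub>R exp (\<i> * of_real \<omega> * of_real (x j s))) \<partial>N) * \<phi> \<omega> \<partial>lborel)"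
proof -
  interpret N: sigma_finite_measure N by (rule N)
  interpret P: pair_sigma_finite N lborel ..
  define K where "K = (\<lambda>\<phi> s. \<Sum>j\<in>J. c0 j s *\<^sub>R \<phi> (x j s) :: complex)"
  define e where "e = (\<lambda>\<omega> x. exp (\<i> * of_real \<omega> * of_real x) :: complex)"
  have bound: "AE s in N. \<forall>\<omega>. norm (K (e \<omega>) s) \<le> b s * (1 + \<omega>\<^sup>2)"
    using bound unfolding K_def e_def .
  have [measurable]: "\<phi> \<in> borel_measurable borel" using schwartz_measurable[OF \<phi>, of 0] by simp
  have int_e: "integrable lborel (\<lambda>\<omega>. \<phi> \<omega> * e \<omega> y)" for y
    using schwartz_integrable_times[OF \<phi>, of 0 "\<lambda>\<omega>. e \<omega> y" 1]
    by (simp add: e_def mult.commute add_increasing2)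
  have mp: "(\<lambda>(s, \<omega>). K (e \<omega>) s * \<phi> \<omega>) \<in> borel_measurable (N \<Otimes>\<^sub>M lborel)"
    unfolding K_def e_def by measurable
  have le: "AE s in N. \<forall>\<omega>. norm (K (e \<omega>) s * \<phi> \<omega>) \<le> b s * ((1 + \<omega>\<^sup>2) * norm (\<phi> \<omega>))"
    using bound
  proof eventually_elim
    case (elim s)
    show ?case
      unfolding norm_mult mult.assoc[symmetric] using elim by (intro allI mult_right_mono) auto
  qed
  have prod: "K (e \<omega>) s * \<phi> \<omega> = (\<Sum>j\<in>J. c0 j s *\<^sub>R (\<phi> \<omega> * e \<omega> (x j s)))" for \<omega> s
    by (simp add: K_def sum_distrib_right sum_distrib_left scaleR_conv_of_real mult_ac)
  have int_s: "integrable lborel (\<lambda>\<omega>. K (e \<omega>) s * \<phi> \<omega>)" for s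
    unfolding prod by (intro Bochner_Integration.integrable_sum integrable_scaleR_right int_e)
  have int_P: "integrable (N \<Otimes>\<^sub>M lborel) (\<lambda>(s, \<omega>). K (e \<omega>) s * \<phi> \<omega>)"
  proof (rule P.Fubini_integrable[OF mp])
    let ?m = "\<integral>\<omega>. (1 + \<omega>\<^sup>2) * norm (\<phi> \<omega>) \<partial>lborel"
    show "integrable N (\<lambda>s. \<integral>\<omega>. norm (case (s, \<omega>) of (s, \<omega>) \<Rightarrow> K (e \<omega>) s * \<phi> \<omega>) \<partial>lborel)"
    proof (rule Bochner_Integration.integrable_bound)
      show "integrable N (\<lambda>s. b s * ?m)" using b by simp
      show "(\<lambda>s. \<integral>\<omega>. norm (case (s, \<omega>) of (s, \<omega>) \<Rightarrow> K (e \<omega>) s * \<phi> \<omega>) \<partial>lborel) \<in> borel_measurable N"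
        using mp by measurable
      show "AE s in N. norm (\<integral>\<omega>. norm (case (s, \<omega>) of (s, \<omega>) \<Rightarrow> K (e \<omega>) s * \<phi> \<omega>) \<partial>lborel) \<le> norm (b s * ?m)"
        using le
      proof eventually_elim
        case (elim s)
        have "(\<integral>\<omega>. norm (K (e \<omega>) s * \<phi> \<omega>) \<partial>lborel) \<le> (\<integral>\<omega>. b s * ((1 + \<omega>\<^sup>2) * norm (\<phi> \<omega>)) \<partial>lborel)"
          using elim int_s schwartz_norm_moment_integrable[OF \<phi>]
          by (intro Bochner_Integration.integral_mono) auto
        then have "(\<integral>\<omega>. norm (K (e \<omega>) s * \<phi> \<omega>) \<partial>lborel) \<le> b s * ?m" by simp
        then show ?case by (auto simp: abs_of_nonneg intro: order_trans[OF _ abs_ge_self])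
      qed
    qed
    show "AE s in N. integrable lborel (\<lambda>\<omega>. case (s, \<omega>) of (s, \<omega>) \<Rightarrow> K (e \<omega>) s * \<phi> \<omega>)"
      using int_s by simp
  qed
  have "(\<integral>s. K (fourier \<phi>) s \<partial>N) = (\<integral>s. (\<integral>\<omega>. K (e \<omega>) s * \<phi> \<omega> \<partial>lborel) \<partial>N)"
  proof (rule Bochner_Integration.integral_cong)
    fix s
    have "K (fourier \<phi>) s = (\<Sum>j\<in>J. c0 j s *\<^sub>R (\<integral>\<omega>. \<phi> \<omega> * e \<omega> (x j s) \<partial>lborel))"
      by (simp add: K_def fourier_def e_def)
    also have "\<dots> = (\<integral>\<omega>. (\<Sum>j\<in>J. c0 j s *\<^sub>R (\<phi> \<omega> * e \<omega> (x j s))) \<partial>lborel)"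
      using int_e by (subst Bochner_Integration.integral_sum) auto
    also have "\<dots> = (\<integral>\<omega>. K (e \<omega>) s * \<phi> \<omega> \<partial>lborel)"
      unfolding prod ..
    finally show "K (fourier \<phi>) s = (\<integral>\<omega>. K (e \<omega>) s * \<phi> \<omega> \<partial>lborel)" .
  qed simp
  also have "\<dots> = (\<integral>\<omega>. (\<integral>s. K (e \<omega>) s * \<phi> \<omega> \<partial>N) \<partial>lborel)"
    using P.Fubini_integral[OF int_P] by simp
  also have "\<dots> = (\<integral>\<omega>. (\<integral>s. K (e \<omega>) s \<partial>N) * \<phi> \<omega> \<partial>lborel)" by simp
  finally show ?thesis unfolding K_def e_def .
qed

text \<open>
  Dominated convergence gives the limit functional, and duality its spectrum. The coefficients
  \<open>c \<epsilon> j\<close> may be singular separately: only the bound on the whole combination enters, so the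
  points \<open>x j\<close> can be chosen such that singular contributions meet and cancel.
\<close>

lemma spectral_limit_of_kernel:
  fixes N :: "real measure" and c :: "real \<Rightarrow> 'j \<Rightarrow> real \<Rightarrow> real" and x :: "'j \<Rightarrow> real \<Rightarrow> real"
  assumes N: "sigma_finite_measure N" and J: "finite J"
    and c [measurable]: "\<And>\<epsilon> j. c \<epsilon> j \<in> borel_measurable N"
    and c0 [measurable]: "\<And>j. c0 j \<in> borel_measurable N"
    and x [measurable]: "\<And>j. x j \<in> borel_measurable N"
    and b: "integrable N b"
    and bound: "\<And>\<epsilon> \<phi> B s. \<epsilon> > 0 \<Longrightarrow> s \<in> space N \<Longrightarrow> C2_bounded \<phi> B \<Longrightarrow>
                  norm (\<Sum>j\<in>J. c \<epsilon> j s *\<^sub>R \<phi> (x j s)) \<le> b s * B"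
    and conv: "AE s in N. \<forall>j\<in>J. ((\<lambda>\<epsilon>. c \<epsilon> j s) \<longlongrightarrow> c0 j s) (at_right 0)"
    and g_int: "\<And>\<epsilon> \<phi>. \<epsilon> > 0 \<Longrightarrow> schwartz \<phi> \<Longrightarrow> integrable lborel (\<lambda>s. complex_of_real (g \<epsilon> s) * \<phi> s)"
    and g_eq: "\<And>\<epsilon> \<phi>. \<epsilon> > 0 \<Longrightarrow> schwartz \<phi> \<Longrightarrow>
         (\<integral>s. complex_of_real (g \<epsilon> s) * \<phi> s \<partial>lborel) = (\<integral>s. (\<Sum>j\<in>J. c \<epsilon> j s *\<^sub>R \<phi> (x j s)) \<partial>N)"
  shows "spectral_limit g (\<lambda>\<omega>. \<integral>s. (\<Sum>j\<in>J. c0 j s *\<^sub>R exp (\<i> * of_real \<omega> * of_real (x j s))) \<partial>N) 0"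
proof -
  interpret N: sigma_finite_measure N by (rule N)
  define K where "K = (\<lambda>\<phi> s. \<Sum>j\<in>J. c0 j s *\<^sub>R \<phi> (x j s) :: complex)"
  define D where "D = (\<lambda>\<phi>. \<integral>s. K \<phi> s \<partial>N)"
  define e where "e = (\<lambda>\<omega> x. exp (\<i> * of_real \<omega> * of_real x) :: complex)"
  have conv_K: "AE s in N. \<forall>\<phi>. ((\<lambda>\<epsilon>. \<Sum>j\<in>J. c \<epsilon> j s *\<^sub>R \<phi> (x j s)) \<longlongrightarrow> K \<phi> s) (at_right 0)"
    using conv by eventually_elim (auto simp: K_def intro!: tendsto_intros)
  have bound_K: "AE s in N. \<forall>\<phi> B. C2_bounded \<phi> B \<longrightarrow> norm (K \<phi> s) \<le> b s * B"
    using conv_K AE_space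
  proof eventually_elim
    case (elim s)
    show ?case
    proof (intro allI impI)
      fix \<phi> B assume "C2_bounded \<phi> B"
      then show "norm (K \<phi> s) \<le> b s * B"
        using elim bound
        by (intro Lim_norm_ubound[OF _ elim(1)[rule_format]])
           (auto simp: eventually_at_right_less intro: eventually_mono[OF eventually_at_right_less])
    qed
  qed
  have meas_K [measurable]: "K \<phi> \<in> borel_measurable N" if "C2_bounded \<phi> B" for \<phi> B
  proof -
    have [measurable]: "\<phi> \<in> borel_measurable borel" using C2_bounded_measurable[OF that] .
    show ?thesis unfolding K_def by measurable
  qed
  have int_K: "integrable N (K \<phi>)" "norm (D \<phi>) \<le> (\<integral>s. b s \<partial>N) * B" if "C2_bounded \<phi> B" for \<phi> B
  proof -
    have bB: "integrable N (\<lambda>s. b s * B)" using b by simp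
    show i: "integrable N (K \<phi>)"
      by (rule Bochner_Integration.integrable_bound[OF bB meas_K[OF that]])
         (rule eventually_mono[OF bound_K], use that in \<open>auto intro: order_trans[OF _ abs_ge_self]\<close>)
    have "norm (D \<phi>) \<le> (\<integral>s. norm (K \<phi> s) \<partial>N)"
      unfolding D_def by (rule integral_norm_bound)
    also have "\<dots> \<le> (\<integral>s. b s * B \<partial>N)"
      by (rule integral_mono_AE[OF integrable_norm[OF i] bB])
         (rule eventually_mono[OF bound_K], use that in auto)
    finally have "norm (D \<phi>) \<le> (\<integral>s. b s * B \<partial>N)" .
    then show "norm (D \<phi>) \<le> (\<integral>s. b s \<partial>N) * B" by simp
  qed
  have td: "tempered_distribution D"
    unfolding tempered_distribution_def
  proof (intro conjI allI impI exI)
    fix \<phi> \<psi> a b assume s: "schwartz \<phi>" "schwartz \<psi>"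
    have "K (\<lambda>x. a * \<phi> x + b * \<psi> x) = (\<lambda>s. a * K \<phi> s + b * K \<psi> s)"
      by (simp add: K_def fun_eq_iff sum_distrib_left sum.distrib[symmetric] scaleR_conv_of_real algebra_simps)
    then show "D (\<lambda>x. a * \<phi> x + b * \<psi> x) = a * D \<phi> + b * D \<psi>"
      unfolding D_def using int_K(1)[OF schwartz_C2_bounded[OF s(1)]] int_K(1)[OF schwartz_C2_bounded[OF s(2)]]
      by simp
  next
    fix \<phi> assume "schwartz \<phi>"
    then show "norm (D \<phi>) \<le> (\<integral>s. b s \<partial>N) * (\<Sum>k\<le>4. \<Sum>n\<le>4. schwartz_seminorm k n \<phi>)"
      using int_K(2)[OF schwartz_C2_bounded] by (simp add: schwartz_size_def)
  qed
  have tl: "tempered_limit (\<lambda>\<epsilon> s. complex_of_real (g \<epsilon> s)) D (at_right 0)"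
    unfolding tempered_limit_def
  proof (intro conjI allI impI td)
    fix \<phi> assume \<phi>: "schwartz \<phi>"
    show "\<forall>\<^sub>F \<epsilon> in at_right 0. integrable lborel (\<lambda>s. complex_of_real (g \<epsilon> s) * \<phi> s)"
      by (rule eventually_mono[OF eventually_at_right_less]) (use g_int \<phi> in auto)
    have [measurable]: "\<phi> \<in> borel_measurable borel" using schwartz_measurable[OF \<phi>, of 0] by simp
    have bB: "integrable N (\<lambda>s. b s * schwartz_size \<phi>)" using b by simp
    have "((\<lambda>\<epsilon>. \<integral>s. (\<Sum>j\<in>J. c \<epsilon> j s *\<^sub>R \<phi> (x j s)) \<partial>N) \<longlongrightarrow> D \<phi>) (at_right 0)"
    proof (unfold tendsto_at_iff_sequentially comp_def, intro allI impI)
      fix X :: "nat \<Rightarrow> real" assume X: "\<forall>i. X i \<in> {0<..} - {0}" "X \<longlonglongrightarrow> 0"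
      then have Xr: "filterlim X (at_right 0) sequentially"
        by (auto simp: filterlim_at intro!: always_eventually less_imp_neq[THEN not_sym])
      show "(\<lambda>i. \<integral>s. (\<Sum>j\<in>J. c (X i) j s *\<^sub>R \<phi> (x j s)) \<partial>N) \<longlonglongrightarrow> D \<phi>"
        unfolding D_def
      proof (rule integral_dominated_convergence[OF _ _ bB])
        show "K \<phi> \<in> borel_measurable N" using meas_K[OF schwartz_C2_bounded[OF \<phi>]] .
        show "(\<lambda>s. \<Sum>j\<in>J. c (X i) j s *\<^sub>R \<phi> (x j s)) \<in> borel_measurable N" for i by measurable
        show "AE s in N. (\<lambda>i. \<Sum>j\<in>J. c (X i) j s *\<^sub>R \<phi> (x j s)) \<longlonglongrightarrow> K \<phi> s"
          using conv_K by eventually_elim (auto intro: filterlim_compose[OF _ Xr])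
        show "AE s in N. norm (\<Sum>j\<in>J. c (X i) j s *\<^sub>R \<phi> (x j s)) \<le> b s * schwartz_size \<phi>" for i
          using X bound schwartz_C2_bounded[OF \<phi>] by (intro AE_I2) auto
      qed
    qed
    then show "((\<lambda>\<epsilon>. \<integral>s. complex_of_real (g \<epsilon> s) * \<phi> s \<partial>lborel) \<longlongrightarrow> D \<phi>) (at_right 0)"
      by (rule Lim_transform_eventually)
         (rule eventually_mono[OF eventually_at_right_less], use g_eq \<phi> in auto)
  qed
  let ?h = "\<lambda>\<omega>. \<integral>s. K (e \<omega>) s \<partial>N"
  have h_meas: "?h \<in> borel_measurable borel"
  proof -
    have "(\<lambda>(\<omega>, s). K (e \<omega>) s) \<in> borel_measurable (borel \<Otimes>\<^sub>M N)"
      unfolding K_def e_def by measurable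
    then show ?thesis by (intro N.borel_measurable_lebesgue_integral) simp
  qed
  have osc: "C2_bounded (e \<omega>) (1 + \<omega>\<^sup>2)" for \<omega>
    unfolding e_def by (rule oscillation_C2_bounded)
  have h_bound: "norm (?h \<omega>) \<le> (\<integral>s. b s \<partial>N) * (1 + \<omega>\<^sup>2)" for \<omega>
    using int_K(2)[OF osc, of \<omega>] by (simp add: D_def)
  have dual: "D (fourier \<phi>) = (\<integral>\<omega>. ?h \<omega> * \<phi> \<omega> \<partial>lborel)" if \<phi>: "schwartz \<phi>" for \<phi>
    unfolding D_def K_def e_def
    by (rule kernel_duality[OF N c0 x b _ \<phi>])
       (rule eventually_mono[OF bound_K], use osc in \<open>auto simp: K_def e_def\<close>)
  have h_eq: "(\<lambda>\<omega>. \<integral>s. (\<Sum>j\<in>J. c0 j s *\<^sub>R exp (\<i> * of_real \<omega> * of_real (x j s))) \<partial>N) = ?h"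
    by (simp add: K_def e_def)
  show ?thesis
    unfolding spectral_limit_def h_eq using tl dual h_meas h_bound by auto
qed

section \<open>The direct term\<close>

lemma onorm_le_of_norm_le:
  fixes v :: "'a::real_normed_vector"
  assumes "norm v \<le> B" shows "onorm (\<lambda>h::real. h *\<^sub>R v) \<le> B"
proof (rule onorm_bound)
  show "0 \<le> B" using assms norm_ge_zero order_trans by blast
  show "norm (h *\<^sub>R v) \<le> B * norm h" for h :: real
    using mult_left_mono[OF assms, of "\<bar>h\<bar>"] by (simp add: mult.commute)
qed

lemma C2_bounded_Lipschitz:
  assumes "C2_bounded \<phi> B" shows "norm (\<phi> x - \<phi> y) \<le> B * \<bar>x - y\<bar>"
proof -
  obtain \<phi>' where d: "\<And>x. (\<phi> has_vector_derivative \<phi>' x) (at x)" and b: "\<And>x. norm (\<phi>' x) \<le> B"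
    using assms unfolding C2_bounded_def by blast
  have "norm (\<phi> x - \<phi> y) \<le> B * norm (x - y)"
  proof (rule differentiable_bound[where S=UNIV and f'="\<lambda>x h. h *\<^sub>R \<phi>' x"])
    show "(\<phi> has_derivative (\<lambda>h. h *\<^sub>R \<phi>' x)) (at x within UNIV)" for x
      using d[of x] by (simp add: has_vector_derivative_def)
    show "onorm (\<lambda>h. h *\<^sub>R \<phi>' x) \<le> B" for x
      by (rule onorm_le_of_norm_le[OF b])
  qed auto
  then show ?thesis by simp
qed

lemma C2_bounded_second_difference:
  assumes "C2_bounded \<phi> B" "x \<ge> 0" shows "norm (\<phi> x + \<phi> (- x) - 2 * \<phi> 0) \<le> 2 * B * x\<^sup>2"
proof -
  obtain \<phi>' \<phi>'' where d: "\<And>x. (\<phi> has_vector_derivative \<phi>' x) (at x)" 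
    and d2: "\<And>x. (\<phi>' has_vector_derivative \<phi>'' x) (at x)" and b: "\<And>x. norm (\<phi>'' x) \<le> B"
    using assms unfolding C2_bounded_def by blast
  have lip: "norm (\<phi>' y - \<phi>' z) \<le> B * norm (y - z)" for y z
  proof (rule differentiable_bound[where S=UNIV and f'="\<lambda>x h. h *\<^sub>R \<phi>'' x"])
    show "(\<phi>' has_derivative (\<lambda>h. h *\<^sub>R \<phi>'' x)) (at x within UNIV)" for x
      using d2[of x] by (simp add: has_vector_derivative_def)
    show "onorm (\<lambda>h. h *\<^sub>R \<phi>'' x) \<le> B" for x
      by (rule onorm_le_of_norm_le[OF b])
  qed auto
  have B: "0 \<le> B" using b[of 0] norm_ge_zero order_trans by blast
  have "norm ((\<phi> x + \<phi> (- x)) - (\<phi> 0 + \<phi> (- 0))) \<le> 2 * x * B * norm (x - 0)"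
  proof (rule differentiable_bound[where S="{0..x}" and f="\<lambda>x. \<phi> x + \<phi> (- x)" and f'="\<lambda>y h. h *\<^sub>R (\<phi>' y - \<phi>' (- y))"])
    fix y assume y: "y \<in> {0..x}"
    have 1: "((\<lambda>y. \<phi> (- y)) has_vector_derivative (- 1) *\<^sub>R \<phi>' (- y)) (at y within {0..x})"
    proof -
      have u: "(uminus has_vector_derivative - 1) (at y within {0..x})"
        unfolding has_real_derivative_iff_has_vector_derivative[symmetric] using DERIV_minus[OF DERIV_ident] .
      show ?thesis
        using vector_diff_chain_within[OF u, of \<phi> "\<phi>' (- y)"] d[of "-y"]
        by (simp add: o_def has_vector_derivative_at_within)
    qed
    have "((\<lambda>y. \<phi> y + \<phi> (- y)) has_vector_derivative (\<phi>' y + (- 1) *\<^sub>R \<phi>' (- y))) (at y within {0..x})"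
      by (rule has_vector_derivative_add[OF has_vector_derivative_at_within[OF d] 1])
    then show "((\<lambda>x. \<phi> x + \<phi> (- x)) has_derivative (\<lambda>h. h *\<^sub>R (\<phi>' y - \<phi>' (- y)))) (at y within {0..x})"
      by (simp add: has_vector_derivative_def)
    have "norm (\<phi>' y - \<phi>' (- y)) \<le> B * (2 * x)"
      using y B mult_left_mono[of "2 * y" "2 * x" B] by (intro order_trans[OF lip]) auto
    then show "onorm (\<lambda>h. h *\<^sub>R (\<phi>' y - \<phi>' (- y))) \<le> 2 * x * B"
      by (intro onorm_le_of_norm_le) (simp add: mult_ac)
  qed (use assms in auto)
  then show ?thesis using assms by (simp add: power2_eq_square mult_ac)
qed

lemma C2_bounded_nonneg: "C2_bounded \<phi> B \<Longrightarrow> 0 \<le> B"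
  unfolding C2_bounded_def using norm_ge_zero order_trans by blast

lemma C2_bounded_norm: "C2_bounded \<phi> B \<Longrightarrow> norm (\<phi> x) \<le> B"
  unfolding C2_bounded_def by blast

lemma schwartz_integrable: "schwartz \<phi> \<Longrightarrow> integrable lborel \<phi>"
  using schwartz_integrable_times[of \<phi> 0 "\<lambda>_. 1" 1] by simp

text \<open>
  The substitution \<open>\<tau>' = k s\<close>, followed by collecting \<open>s\<close> and \<open>- s\<close>.
\<close>

lemma even_kernel_fold:
  fixes \<gamma> :: "real \<Rightarrow> real"
  assumes k: "k > 0" and \<gamma> [measurable]: "\<gamma> \<in> borel_measurable borel" and even: "\<And>s. \<gamma> (- s) = \<gamma> s"
    and bound: "\<And>s. \<bar>\<gamma> s\<bar> \<le> C" and \<phi>: "schwartz \<phi>"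
  shows "integrable lborel (\<lambda>\<tau>. of_real (\<gamma> (\<tau> / k)) * \<phi> \<tau>)"
    and "integrable half_line (\<lambda>s. (k * \<gamma> s) *\<^sub>R \<phi> (k * s))"
    and "integrable half_line (\<lambda>s. (k * \<gamma> s) *\<^sub>R \<phi> (- (k * s)))"
    and "(\<integral>\<tau>. of_real (\<gamma> (\<tau> / k)) * \<phi> \<tau> \<partial>lborel) =
         (\<integral>s. (k * \<gamma> s) *\<^sub>R \<phi> (k * s) + (k * \<gamma> s) *\<^sub>R \<phi> (- (k * s)) \<partial>half_line)"
proof -
  have [measurable]: "\<phi> \<in> borel_measurable borel" using schwartz_measurable[OF \<phi>, of 0] by simp
  let ?f = "\<lambda>\<tau>. complex_of_real (\<gamma> (\<tau> / k)) * \<phi> \<tau>" and ?g = "\<lambda>s. (k * \<gamma> s) *\<^sub>R \<phi> (k * s)"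
  have C: "0 \<le> C" using bound[of 0] by linarith
  show i: "integrable lborel ?f"
  proof (rule Bochner_Integration.integrable_bound)
    show "integrable lborel (\<lambda>\<tau>. C *\<^sub>R \<phi> \<tau>)" using schwartz_integrable[OF \<phi>] by simp
    show "AE \<tau> in lborel. norm (?f \<tau>) \<le> norm (C *\<^sub>R \<phi> \<tau>)"
      using bound C by (auto simp: norm_mult intro!: mult_right_mono)
  qed measurable
  have g: "integrable lborel ?g"
    using lborel_integrable_real_affine[OF i, of k 0] k by (simp add: scaleR_conv_of_real mult.assoc)
  then show "integrable half_line ?g" "integrable half_line (\<lambda>s. (k * \<gamma> s) *\<^sub>R \<phi> (- (k * s)))"
    using integral_lborel_fold(1)[of ?g] by (simp_all add: even)
  have "integral\<^sup>L lborel ?f = integral\<^sup>L lborel ?g"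
    using lborel_integral_real_affine[of k ?f 0] k by (simp add: scaleR_conv_of_real mult.assoc)
  also have "\<dots> = (\<integral>s. ?g s + ?g (- s) \<partial>half_line)"
    by (rule integral_lborel_fold(2)) (use g in auto)
  finally show "integral\<^sup>L lborel ?f = (\<integral>s. ?g s + (k * \<gamma> s) *\<^sub>R \<phi> (- (k * s)) \<partial>half_line)"
    by (simp add: even)
qed

lemma measurable_regularized_kernel [measurable]:
  assumes [measurable]: "r \<in> borel_measurable M" "d \<in> borel_measurable M"
  shows "(\<lambda>s. regularized_kernel \<epsilon> (r s) (d s)) \<in> borel_measurable M"
  unfolding regularized_kernel_def by measurable

lemma measurable_sinh [measurable]: "(sinh :: real \<Rightarrow> real) \<in> borel_measurable borel"
  by (intro borel_measurable_continuous_onI continuous_intros)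

lemma measurable_cosh [measurable]: "(cosh :: real \<Rightarrow> real) \<in> borel_measurable borel"
  by (intro borel_measurable_continuous_onI continuous_intros)

lemma sinh_ge_exp:
  assumes "s \<ge> (1::real)" shows "exp s / 4 \<le> sinh s"
proof -
  have "exp (- s) \<le> 1" using assms by simp
  moreover have "2 \<le> exp s" using exp_ge_add_one_self[of s] assms by linarith
  ultimately have "exp (- s) \<le> exp s / 2" by linarith
  then show ?thesis by (simp add: sinh_def)
qed

lemma sinh_ge_self: assumes "s \<ge> (0::real)" shows "s \<le> sinh s"
proof -
  have "sinh 0 - 0 \<le> sinh s - s"
    by (rule DERIV_nonneg_imp_nondecreasing[OF assms, of "\<lambda>s. sinh s - s"])
       (auto intro!: derivative_eq_intros exI cosh_real_ge_1)
  then show ?thesis by simp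
qed

lemma cosh_minus_one_le: "cosh s - 1 \<le> (sinh s)\<^sup>2" for s :: real
proof -
  have "(sinh s)\<^sup>2 = (cosh s - 1) * (cosh s + 1)" using cosh_square_eq[of s] by (simp add: algebra_simps power2_eq_square)
  then show ?thesis using cosh_real_ge_1[of s] mult_left_mono[of 1 "cosh s + 1" "cosh s - 1"] by simp
qed

lemma cosh_le_exp: "s \<ge> 0 \<Longrightarrow> cosh s \<le> exp s" for s :: real
  by (simp add: cosh_def)

text \<open>
  Merges a bound near the singularity with an exponential bound at infinity into one
  dominating function.
\<close>

lemma exp_bound_cases:
  fixes f :: "real \<Rightarrow> real"
  assumes "\<And>s. 0 < s \<Longrightarrow> s \<le> a \<Longrightarrow> f s \<le> C" "\<And>s. 0 < s \<Longrightarrow> s > a \<Longrightarrow> f s \<le> D * exp (- s)" "0 \<le> C" "0 \<le> D" "0 < s"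
  shows "f s \<le> (C * exp a + D) * exp (- s)"
proof (cases "s \<le> a")
  case True
  have "C * 1 \<le> C * (exp a * exp (- s))"
    using True assms by (intro mult_left_mono) (auto simp flip: exp_add)
  moreover have "0 \<le> D * exp (- s)" using assms by simp
  ultimately show ?thesis using assms(1)[of s] assms(5) True by (simp add: algebra_simps)
next
  case False
  have "0 \<le> C * exp a * exp (- s)" using assms by simp
  then show ?thesis using assms(2)[of s] False assms(5) by (simp add: algebra_simps)
qed

text \<open>
  In the variable \<open>S = sinh s\<close> the integral is, up to the sign, half of the real part of the
  integral of \<open>2 / ((a S - i \<epsilon>) (b S - i \<epsilon>))\<close> over the whole line, and both poles lie in the
  upper half-plane. An antiderivative is a difference of two arctangents, which degenerates to
  \<open>2 S / (\<epsilon>\<^sup>2 + a\<^sup>2 S\<^sup>2)\<close> if \<open>a = b\<close>; in either case it vanishes at \<open>0\<close> and at infinity.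
\<close>

lemma direct_kernel_null_integral:
  fixes k \<eta> \<epsilon> :: real
  assumes k: "k > 0" and e: "\<epsilon> > 0"
  defines "\<gamma> \<equiv> \<lambda>s. regularized_kernel \<epsilon> ((k * sinh \<eta> * sinh s)\<^sup>2) (k * cosh \<eta> * sinh s)"
  shows "integrable half_line (\<lambda>s. \<gamma> s * cosh s)" and "(\<integral>s. \<gamma> s * cosh s \<partial>half_line) = 0"
proof -
  have q: "(k * sinh \<eta> * x)\<^sup>2 - (k * cosh \<eta> * x)\<^sup>2 = - (k\<^sup>2 * x\<^sup>2)" for x
    by (simp add: power_mult_distrib cosh_square_eq algebra_simps)
  have b1: "\<bar>\<gamma> s\<bar> \<le> 2 / \<epsilon>\<^sup>2" for s
    unfolding \<gamma>_def using e by (intro regularized_kernel_bounds) auto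
  have b2: "\<bar>\<gamma> s\<bar> \<le> 2 / (k\<^sup>2 * (sinh s)\<^sup>2)" if "s > 0" for s
  proof -
    have "k\<^sup>2 * (sinh s)\<^sup>2 > 0" using k that by simp
    then have "(k * sinh \<eta> * sinh s)\<^sup>2 \<noteq> (k * cosh \<eta> * sinh s)\<^sup>2" using q[of "sinh s"] by linarith
    then show ?thesis
      using regularized_kernel_bounds(3)[OF e, of "(k * sinh \<eta> * sinh s)\<^sup>2" "k * cosh \<eta> * sinh s"] q[of "sinh s"]
      by (simp add: \<gamma>_def abs_mult)
  qed
  have bound: "norm (\<gamma> s * cosh s) \<le> (2 / \<epsilon>\<^sup>2 * exp 1 * exp 1 + 32 / k\<^sup>2) * exp (- 1 * s)" if "s > 0" for s
    unfolding mult_minus1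
  proof (rule exp_bound_cases[where a=1])
    fix s :: real assume s: "s > 0" "s \<le> 1"
    have "cosh s \<le> exp 1" using cosh_le_exp[of s] s by (smt (verit) exp_le_cancel_iff)
    then show "norm (\<gamma> s * cosh s) \<le> 2 / \<epsilon>\<^sup>2 * exp 1"
      unfolding real_norm_def abs_mult using b1[of s] e by (intro mult_mono) auto
  next
    fix s :: real assume s: "s > 0" "s > 1"
    have "(exp s / 4)\<^sup>2 \<le> (sinh s)\<^sup>2" using sinh_ge_exp[of s] s by (intro power_mono) auto
    then have "2 / (k\<^sup>2 * (sinh s)\<^sup>2) \<le> 2 / (k\<^sup>2 * (exp s / 4)\<^sup>2)"
      using k by (intro divide_left_mono mult_left_mono) (auto intro!: mult_pos_pos)
    then have "\<bar>\<gamma> s\<bar> * cosh s \<le> 2 / (k\<^sup>2 * (exp s / 4)\<^sup>2) * exp s"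
      using b2[OF s(1)] cosh_le_exp[of s] s by (intro mult_mono) auto
    also have "\<dots> = 32 / k\<^sup>2 * exp (- s)"
      by (simp add: power2_eq_square exp_minus field_simps)
    finally show "norm (\<gamma> s * cosh s) \<le> 32 / k\<^sup>2 * exp (- s)"
      by (simp add: abs_mult)
  qed (use e that in auto)
  have [measurable]: "\<gamma> \<in> borel_measurable borel" unfolding \<gamma>_def by measurable
  show i: "integrable half_line (\<lambda>s. \<gamma> s * cosh s)"
    by (rule integrable_half_line_bound[OF _ _ bound]) auto
  \<comment> \<open>\<open>d - \<rho> = a S\<close> and \<open>d + \<rho> = b S\<close> with \<open>\<rho> = k sinh \<eta> S\<close>, so the case \<open>a = b\<close> is \<open>\<eta> = 0\<close>\<close>
  define a b where "a = k * exp (- \<eta>)" and "b = k * exp \<eta>"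
  have ab: "a > 0" "b > 0" "a * b = k\<^sup>2" using k by (auto simp: a_def b_def power2_eq_square simp flip: exp_add)
  have ce: "cosh \<eta> + sinh \<eta> = exp \<eta>" "cosh \<eta> - sinh \<eta> = exp (- \<eta>)" by (simp_all add: cosh_def sinh_def field_simps)
  have nz: "\<epsilon>\<^sup>2 + x\<^sup>2 > 0" for x using e by (simp add: add_pos_nonneg)
  have form: "\<gamma> s = 2 * (\<epsilon>\<^sup>2 - a * b * (sinh s)\<^sup>2) / ((\<epsilon>\<^sup>2 + (b * sinh s)\<^sup>2) * (\<epsilon>\<^sup>2 + (a * sinh s)\<^sup>2))" for s
  proof -
    have 1: "k * sinh \<eta> * sinh s + k * cosh \<eta> * sinh s = b * sinh s" "(k * sinh \<eta> * sinh s - k * cosh \<eta> * sinh s)\<^sup>2 = (a * sinh s)\<^sup>2"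
      unfolding b_def a_def ce[symmetric] by (simp_all add: power2_eq_square algebra_simps)
    show ?thesis
      unfolding \<gamma>_def regularized_kernel_def regularized_kernel_factored 1 ab(3) using q[of "sinh s"] by (simp add: algebra_simps)
  qed
  define F where "F = (\<lambda>x. if a = b then 2 * x / (\<epsilon>\<^sup>2 + (a * x)\<^sup>2) else - 2 / (\<epsilon> * (b - a)) * (arctan (a * x / \<epsilon>) - arctan (b * x / \<epsilon>)))"
  have dF: "(F has_real_derivative 2 * (\<epsilon>\<^sup>2 - a * b * x\<^sup>2) / ((\<epsilon>\<^sup>2 + (b * x)\<^sup>2) * (\<epsilon>\<^sup>2 + (a * x)\<^sup>2))) (at x)" for x
  proof (cases "a = b")
    case True
    have "\<epsilon>\<^sup>2 + (b * x)\<^sup>2 \<noteq> 0" using nz[of "b * x"] by linarith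
    then have "((\<lambda>x. 2 * x / (\<epsilon>\<^sup>2 + (b * x)\<^sup>2)) has_real_derivative
        (2 * (\<epsilon>\<^sup>2 + (b * x)\<^sup>2) - 2 * x * (2 * (b * x) * b)) / ((\<epsilon>\<^sup>2 + (b * x)\<^sup>2) * (\<epsilon>\<^sup>2 + (b * x)\<^sup>2))) (at x)"
      by (intro DERIV_divide) (use e in \<open>auto intro!: derivative_eq_intros\<close>)
    moreover have "2 * (\<epsilon>\<^sup>2 + (b * x)\<^sup>2) - 2 * x * (2 * (b * x) * b) = 2 * (\<epsilon>\<^sup>2 - b * b * x\<^sup>2)"
      by (simp add: power2_eq_square algebra_simps)
    ultimately show ?thesis
      unfolding F_def using True by (simp only: if_True simp_thms)
  next
    case False
    have at: "((\<lambda>x. arctan (c * x / \<epsilon>)) has_real_derivative c * \<epsilon> / (\<epsilon>\<^sup>2 + (c * x)\<^sup>2)) (at x)" for c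
    proof -
      have "1 + (c * x / \<epsilon>)\<^sup>2 = (\<epsilon>\<^sup>2 + (c * x)\<^sup>2) / \<epsilon>\<^sup>2" using e by (simp add: field_simps)
      then have "inverse (1 + (c * x / \<epsilon>)\<^sup>2) * (c / \<epsilon>) = c * \<epsilon> / (\<epsilon>\<^sup>2 + (c * x)\<^sup>2)"
        using e by (simp add: power2_eq_square)
      then show ?thesis using e by (auto intro!: derivative_eq_intros)
    qed
    have "(F has_real_derivative - 2 / (\<epsilon> * (b - a)) * (a * \<epsilon> / (\<epsilon>\<^sup>2 + (a * x)\<^sup>2) - b * \<epsilon> / (\<epsilon>\<^sup>2 + (b * x)\<^sup>2))) (at x)"
      unfolding F_def using DERIV_cmult[OF DERIV_diff[OF at[of a] at[of b]], of "- 2 / (\<epsilon> * (b - a))"] False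
      by (simp only: if_False)
    moreover have "- 2 / (\<epsilon> * (b - a)) * (a * \<epsilon> / (\<epsilon>\<^sup>2 + (a * x)\<^sup>2) - b * \<epsilon> / (\<epsilon>\<^sup>2 + (b * x)\<^sup>2))
      = 2 * (\<epsilon>\<^sup>2 - a * b * x\<^sup>2) / ((\<epsilon>\<^sup>2 + (b * x)\<^sup>2) * (\<epsilon>\<^sup>2 + (a * x)\<^sup>2))"
    proof -
      have "a * \<epsilon> / (\<epsilon>\<^sup>2 + (a * x)\<^sup>2) - b * \<epsilon> / (\<epsilon>\<^sup>2 + (b * x)\<^sup>2)
        = (a * \<epsilon> * (\<epsilon>\<^sup>2 + (b * x)\<^sup>2) - b * \<epsilon> * (\<epsilon>\<^sup>2 + (a * x)\<^sup>2)) / ((\<epsilon>\<^sup>2 + (b * x)\<^sup>2) * (\<epsilon>\<^sup>2 + (a * x)\<^sup>2))"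
        unfolding diff_frac_eq[OF less_imp_neq[OF nz, symmetric] less_imp_neq[OF nz, symmetric]]
        by (simp only: mult.commute)
      also have "a * \<epsilon> * (\<epsilon>\<^sup>2 + (b * x)\<^sup>2) - b * \<epsilon> * (\<epsilon>\<^sup>2 + (a * x)\<^sup>2) = - (\<epsilon> * (b - a)) * (\<epsilon>\<^sup>2 - a * b * x\<^sup>2)"
        by (simp add: power2_eq_square algebra_simps)
      finally show ?thesis using False e by (simp, simp only: minus_divide_left minus_diff_eq)
    qed
    ultimately show ?thesis by simp
  qed
  have F0: "(F \<longlongrightarrow> 0) at_top"
  proof (cases "a = b")
    case True
    have "((\<lambda>x. 2 * x / (\<epsilon>\<^sup>2 + (b * x)\<^sup>2)) \<longlongrightarrow> 0) at_top" using e ab by real_asymp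
    then show ?thesis unfolding F_def using True by simp
  next
    case False
    have "((\<lambda>x. arctan (c * x / \<epsilon>)) \<longlongrightarrow> pi / 2) at_top" if "c > 0" for c
      using e that by real_asymp
    from this[OF ab(1)] this[OF ab(2)]
    have "((\<lambda>x. - 2 / (\<epsilon> * (b - a)) * (arctan (a * x / \<epsilon>) - arctan (b * x / \<epsilon>))) \<longlongrightarrow> - 2 / (\<epsilon> * (b - a)) * (pi / 2 - pi / 2)) at_top"
      by (intro tendsto_intros)
    then show ?thesis unfolding F_def using False by simp
  qed
  have "(\<integral>s. \<gamma> s * cosh s \<partial>half_line) = 0 - F (sinh 0)"
  proof (rule half_line_FTC[where F="\<lambda>s. F (sinh s)"])
    show "((\<lambda>s. F (sinh s)) has_vector_derivative \<gamma> s * cosh s) (at s)" for s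
      unfolding has_real_derivative_iff_has_vector_derivative[symmetric] form
      by (rule DERIV_chain2[where f=F and g=sinh, OF dF]) (auto intro!: derivative_eq_intros)
    show "isCont (\<lambda>s. \<gamma> s * cosh s) s" for s
      unfolding form using nz[of "a * sinh s"] nz[of "b * sinh s"] by (auto intro!: continuous_intros)
    have "isCont (\<lambda>s. F (sinh s)) 0"
      by (rule isCont_o2[where f=sinh and g=F, OF _ DERIV_isCont[OF dF]]) (intro continuous_intros)
    then show "((\<lambda>s. F (sinh s)) \<longlongrightarrow> F (sinh 0)) (at_right 0)"
      by (simp add: isCont_def filterlim_at_split)
    show "((\<lambda>s. F (sinh s)) \<longlongrightarrow> 0) at_top"
      by (rule filterlim_compose[OF F0 sinh_real_at_top])
  qed (rule i)
  then show "(\<integral>s. \<gamma> s * cosh s \<partial>half_line) = 0"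
    by (simp add: F_def)
qed

text \<open>
  By the previous lemma \<open>2 \<phi> 0 cosh s\<close> may be subtracted from \<open>\<phi> (k s) + \<phi> (- k s)\<close>. The
  difference is of order \<open>s\<^sup>2\<close> at \<open>0\<close>, which makes up for the double pole.
\<close>

lemma direct_spectral_limit:
  fixes k \<eta> :: real
  assumes k: "k > 0"
  shows "spectral_limit
    (\<lambda>\<epsilon> \<tau>. regularized_kernel \<epsilon> ((k * sinh \<eta> * sinh (\<tau> / k))\<^sup>2) (k * cosh \<eta> * sinh (\<tau> / k)))
    (\<lambda>\<omega>. \<integral>s. (4 / k) *\<^sub>R of_real ((cosh s - cos (\<omega> * k * s)) / (sinh s)\<^sup>2) \<partial>half_line) 0"
proof -
  define \<gamma> where "\<gamma> = (\<lambda>\<epsilon> s. regularized_kernel \<epsilon> ((k * sinh \<eta> * sinh s)\<^sup>2) (k * cosh \<eta> * sinh s))"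
  define \<gamma>0 where "\<gamma>0 = (\<lambda>s. - 2 / (k\<^sup>2 * (sinh s)\<^sup>2))"
  define c where "c = (\<lambda>\<epsilon> (j::nat) s. if j = 2 then - (2 * (k * \<gamma> \<epsilon> s * cosh s)) else k * \<gamma> \<epsilon> s)"
  define c0 where "c0 = (\<lambda>(j::nat) s. if j = 2 then - (2 * (k * \<gamma>0 s * cosh s)) else k * \<gamma>0 s)"
  define x where "x = (\<lambda>(j::nat) s. if j = 0 then k * s else if j = 1 then - (k * s) else 0 :: real)"
  have [measurable]: "\<gamma> \<epsilon> \<in> borel_measurable borel" for \<epsilon> unfolding \<gamma>_def by measurable
  have [measurable]: "\<gamma>0 \<in> borel_measurable borel" unfolding \<gamma>0_def by measurable
  have sum3: "(\<Sum>j\<in>{0,1,2::nat}. f j) = f 0 + f 1 + f 2" for f :: "nat \<Rightarrow> complex" by (simp add: add.assoc)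
  have q: "(k * sinh \<eta> * y)\<^sup>2 - (k * cosh \<eta> * y)\<^sup>2 = - (k\<^sup>2 * y\<^sup>2)" for y
    by (simp add: power_mult_distrib cosh_square_eq algebra_simps)
  have pos: "k\<^sup>2 * (sinh s)\<^sup>2 > 0" if "s > 0" for s using k that by simp
  have ne: "(k * sinh \<eta> * sinh s)\<^sup>2 \<noteq> (k * cosh \<eta> * sinh s)\<^sup>2" if "s > 0" for s
    using pos[OF that] q[of "sinh s"] by linarith
  have b2: "\<bar>\<gamma> \<epsilon> s\<bar> \<le> 2 / (k\<^sup>2 * (sinh s)\<^sup>2)" if "s > 0" "\<epsilon> > 0" for \<epsilon> s
    using regularized_kernel_bounds(3)[OF that(2), of "(k * sinh \<eta> * sinh s)\<^sup>2" "k * cosh \<eta> * sinh s"] ne[OF that(1)] q[of "sinh s"]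
    by (simp add: \<gamma>_def abs_mult)
  have lim: "((\<lambda>\<epsilon>. \<gamma> \<epsilon> s) \<longlongrightarrow> \<gamma>0 s) (at_right 0)" if "s > 0" for s
    using regularized_kernel_tendsto[OF ne[OF that]] unfolding \<gamma>_def \<gamma>0_def q by simp
  have main: "spectral_limit (\<lambda>\<epsilon> \<tau>. \<gamma> \<epsilon> (\<tau> / k))
    (\<lambda>\<omega>. \<integral>s. (\<Sum>j\<in>{0,1,2}. c0 j s *\<^sub>R exp (\<i> * of_real \<omega> * of_real (x j s))) \<partial>half_line) 0"
  proof (rule spectral_limit_of_kernel[where c=c, OF sigma_finite_half_line])
    show "c \<epsilon> j \<in> borel_measurable half_line" "c0 j \<in> borel_measurable half_line" "x j \<in> borel_measurable half_line" for \<epsilon> j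
      unfolding c_def c0_def x_def by measurable
    \<comment> \<open>\<open>?C\<close> from the second difference of \<open>\<phi>\<close> and \<open>cosh s - 1 \<le> sinh\<^sup>2 s\<close>, \<open>?D\<close> from \<open>sinh s \<ge> exp s / 4\<close> for \<open>s \<ge> 1\<close>\<close>
    let ?C = "2 / k * (4 * k\<^sup>2 + 2)" and ?D = "256 / k"
    show "integrable half_line (\<lambda>s. (?C * exp 1 + ?D) * exp (- 1 * s))"
      by (rule integrable_half_line_exp) simp
    show "AE s in half_line. \<forall>j\<in>{0,1,2}. ((\<lambda>\<epsilon>. c \<epsilon> j s) \<longlongrightarrow> c0 j s) (at_right 0)"
    proof (rule AE_half_line[of 0])
      fix s :: real assume s: "s > 0"
      show "\<forall>j\<in>{0,1,2}. ((\<lambda>\<epsilon>. c \<epsilon> j s) \<longlongrightarrow> c0 j s) (at_right 0)"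
        unfolding c_def c0_def using lim[OF s] by (auto intro!: tendsto_intros)
    qed
    fix \<epsilon> :: real assume e: "\<epsilon> > 0"
    {
      fix \<phi> B and s :: real assume s: "s \<in> space half_line" and \<phi>: "C2_bounded \<phi> B"
      define \<Phi> where "\<Phi> = (\<lambda>s. \<phi> (k * s) + \<phi> (- (k * s)) - 2 * of_real (cosh s) * \<phi> 0)"
      have eq: "(\<Sum>j\<in>{0,1,2}. c \<epsilon> j s *\<^sub>R \<phi> (x j s)) = (k * \<gamma> \<epsilon> s) *\<^sub>R \<Phi> s"
        unfolding sum3 by (simp add: \<Phi>_def c_def x_def scaleR_conv_of_real algebra_simps)
      have B: "0 \<le> B" using C2_bounded_nonneg[OF \<phi>] .
      have bnd: "norm ((k * \<gamma> \<epsilon> s) *\<^sub>R \<Phi> s) \<le> 2 * v / (k * (sinh s)\<^sup>2) * B" if "norm (\<Phi> s) \<le> v * B" "s > 0" "0 \<le> v" for v s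
      proof -
        have "norm ((k * \<gamma> \<epsilon> s) *\<^sub>R \<Phi> s) \<le> (k * (2 / (k\<^sup>2 * (sinh s)\<^sup>2))) * (v * B)"
          unfolding norm_scaleR abs_mult using b2[OF that(2) e] that k B by (intro mult_mono) auto
        also have "\<dots> = 2 * v / (k * (sinh s)\<^sup>2) * B" using k by (simp add: power2_eq_square)
        finally show ?thesis .
      qed
      have P1: "norm (\<Phi> s) \<le> (4 * k\<^sup>2 + 2) * (sinh s)\<^sup>2 * B" if s: "s > 0" for s
      proof -
        have "\<Phi> s = (\<phi> (k * s) + \<phi> (- (k * s)) - 2 * \<phi> 0) - 2 * of_real (cosh s - 1) * \<phi> 0" by (simp add: \<Phi>_def algebra_simps)
        then have "norm (\<Phi> s) \<le> norm (\<phi> (k * s) + \<phi> (- (k * s)) - 2 * \<phi> 0) + norm (2 * of_real (cosh s - 1) * \<phi> 0)"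
          by (simp only: norm_triangle_ineq4)
        also have "norm (\<phi> (k * s) + \<phi> (- (k * s)) - 2 * \<phi> 0) \<le> 2 * B * (k * s)\<^sup>2"
          using k s by (intro C2_bounded_second_difference[OF \<phi>]) auto
        also have "\<dots> \<le> 4 * k\<^sup>2 * (sinh s)\<^sup>2 * B"
        proof -
          have "s\<^sup>2 \<le> (sinh s)\<^sup>2" using s sinh_ge_self[of s] by (intro power_mono) auto
          then have "4 * (k\<^sup>2 * B) * s\<^sup>2 \<le> 4 * (k\<^sup>2 * B) * (sinh s)\<^sup>2" using B by (intro mult_left_mono) auto
          moreover have "0 \<le> k\<^sup>2 * B * s\<^sup>2" using B by simp
          ultimately show ?thesis by (simp add: power_mult_distrib algebra_simps)
        qed
        also have "norm (2 * of_real (cosh s - 1) * \<phi> 0) \<le> 2 * (sinh s)\<^sup>2 * B"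
        proof -
          have "norm (complex_of_real (cosh s - 1)) = cosh s - 1"
            unfolding norm_of_real using cosh_real_ge_1[of s] by simp
          then show ?thesis
            unfolding norm_mult using cosh_minus_one_le[of s] cosh_real_ge_1[of s] C2_bounded_norm[OF \<phi>, of 0]
            by (intro mult_mono) auto
        qed
        finally show ?thesis by (simp add: algebra_simps)
      qed
      have P2: "norm (\<Phi> s) \<le> 4 * exp s * B" if s: "s > 0" for s
      proof -
        have "norm (\<Phi> s) \<le> norm (\<phi> (k * s)) + norm (\<phi> (- (k * s))) + norm (2 * of_real (cosh s) * \<phi> 0)"
          unfolding \<Phi>_def by (intro order_trans[OF norm_triangle_ineq4] add_right_mono norm_triangle_ineq)
        also have "\<dots> \<le> B + B + 2 * exp s * B"
          unfolding norm_mult using cosh_le_exp[of s] s cosh_real_ge_1[of s] C2_bounded_norm[OF \<phi>]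
          by (intro add_mono mult_mono) auto
        also have "\<dots> \<le> 4 * exp s * B"
          using mult_right_mono[of 1 "exp s" B] s B by (simp add: algebra_simps)
        finally show ?thesis .
      qed
      have "norm (\<Sum>j\<in>{0,1,2}. c \<epsilon> j s *\<^sub>R \<phi> (x j s)) \<le> (?C * B * exp 1 + ?D * B) * exp (- s)"
        unfolding eq
      proof (rule exp_bound_cases[where a=1 and f="\<lambda>s. norm ((k * \<gamma> \<epsilon> s) *\<^sub>R \<Phi> s)"])
        fix s :: real assume s: "s > 0"
        show "norm ((k * \<gamma> \<epsilon> s) *\<^sub>R \<Phi> s) \<le> ?C * B"
        proof -
          have "2 * ((4 * k\<^sup>2 + 2) * (sinh s)\<^sup>2) / (k * (sinh s)\<^sup>2) = ?C"
            using s k by simp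
          then show ?thesis using bnd[OF P1[OF s] s] by simp
        qed
      next
        fix s :: real assume s: "s > 0" "s > 1"
        have "2 * (4 * exp s) / (k * (sinh s)\<^sup>2) \<le> 2 * (4 * exp s) / (k * (exp s / 4)\<^sup>2)"
          using k s sinh_ge_exp[of s] by (intro divide_left_mono mult_left_mono power_mono) (auto intro!: mult_pos_pos)
        also have "\<dots> \<le> 256 / k * exp (- s)"
          using k by (simp add: power2_eq_square exp_minus field_simps)
        finally have "2 * (4 * exp s) / (k * (sinh s)\<^sup>2) * B \<le> 256 / k * exp (- s) * B"
          using B by (rule mult_right_mono)
        then show "norm ((k * \<gamma> \<epsilon> s) *\<^sub>R \<Phi> s) \<le> ?D * B * exp (- s)"
          using bnd[OF P2[OF s(1)] s(1)] by (simp add: mult_ac)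
      qed (use k B s in auto)
      then show "norm (\<Sum>j\<in>{0,1,2}. c \<epsilon> j s *\<^sub>R \<phi> (x j s)) \<le> (?C * exp 1 + ?D) * exp (- 1 * s) * B"
        by (simp add: algebra_simps)
    }
    fix \<phi> assume \<phi>: "schwartz \<phi>"
    have fold: "\<gamma> \<epsilon> \<in> borel_measurable borel" "\<And>s. \<gamma> \<epsilon> (- s) = \<gamma> \<epsilon> s" "\<And>s. \<bar>\<gamma> \<epsilon> s\<bar> \<le> 2 / \<epsilon>\<^sup>2"
      using regularized_kernel_bounds(2)[OF e] by (auto simp: \<gamma>_def regularized_kernel_def)
    note fold = even_kernel_fold[OF k fold \<phi>]
    show "integrable lborel (\<lambda>s. complex_of_real (\<gamma> \<epsilon> (s / k)) * \<phi> s)" by (rule fold(1))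
    have nullint: "integrable half_line (\<lambda>s. \<gamma> \<epsilon> s * cosh s)" "(\<integral>s. \<gamma> \<epsilon> s * cosh s \<partial>half_line) = 0"
      using direct_kernel_null_integral[OF k e, of \<eta>] by (simp_all add: \<gamma>_def)
    have int2: "integrable half_line (\<lambda>s. (- (2 * k) * (\<gamma> \<epsilon> s * cosh s)) *\<^sub>R \<phi> 0)"
      using nullint(1) by (intro integrable_scaleR_left integrable_mult_right)
    have "(\<integral>s. (- (2 * k) * (\<gamma> \<epsilon> s * cosh s)) *\<^sub>R \<phi> 0 \<partial>half_line) = 0"
      using nullint by (subst Bochner_Integration.integral_scaleR_left) simp_all
    then have "(\<integral>s. complex_of_real (\<gamma> \<epsilon> (s / k)) * \<phi> s \<partial>lborel) =
      (\<integral>s. (k * \<gamma> \<epsilon> s) *\<^sub>R \<phi> (k * s) + (k * \<gamma> \<epsilon> s) *\<^sub>R \<phi> (- (k * s)) \<partial>half_line)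
       + (\<integral>s. (- (2 * k) * (\<gamma> \<epsilon> s * cosh s)) *\<^sub>R \<phi> 0 \<partial>half_line)"
      unfolding fold(4) by simp
    also have "\<dots> = (\<integral>s. ((k * \<gamma> \<epsilon> s) *\<^sub>R \<phi> (k * s) + (k * \<gamma> \<epsilon> s) *\<^sub>R \<phi> (- (k * s))) + (- (2 * k) * (\<gamma> \<epsilon> s * cosh s)) *\<^sub>R \<phi> 0 \<partial>half_line)"
      by (rule Bochner_Integration.integral_add[symmetric, OF Bochner_Integration.integrable_add[OF fold(2,3)] int2])
    also have "\<dots> = (\<integral>s. (\<Sum>j\<in>{0,1,2}. c \<epsilon> j s *\<^sub>R \<phi> (x j s)) \<partial>half_line)"
      unfolding sum3 by (rule half_line_cong) (simp add: c_def x_def mult_ac)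
    finally show "(\<integral>s. complex_of_real (\<gamma> \<epsilon> (s / k)) * \<phi> s \<partial>lborel) = (\<integral>s. (\<Sum>j\<in>{0,1,2}. c \<epsilon> j s *\<^sub>R \<phi> (x j s)) \<partial>half_line)" .
  qed simp
  have "(\<integral>s. (\<Sum>j\<in>{0,1,2}. c0 j s *\<^sub>R exp (\<i> * of_real \<omega> * of_real (x j s))) \<partial>half_line)
     = (\<integral>s. (4 / k) *\<^sub>R of_real ((cosh s - cos (\<omega> * k * s)) / (sinh s)\<^sup>2) \<partial>half_line)" for \<omega>
  proof (rule half_line_cong)
    fix s :: real assume s: "s > 0"
    have cs: "exp (\<i> * of_real \<omega> * of_real (k * s)) + exp (\<i> * of_real \<omega> * of_real (- (k * s))) = 2 * of_real (cos (\<omega> * k * s))"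
      by (simp add: cos_of_real[symmetric] cos_exp_eq mult_ac)
    have "(\<Sum>j\<in>{0,1,2}. c0 j s *\<^sub>R exp (\<i> * of_real \<omega> * of_real (x j s))) =
       of_real (k * \<gamma>0 s) * (exp (\<i> * of_real \<omega> * of_real (k * s)) + exp (\<i> * of_real \<omega> * of_real (- (k * s)))) - of_real (2 * (k * \<gamma>0 s * cosh s))"
      unfolding sum3 by (simp add: c0_def x_def scaleR_conv_of_real algebra_simps)
    also have "\<dots> = of_real (k * \<gamma>0 s * (2 * cos (\<omega> * k * s) - 2 * cosh s))" unfolding cs by (simp add: algebra_simps)
    also have "k * \<gamma>0 s * (2 * cos (\<omega> * k * s) - 2 * cosh s) = (4 / k) * ((cosh s - cos (\<omega> * k * s)) / (sinh s)\<^sup>2)"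
      using k s by (simp add: \<gamma>0_def power2_eq_square field_simps)
    finally show "(\<Sum>j\<in>{0,1,2}. c0 j s *\<^sub>R exp (\<i> * of_real \<omega> * of_real (x j s))) = (4 / k) *\<^sub>R of_real ((cosh s - cos (\<omega> * k * s)) / (sinh s)\<^sup>2)"
      by (simp add: scaleR_conv_of_real)
  qed
  with main show ?thesis by (simp add: \<gamma>_def)
qed

section \<open>The mirror term\<close>

lemma half_line_fold_at:
  fixes H :: "real \<Rightarrow> 'a::{banach, second_countable_topology}"
  assumes [measurable]: "H \<in> borel_measurable borel" and H: "integrable half_line H" and a: "a > 0"
  shows "(\<integral>s. H s \<partial>half_line) = (\<integral>t. H (a + t) + (if t \<le> a then H (a - t) else 0) \<partial>half_line)"
    and "integrable half_line (\<lambda>t. H (a + t) + (if t \<le> a then H (a - t) else 0))"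
proof -
  let ?f = "\<lambda>s. indicator {0<..} s *\<^sub>R H s"
  have f: "integrable lborel ?f" using H by (simp add: integrable_half_line_iff)
  have f': "integrable lborel (\<lambda>t. ?f (a + t))"
    using lborel_integrable_real_affine[OF f, of 1 a] by simp
  have ae: "AE t in half_line. ?f (a + t) + ?f (a + - t) = H (a + t) + (if t \<le> a then H (a - t) else 0)"
    by (rule AE_half_line[of a]) (use a in \<open>auto simp: indicator_def\<close>)
  have "integrable half_line (\<lambda>t. ?f (a + t) + ?f (a + - t))"
    using f' integral_lborel_fold(1)[of "\<lambda>t. ?f (a + t)"] by (intro Bochner_Integration.integrable_add) auto
  then show "integrable half_line (\<lambda>t. H (a + t) + (if t \<le> a then H (a - t) else 0))"
    by (rule Bochner_Integration.integrable_cong_AE_imp[OF _ _ ae]) measurable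
  have "(\<integral>s. H s \<partial>half_line) = (\<integral>s. ?f s \<partial>lborel)" by (rule integral_half_line)
  also have "\<dots> = (\<integral>t. ?f (a + t) \<partial>lborel)"
    using lborel_integral_real_affine[of 1 ?f a] by simp
  also have "\<dots> = (\<integral>t. ?f (a + t) + ?f (a + - t) \<partial>half_line)"
    by (rule integral_lborel_fold(2)[OF _ f']) simp
  also have "\<dots> = (\<integral>t. H (a + t) + (if t \<le> a then H (a - t) else 0) \<partial>half_line)"
    by (rule integral_cong_AE[OF _ _ ae]) measurable
  finally show "(\<integral>s. H s \<partial>half_line) = (\<integral>t. H (a + t) + (if t \<le> a then H (a - t) else 0) \<partial>half_line)" .
qed

lemma cosh_minus_cosh: "cosh u - cosh v = 2 * sinh ((u + v) / 2) * sinh ((u - v) / 2)" for u v :: real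
proof -
  have "cosh ((u + v) / 2 + (u - v) / 2) - cosh ((u + v) / 2 - (u - v) / 2) = 2 * sinh ((u + v) / 2) * sinh ((u - v) / 2)"
    by (simp only: cosh_add cosh_diff)
  moreover have "(u + v) / 2 + (u - v) / 2 = u" "(u + v) / 2 - (u - v) / 2 = v" by (simp_all add: field_simps)
  ultimately show ?thesis by simp
qed

text \<open>
  For the interval \<open>(0, 2 a)\<close>, on which the fold about \<open>a\<close> pairs two points.
\<close>

lemma cosh_near_lower:
  fixes a t :: real
  assumes "0 < t" "t \<le> a"
  shows "sinh (a / 2) * t \<le> \<bar>cosh (a + t) - cosh a\<bar>" "sinh (a / 2) * t \<le> \<bar>cosh (a - t) - cosh a\<bar>"
proof -
  have 1: "sinh (a / 2) * (t / 2) \<le> sinh (a + t / 2) * sinh (t / 2)"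
    "sinh (a / 2) * (t / 2) \<le> sinh (a - t / 2) * sinh (t / 2)"
    using assms sinh_ge_self[of "t / 2"] by (intro mult_mono; simp)+
  have p: "0 \<le> sinh (a / 2) * (t / 2)" using assms by simp
  have eq: "cosh (a + t) - cosh a = 2 * (sinh (a + t / 2) * sinh (t / 2))"
    "cosh a - cosh (a - t) = 2 * (sinh (a - t / 2) * sinh (t / 2))"
    using cosh_minus_cosh[of "a + t" a] cosh_minus_cosh[of a "a - t"] by (simp_all add: add_divide_distrib diff_divide_distrib)
  show "sinh (a / 2) * t \<le> \<bar>cosh (a + t) - cosh a\<bar>" using 1(1) p eq(1) by linarith
  show "sinh (a / 2) * t \<le> \<bar>cosh (a - t) - cosh a\<bar>" using 1(2) p eq(2) by linarith
qed

lemma cosh_far_lower: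
  fixes a t :: real
  assumes "0 < a" "a \<le> t"
  shows "(1 - exp (- a))\<^sup>2 / 2 * exp t \<le> cosh (a + t) - cosh a"
proof -
  have s: "sinh (t / 2) = exp (t / 2) * (1 - exp (- t)) / 2"
    by (simp add: sinh_def algebra_simps flip: exp_add)
  have "exp (t / 2) * (1 - exp (- a)) / 2 \<le> sinh (t / 2)"
    unfolding s using assms by (intro divide_right_mono mult_left_mono) auto
  then have "(exp (t / 2) * (1 - exp (- a)) / 2)\<^sup>2 \<le> (sinh (t / 2))\<^sup>2"
    using assms by (intro power_mono) auto
  moreover have "(exp (t / 2) * (1 - exp (- a)) / 2)\<^sup>2 = (1 - exp (- a))\<^sup>2 / 4 * exp t"
    by (simp add: power_mult_distrib power_divide power2_eq_square[of "exp (t / 2)"] flip: exp_add)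
  moreover have "(sinh (t / 2))\<^sup>2 \<le> sinh (a + t / 2) * sinh (t / 2)"
    unfolding power2_eq_square using assms by (intro mult_right_mono) auto
  moreover have "cosh (a + t) - cosh a = 2 * (sinh (a + t / 2) * sinh (t / 2))"
    using cosh_minus_cosh[of "a + t" a] by (simp add: add_divide_distrib)
  ultimately show ?thesis by (simp add: field_simps)
qed

text \<open>
  At distance \<open>t\<close> on the two sides of a simple zero of \<open>r - d\<^sup>2\<close> the two kernels have size
  \<open>1 / t\<close> and opposite signs. Write them as \<open>2 u / U\<close> and \<open>2 w / V\<close>. Then \<open>U\<close> and \<open>V\<close> are at least
  of order \<open>t\<^sup>2 + \<epsilon>\<^sup>2\<close>, and in \<open>u V + w U = (u + w) (u w + f) + w (4 \<epsilon>\<^sup>2 (d1\<^sup>2 - d2\<^sup>2))\<close> the sum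
  \<open>u + w\<close> is at most of that order, since the linear terms cancel; here \<open>f = 4 \<epsilon>\<^sup>2 d2\<^sup>2 \<le> V\<close>. The last term gains the factor
  \<open>t\<close> from \<open>d1\<^sup>2 - d2\<^sup>2\<close>. Hence the sum is bounded uniformly in \<open>t\<close> and \<open>\<epsilon>\<close>.
\<close>

lemma paired_kernel_bound:
  fixes r1 r2 d1 d2 \<epsilon> t \<kappa> C D :: real
  assumes e: "\<epsilon> > 0" and t: "t > 0" and r: "r1 \<ge> 0" "r2 \<ge> 0" and \<kappa>: "\<kappa> > 0"
    and q1: "\<kappa> * t\<^sup>2 \<le> (r1 - d1\<^sup>2)\<^sup>2" and q2: "\<kappa> * t\<^sup>2 \<le> (r2 - d2\<^sup>2)\<^sup>2"
    and p1: "\<kappa> \<le> 2 * (r1 + d1\<^sup>2)" and p2: "\<kappa> \<le> 2 * (r2 + d2\<^sup>2)"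
    and C: "\<bar>(r1 - d1\<^sup>2) + (r2 - d2\<^sup>2)\<bar> \<le> C * t\<^sup>2" "0 \<le> C"
    and D: "\<bar>d1\<^sup>2 - d2\<^sup>2\<bar> \<le> D * t" "0 \<le> D"
  shows "\<bar>regularized_kernel \<epsilon> r1 d1 + regularized_kernel \<epsilon> r2 d2\<bar> \<le> 2 * (2 * (C + 2) / \<kappa> + 2 * D * (1 + 1 / \<kappa>) / \<kappa>)"
proof -
  define u where "u = \<epsilon>\<^sup>2 + r1 - d1\<^sup>2"
  define w where "w = \<epsilon>\<^sup>2 + r2 - d2\<^sup>2"
  define f where "f = 4 * \<epsilon>\<^sup>2 * d2\<^sup>2"
  define U where "U = u\<^sup>2 + 4 * \<epsilon>\<^sup>2 * d1\<^sup>2"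
  define V where "V = w\<^sup>2 + f"
  define T where "T = t\<^sup>2 + \<epsilon>\<^sup>2"
  have T: "T > 0" using t by (simp add: T_def add_pos_nonneg)
  have lower: "\<kappa> * T \<le> U" "\<kappa> * T \<le> V"
  proof -
    have "\<epsilon>\<^sup>2 * \<kappa> \<le> \<epsilon>\<^sup>2 * (2 * (r1 + d1\<^sup>2))" "\<epsilon>\<^sup>2 * \<kappa> \<le> \<epsilon>\<^sup>2 * (2 * (r2 + d2\<^sup>2))"
      using p1 p2 by (auto intro!: mult_left_mono)
    then show "\<kappa> * T \<le> U" "\<kappa> * T \<le> V"
      using regularized_kernel_bounds(1)[OF e r(1), of d1] regularized_kernel_bounds(1)[OF e r(2), of d2] q1 q2
      unfolding U_def V_def T_def u_def w_def f_def by (simp_all add: algebra_simps)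
  qed
  have UV: "U > 0" "V > 0" using lower \<kappa> T mult_pos_pos[OF \<kappa> T] by linarith+
  have sq: "u\<^sup>2 \<le> U" "w\<^sup>2 \<le> V" "0 \<le> f" "f \<le> V" by (auto simp: U_def V_def f_def)
  have uw: "\<bar>u + w\<bar> \<le> (C + 2) * T"
  proof -
    have "\<bar>u + w\<bar> \<le> \<bar>(r1 - d1\<^sup>2) + (r2 - d2\<^sup>2)\<bar> + 2 * \<epsilon>\<^sup>2" 
    proof -
      have "u + w = ((r1 - d1\<^sup>2) + (r2 - d2\<^sup>2)) + 2 * \<epsilon>\<^sup>2" by (simp add: u_def w_def)
      then show ?thesis using abs_triangle_ineq[of "(r1 - d1\<^sup>2) + (r2 - d2\<^sup>2)" "2 * \<epsilon>\<^sup>2"] by simp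
    qed
    moreover have "(C + 2) * T = C * t\<^sup>2 + C * \<epsilon>\<^sup>2 + 2 * t\<^sup>2 + 2 * \<epsilon>\<^sup>2" by (simp add: T_def algebra_simps)
    moreover have "0 \<le> C * \<epsilon>\<^sup>2" "0 \<le> t\<^sup>2" using C by auto
    ultimately show ?thesis using C by linarith
  qed
  have "regularized_kernel \<epsilon> r1 d1 + regularized_kernel \<epsilon> r2 d2 = 2 * (u / U + w / V)"
    unfolding regularized_kernel_def u_def[symmetric] w_def[symmetric] U_def[symmetric] V_def[symmetric] f_def[symmetric] by simp
  also have "u / U + w / V = (u * V + w * U) / (U * V)" using UV by (simp add: add_frac_eq mult.commute)
  also have "u * V + w * U = (u + w) * (u * w + f) + w * (4 * \<epsilon>\<^sup>2 * (d1\<^sup>2 - d2\<^sup>2))"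
    unfolding U_def V_def f_def by (simp add: power2_eq_square algebra_simps)
  finally have eq: "regularized_kernel \<epsilon> r1 d1 + regularized_kernel \<epsilon> r2 d2
     = 2 * (((u + w) * (u * w + f) + w * (4 * \<epsilon>\<^sup>2 * (d1\<^sup>2 - d2\<^sup>2))) / (U * V))" .
  have A: "\<bar>(u + w) * (u * w + f)\<bar> \<le> 2 * (C + 2) / \<kappa> * (U * V)"
  proof -
    have "2 * \<bar>u * w\<bar> \<le> u\<^sup>2 + w\<^sup>2" using sum_squares_bound[of "\<bar>u\<bar>" "\<bar>w\<bar>"] by (simp add: abs_mult)
    then have uwf: "\<bar>u * w + f\<bar> \<le> (U + V) / 2 + V" using sq abs_triangle_ineq[of "u * w" f] unfolding abs_of_nonneg[OF sq(3)]
      by (simp add: field_simps)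
    define X where "X = U * V / \<kappa>"
    have TU: "T * U \<le> X" "T * V \<le> X" unfolding X_def
      using lower UV \<kappa> mult_right_mono[of "\<kappa> * T" U V] mult_right_mono[of "\<kappa> * T" V U] by (simp_all add: pos_le_divide_eq mult_ac)
    have eq': "T * ((U + V) / 2 + V) = (T * U + T * V) / 2 + T * V" by (simp add: field_simps)
    have "T * ((U + V) / 2 + V) \<le> 2 * X" unfolding eq' using TU by (simp add: field_simps)
    with uwf have "T * \<bar>u * w + f\<bar> \<le> 2 * X"
      using T mult_left_mono[of "\<bar>u * w + f\<bar>" "(U + V) / 2 + V" T] by linarith
    then have "(C + 2) * (T * \<bar>u * w + f\<bar>) \<le> (C + 2) * (2 * X)" using C by (intro mult_left_mono) auto
    moreover have "\<bar>u + w\<bar> * \<bar>u * w + f\<bar> \<le> (C + 2) * T * \<bar>u * w + f\<bar>" using uw by (intro mult_right_mono) auto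
    ultimately show ?thesis by (simp add: abs_mult X_def mult_ac)
  qed
  have B: "\<bar>w * (4 * \<epsilon>\<^sup>2 * (d1\<^sup>2 - d2\<^sup>2))\<bar> \<le> 2 * D * (1 + 1 / \<kappa>) / \<kappa> * (U * V)"
  proof -
    have "t\<^sup>2 \<le> V / \<kappa>" "\<epsilon>\<^sup>2 \<le> U / \<kappa>"
    proof -
      have "\<kappa> * t\<^sup>2 \<le> \<kappa> * T" "\<kappa> * \<epsilon>\<^sup>2 \<le> \<kappa> * T" using \<kappa> by (auto simp: T_def)
      then have "\<kappa> * t\<^sup>2 \<le> V" "\<kappa> * \<epsilon>\<^sup>2 \<le> U" using lower by linarith+
      then show "t\<^sup>2 \<le> V / \<kappa>" "\<epsilon>\<^sup>2 \<le> U / \<kappa>" using \<kappa> by (simp_all add: pos_le_divide_eq mult.commute)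
    qed
    moreover have "2 * (\<bar>w\<bar> * t) \<le> w\<^sup>2 + t\<^sup>2" using sum_squares_bound[of "\<bar>w\<bar>" t] by (simp add: mult.assoc)
    ultimately have wt: "2 * (\<bar>w\<bar> * t) \<le> V * (1 + 1 / \<kappa>)" and eU: "\<epsilon>\<^sup>2 \<le> U / \<kappa>" using sq by (simp_all add: algebra_simps)
    have "2 * (\<bar>w\<bar> * t) * \<epsilon>\<^sup>2 \<le> V * (1 + 1 / \<kappa>) * (U / \<kappa>)"
      by (rule mult_mono[OF wt eU]) (use UV \<kappa> t in auto)
    then have "2 * D * (2 * (\<bar>w\<bar> * t) * \<epsilon>\<^sup>2) \<le> 2 * D * (V * (1 + 1 / \<kappa>) * (U / \<kappa>))" using D by (intro mult_left_mono) auto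
    moreover have "\<bar>w\<bar> * (4 * \<epsilon>\<^sup>2) * \<bar>d1\<^sup>2 - d2\<^sup>2\<bar> \<le> \<bar>w\<bar> * (4 * \<epsilon>\<^sup>2) * (D * t)" using D by (intro mult_left_mono) auto
    ultimately show ?thesis by (simp add: abs_mult mult_ac)
  qed
  have "\<bar>(u + w) * (u * w + f) + w * (4 * \<epsilon>\<^sup>2 * (d1\<^sup>2 - d2\<^sup>2))\<bar> \<le> (2 * (C + 2) / \<kappa> + 2 * D * (1 + 1 / \<kappa>) / \<kappa>) * (U * V)"
    using A B by (simp add: distrib_right)
  then have "\<bar>((u + w) * (u * w + f) + w * (4 * \<epsilon>\<^sup>2 * (d1\<^sup>2 - d2\<^sup>2))) / (U * V)\<bar> \<le> 2 * (C + 2) / \<kappa> + 2 * D * (1 + 1 / \<kappa>) / \<kappa>"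
    using UV by (simp add: abs_divide pos_divide_le_eq abs_mult)
  from mult_left_mono[OF this, of 2] show ?thesis unfolding eq abs_mult[of 2] by (simp only: abs_numeral zero_le_numeral simp_thms)
qed

text \<open>
  The principal value of the integral of \<open>\<kappa> s * cos (\<mu> * s)\<close> over \<open>s > 0\<close>, for a simple pole at \<open>a\<close>.
  Folding the line about \<open>a\<close> makes it absolutely convergent.
\<close>

definition pv_cosine :: "(real \<Rightarrow> real) \<Rightarrow> real \<Rightarrow> real \<Rightarrow> real" where
  "pv_cosine \<kappa> a \<mu> = (\<integral>t. \<kappa> (a + t) * cos (\<mu> * (a + t)) +
      (if t \<le> a then \<kappa> (a - t) * cos (\<mu> * (a - t)) else 0) \<partial>half_line)"

lemma cosine_pair: "exp (\<i> * of_real \<omega> * of_real y) + exp (\<i> * of_real \<omega> * of_real (- y)) = 2 * of_real (cos (\<omega> * y))"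
  by (simp add: cos_of_real[symmetric] cos_exp_eq mult_ac)

text \<open>
  Without a zero of \<open>r - d\<^sup>2\<close> the uniform bound \<open>2 / |r - d\<^sup>2|\<close> is integrable as it stands.
\<close>

lemma regular_spectral_limit:
  fixes r d :: "real \<Rightarrow> real" and k l :: real
  assumes k: "k > 0" and l: "l > 0"
    and [measurable]: "r \<in> borel_measurable borel" "d \<in> borel_measurable borel"
    and r: "\<And>s. r s \<ge> 0" and even: "\<And>s. r (- s) = r s" "\<And>s. (d (- s))\<^sup>2 = (d s)\<^sup>2"
    and lower: "\<And>s. l * exp s \<le> \<bar>r s - (d s)\<^sup>2\<bar>"
  shows "spectral_limit (\<lambda>\<epsilon> \<tau>. regularized_kernel \<epsilon> (r (\<tau> / k)) (d (\<tau> / k)))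
    (\<lambda>\<omega>. of_real (2 * k * (\<integral>s. 2 / (r s - (d s)\<^sup>2) * cos (\<omega> * k * s) \<partial>half_line))) 0"
proof -
  define \<gamma> where "\<gamma> = (\<lambda>\<epsilon> s. regularized_kernel \<epsilon> (r s) (d s))"
  define \<gamma>0 where "\<gamma>0 = (\<lambda>s. 2 / (r s - (d s)\<^sup>2))"
  define c where "c = (\<lambda>\<epsilon> (j::nat) s. k * \<gamma> \<epsilon> s)"
  define c0 where "c0 = (\<lambda>(j::nat) s. k * \<gamma>0 s)"
  define x where "x = (\<lambda>(j::nat) s. if j = 0 then k * s else - (k * s))"
  have sum2: "(\<Sum>j\<in>{0,1::nat}. f j) = f 0 + f 1" for f :: "nat \<Rightarrow> complex" by simp
  have [measurable]: "\<gamma> \<epsilon> \<in> borel_measurable borel" for \<epsilon> unfolding \<gamma>_def by measurable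
  have [measurable]: "\<gamma>0 \<in> borel_measurable borel" unfolding \<gamma>0_def by measurable
  have ne: "r s \<noteq> (d s)\<^sup>2" for s
  proof
    assume "r s = (d s)\<^sup>2"
    then have "l * exp s \<le> 0" using lower[of s] by simp
    then show False using mult_pos_pos[OF l exp_gt_zero[of s]] by linarith
  qed
  have b2: "\<bar>\<gamma> \<epsilon> s\<bar> \<le> 2 / l * exp (- s)" if "\<epsilon> > 0" for \<epsilon> s
  proof -
    have "\<bar>\<gamma> \<epsilon> s\<bar> \<le> 2 / \<bar>r s - (d s)\<^sup>2\<bar>"
      unfolding \<gamma>_def by (rule regularized_kernel_bounds(3)[OF that r ne])
    also have "\<dots> \<le> 2 / (l * exp s)"
      using lower[of s] ne[of s] l by (intro divide_left_mono) (auto intro!: mult_pos_pos)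
    also have "\<dots> = 2 / l * exp (- s)" by (simp add: exp_minus field_simps)
    finally show ?thesis .
  qed
  have main: "spectral_limit (\<lambda>\<epsilon> \<tau>. \<gamma> \<epsilon> (\<tau> / k))
    (\<lambda>\<omega>. \<integral>s. (\<Sum>j\<in>{0,1}. c0 j s *\<^sub>R exp (\<i> * of_real \<omega> * of_real (x j s))) \<partial>half_line) 0"
  proof (rule spectral_limit_of_kernel[where c=c, OF sigma_finite_half_line])
    show "c \<epsilon> j \<in> borel_measurable half_line" "c0 j \<in> borel_measurable half_line" "x j \<in> borel_measurable half_line" for \<epsilon> j
      unfolding c_def c0_def x_def by measurable
    show "integrable half_line (\<lambda>s. (2 * (k * (2 / l))) * exp (- 1 * s))"
      by (rule integrable_half_line_exp) simp
    show "AE s in half_line. \<forall>j\<in>{0,1}. ((\<lambda>\<epsilon>. c \<epsilon> j s) \<longlongrightarrow> c0 j s) (at_right 0)"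
      unfolding c_def c0_def \<gamma>_def \<gamma>0_def by (intro AE_I2 ballI tendsto_intros regularized_kernel_tendsto ne)
    fix \<epsilon> :: real assume e: "\<epsilon> > 0"
    {
      fix \<phi> B and s :: real assume s: "s \<in> space half_line" and \<phi>: "C2_bounded \<phi> B"
      have "norm (\<Sum>j\<in>{0,1}. c \<epsilon> j s *\<^sub>R \<phi> (x j s)) \<le> (\<Sum>j\<in>{0,1::nat}. k * (2 / l * exp (- s)) * B)"
      proof (rule sum_norm_le)
        show "norm (c \<epsilon> j s *\<^sub>R \<phi> (x j s)) \<le> k * (2 / l * exp (- s)) * B" for j
          unfolding norm_scaleR c_def abs_mult using b2[OF e, of s] k C2_bounded_norm[OF \<phi>] l
          by (intro mult_mono) auto
      qed
      then show "norm (\<Sum>j\<in>{0,1}. c \<epsilon> j s *\<^sub>R \<phi> (x j s)) \<le> (2 * (k * (2 / l))) * exp (- 1 * s) * B"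
        by (simp add: mult_ac)
    }
    fix \<phi> assume \<phi>: "schwartz \<phi>"
    have fold: "\<gamma> \<epsilon> \<in> borel_measurable borel" "\<And>s. \<gamma> \<epsilon> (- s) = \<gamma> \<epsilon> s" "\<And>s. \<bar>\<gamma> \<epsilon> s\<bar> \<le> 2 / \<epsilon>\<^sup>2"
      using regularized_kernel_bounds(2)[OF e r] by (simp_all add: \<gamma>_def regularized_kernel_def even)
    note fold = even_kernel_fold[OF k fold \<phi>]
    show "integrable lborel (\<lambda>s. complex_of_real (\<gamma> \<epsilon> (s / k)) * \<phi> s)" by (rule fold(1))
    show "(\<integral>s. complex_of_real (\<gamma> \<epsilon> (s / k)) * \<phi> s \<partial>lborel) = (\<integral>s. (\<Sum>j\<in>{0,1}. c \<epsilon> j s *\<^sub>R \<phi> (x j s)) \<partial>half_line)"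
      unfolding fold(4) sum2 by (simp add: c_def x_def)
  qed simp
  have "(\<integral>s. (\<Sum>j\<in>{0,1}. c0 j s *\<^sub>R exp (\<i> * of_real \<omega> * of_real (x j s))) \<partial>half_line)
     = of_real (2 * k * (\<integral>s. \<gamma>0 s * cos (\<omega> * k * s) \<partial>half_line))" for \<omega>
  proof -
    have "(\<Sum>j\<in>{0,1}. c0 j s *\<^sub>R exp (\<i> * of_real \<omega> * of_real (x j s))) = of_real (2 * k * (\<gamma>0 s * cos (\<omega> * k * s)))" for s
    proof -
      have "(\<Sum>j\<in>{0,1}. c0 j s *\<^sub>R exp (\<i> * of_real \<omega> * of_real (x j s))) =
        of_real (k * \<gamma>0 s) * (exp (\<i> * of_real \<omega> * of_real (k * s)) + exp (\<i> * of_real \<omega> * of_real (- (k * s))))"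
        unfolding sum2 by (simp add: c0_def x_def scaleR_conv_of_real algebra_simps)
      then show ?thesis unfolding cosine_pair by (simp add: mult_ac)
    qed
    then show ?thesis by (simp only: integral_complex_of_real) simp
  qed
  with main show ?thesis by (simp add: \<gamma>_def \<gamma>0_def)
qed

text \<open>
  The function \<open>q = r - d\<^sup>2\<close> has the simple zero \<open>a\<close>, and its other factor stays above \<open>A + E\<close>
  because \<open>cosh s \<ge> 1\<close>. Folded about \<open>a\<close>, the kernel is bounded for \<open>t \<le> a\<close> by the pairing
  estimate and the Lipschitz continuity of \<open>\<phi>\<close>, and decays like \<open>exp (- t)\<close> beyond.
\<close>

lemma singular_spectral_limit:
  fixes k a h A E :: real
  defines "q \<equiv> \<lambda>s. - (k\<^sup>2 * ((cosh s - cosh a) * (A * cosh s + E)))"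
  defines "d \<equiv> \<lambda>s. k * h * sinh s"
  assumes k: "k > 0" and a: "a > 0" and h: "h > 0" and A: "A \<ge> 0" and pos: "A + E > 0"
    and r: "\<And>s. q s + (d s)\<^sup>2 \<ge> 0"
  shows "spectral_limit (\<lambda>\<epsilon> \<tau>. regularized_kernel \<epsilon> (q (\<tau> / k) + (d (\<tau> / k))\<^sup>2) (d (\<tau> / k)))
    (\<lambda>\<omega>. of_real (2 * k * pv_cosine (\<lambda>s. 2 / q s) a (\<omega> * k))) 0"
proof -
  define \<gamma> where "\<gamma> = (\<lambda>\<epsilon> s. regularized_kernel \<epsilon> (q s + (d s)\<^sup>2) (d s))"
  define \<gamma>0 where "\<gamma>0 = (\<lambda>s. 2 / q s)"
  define c where "c = (\<lambda>\<epsilon> (j::nat) t. if j < 2 then k * \<gamma> \<epsilon> (a + t) else if t \<le> a then k * \<gamma> \<epsilon> (a - t) else 0)"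
  define c0 where "c0 = (\<lambda>(j::nat) t. if j < 2 then k * \<gamma>0 (a + t) else if t \<le> a then k * \<gamma>0 (a - t) else 0)"
  define x where "x = (\<lambda>(j::nat) t. if j = 0 then k * (a + t) else if j = 1 then - (k * (a + t))
      else if j = 2 then k * (a - t) else - (k * (a - t)))"
  have sum4: "(\<Sum>j\<in>{0,1,2,3::nat}. f j) = f 0 + f 1 + (f 2 + f 3)" for f :: "nat \<Rightarrow> complex" by (simp add: add.assoc)
  have [measurable]: "q \<in> borel_measurable borel" "d \<in> borel_measurable borel" unfolding q_def d_def by measurable
  have [measurable]: "\<gamma> \<epsilon> \<in> borel_measurable borel" for \<epsilon> unfolding \<gamma>_def by measurable
  have [measurable]: "\<gamma>0 \<in> borel_measurable borel" unfolding \<gamma>0_def by measurable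
  have m_lower: "A + E \<le> A * cosh s + E" for s
    using A cosh_real_ge_1[of s] mult_left_mono[of 1 "cosh s" A] by simp
  have q_lower: "k\<^sup>2 * (A + E) * v \<le> \<bar>q s\<bar>" if "v \<le> \<bar>cosh s - cosh a\<bar>" "0 \<le> v" for v s
  proof -
    have "(A + E) * v \<le> (A * cosh s + E) * \<bar>cosh s - cosh a\<bar>"
      using that m_lower[of s] pos by (intro mult_mono) auto
    then have "k\<^sup>2 * ((A + E) * v) \<le> k\<^sup>2 * ((A * cosh s + E) * \<bar>cosh s - cosh a\<bar>)" by (intro mult_left_mono) auto
    also have "\<dots> = \<bar>q s\<bar>" using m_lower[of s] pos by (simp add: q_def abs_mult)
    finally show ?thesis by (simp add: mult.assoc)
  qed
  define l where "l = k\<^sup>2 * (A + E) * sinh (a / 2)"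
  have l: "l > 0" using k pos a by (simp add: l_def)
  have q_near: "l * t \<le> \<bar>q (a + t)\<bar>" "l * t \<le> \<bar>q (a - t)\<bar>" if "0 < t" "t \<le> a" for t
    using q_lower[OF cosh_near_lower(1)[OF that]] q_lower[OF cosh_near_lower(2)[OF that]] that a by (simp_all add: l_def mult.assoc)
  define l' where "l' = k\<^sup>2 * (A + E) * ((1 - exp (- a))\<^sup>2 / 2)"
  have l': "l' > 0" using k pos a by (simp add: l'_def)
  have q_far: "l' * exp t \<le> \<bar>q (a + t)\<bar>" if "a \<le> t" for t
    using q_lower[of "(1 - exp (- a))\<^sup>2 / 2 * exp t" "a + t"] cosh_far_lower[OF a that] by (simp add: l'_def mult.assoc)
  have q_ne: "q (a + t) \<noteq> 0" if "t > 0" for t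
  proof (cases "t \<le> a")
    case True then show ?thesis using q_near(1)[OF that True] mult_pos_pos[OF l that] by auto
  next
    case False then show ?thesis using q_far[of t] mult_pos_pos[OF l' exp_gt_zero[of t]] by auto
  qed
  have q_ne': "q (a - t) \<noteq> 0" if "t > 0" "t \<le> a" for t
    using q_near(2)[OF that] mult_pos_pos[OF l that(1)] by auto
  have \<gamma>_le: "\<bar>\<gamma> \<epsilon> s\<bar> \<le> 2 / v" if "\<epsilon> > 0" "v \<le> \<bar>q s\<bar>" "0 < v" for \<epsilon> s v
  proof -
    have "q s \<noteq> 0" using that by auto
    then have "\<bar>\<gamma> \<epsilon> s\<bar> \<le> 2 / \<bar>q s\<bar>"
      unfolding \<gamma>_def using regularized_kernel_bounds(3)[OF that(1) r[of s], of "d s"] by simp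
    also have "\<dots> \<le> 2 / v" using that by (intro divide_left_mono) auto
    finally show ?thesis .
  qed
  have lim: "((\<lambda>\<epsilon>. \<gamma> \<epsilon> s) \<longlongrightarrow> \<gamma>0 s) (at_right 0)" if "q s \<noteq> 0" for s
    using regularized_kernel_tendsto[of "q s + (d s)\<^sup>2" "d s"] that by (simp add: \<gamma>_def \<gamma>0_def)
  \<comment> \<open>\<open>r + d\<^sup>2\<close> does not vanish: \<open>r = d = 0\<close> would force \<open>s = 0\<close>, but \<open>q 0 > 0\<close>\<close>
  obtain p where p: "p > 0" "\<And>s. 0 \<le> s \<Longrightarrow> s \<le> 2 * a \<Longrightarrow> p \<le> 2 * (q s + (d s)\<^sup>2 + (d s)\<^sup>2)"
  proof -
    let ?f = "\<lambda>s. 2 * (q s + (d s)\<^sup>2 + (d s)\<^sup>2)"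
    have "continuous_on {0..2 * a} ?f" unfolding q_def d_def by (intro continuous_intros)
    then obtain s0 where s0: "s0 \<in> {0..2 * a}" "\<And>s. s \<in> {0..2 * a} \<Longrightarrow> ?f s0 \<le> ?f s"
      using continuous_attains_inf[of "{0..2 * a}" ?f] a by auto
    have "?f s0 > 0"
    proof (rule ccontr)
      assume "\<not> ?thesis"
      then have "q s0 + (d s0)\<^sup>2 + (d s0)\<^sup>2 \<le> 0" by simp
      then have "(d s0)\<^sup>2 \<le> 0" "q s0 \<le> - (d s0)\<^sup>2 - (d s0)\<^sup>2" using r[of s0] by linarith+
      then have "d s0 = 0" by simp
      then have "s0 = 0" using k h by (simp add: d_def)
      then have "q s0 > 0" using k a pos cosh_real_nonneg_less_iff[of 0 a] by (auto simp: q_def mult_less_0_iff zero_less_mult_iff add.commute)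
      then show False using \<open>d s0 = 0\<close> \<open>q s0 \<le> - (d s0)\<^sup>2 - (d s0)\<^sup>2\<close> by simp
    qed
    with s0 show ?thesis by (intro that[of "?f s0"]) auto
  qed
  define \<kappa> where "\<kappa> = min (l\<^sup>2) p"
  have \<kappa>: "\<kappa> > 0" using l p by (simp add: \<kappa>_def)
  \<comment> \<open>constants for the second order of \<open>q (a + t) + q (a - t)\<close> and first order of \<open>d\<^sup>2 (a + t) - d\<^sup>2 (a - t)\<close>, in terms of \<open>sinh t \<le> t cosh a\<close>\<close>
  define C where "C = k\<^sup>2 * (A * (2 * (cosh a + sinh a)\<^sup>2) + (A * cosh a + E) * (2 * cosh a)) * (cosh a)\<^sup>2"
  define D where "D = k\<^sup>2 * h\<^sup>2 * (4 * cosh a * sinh a * cosh a) * cosh a"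
  have mA: "A * cosh a + E > 0" using m_lower[of a] pos by linarith
  have CD: "0 \<le> C" "0 \<le> D" using k h A mA a by (auto simp: C_def D_def)
  have sinh_le: "sinh t \<le> t * cosh a" if "0 < t" "t \<le> a" for t
  proof -
    have "\<exists>z>0. z < t \<and> sinh t - sinh 0 = (t - 0) * cosh z"
      by (rule MVT2) (use that in \<open>auto intro!: derivative_eq_intros\<close>)
    then obtain z where "z > 0" "z < t" "sinh t - sinh 0 = (t - 0) * cosh z" by blast
    moreover have "cosh z \<le> cosh a" using \<open>z > 0\<close> \<open>z < t\<close> that by (subst cosh_real_nonneg_le_iff) auto
    ultimately show ?thesis using that by (simp add: mult_left_mono)
  qed
  have near: "\<bar>q (a + t) + q (a - t)\<bar> \<le> C * t\<^sup>2" "\<bar>(d (a + t))\<^sup>2 - (d (a - t))\<^sup>2\<bar> \<le> D * t" if t: "0 < t" "t \<le> a" for t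
  proof -
    define S where "S = sinh t"
    have S: "0 \<le> S" "S \<le> t * cosh a" using sinh_le[OF t] t by (auto simp: S_def)
    have S2: "S\<^sup>2 \<le> (cosh a)\<^sup>2 * t\<^sup>2" using power_mono[OF S(2,1), of 2] by (simp add: power_mult_distrib mult.commute)
    define \<delta> where "\<delta> = cosh a * (cosh t - 1)"
    define \<sigma> where "\<sigma> = sinh a * S"
    have xp: "cosh (a + t) = cosh a + (\<delta> + \<sigma>)" "cosh (a - t) = cosh a + (\<delta> - \<sigma>)"
      by (simp_all add: cosh_add cosh_diff \<delta>_def \<sigma>_def S_def algebra_simps)
    have c1: "cosh t - 1 \<le> S\<^sup>2" "0 \<le> cosh t - 1" using cosh_minus_one_le[of t] cosh_real_ge_1[of t] by (auto simp: S_def)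
    have c2: "cosh t - 1 \<le> S" 
      using exp_ge_add_one_self[of "-t"] t by (simp add: S_def cosh_def sinh_def field_simps)
    have \<delta>: "0 \<le> \<delta>" "\<delta> \<le> cosh a * S" "\<delta> \<le> cosh a * S\<^sup>2" using c1 c2 by (auto simp: \<delta>_def intro!: mult_left_mono)
    have \<sigma>: "0 \<le> \<sigma>" using a S by (simp add: \<sigma>_def)
    have "\<delta>\<^sup>2 + \<sigma>\<^sup>2 \<le> (\<delta> + \<sigma>)\<^sup>2" using \<delta> \<sigma> by (simp add: power2_sum)
    also have "\<dots> \<le> ((cosh a + sinh a) * S)\<^sup>2" using \<delta> \<sigma> by (intro power_mono) (auto simp: \<sigma>_def algebra_simps)
    finally have sq: "\<delta>\<^sup>2 + \<sigma>\<^sup>2 \<le> (cosh a + sinh a)\<^sup>2 * S\<^sup>2" by (simp add: power_mult_distrib)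
    have "q (a + t) + q (a - t) = - (k\<^sup>2 * (A * (2 * (\<delta>\<^sup>2 + \<sigma>\<^sup>2)) + (A * cosh a + E) * (2 * \<delta>)))"
      unfolding q_def xp by (simp add: power2_eq_square algebra_simps)
    then have "\<bar>q (a + t) + q (a - t)\<bar> = k\<^sup>2 * (A * (2 * (\<delta>\<^sup>2 + \<sigma>\<^sup>2)) + (A * cosh a + E) * (2 * \<delta>))"
      using A mA \<delta> by (simp add: abs_mult)
    also have "\<dots> \<le> k\<^sup>2 * (A * (2 * ((cosh a + sinh a)\<^sup>2 * S\<^sup>2)) + (A * cosh a + E) * (2 * (cosh a * S\<^sup>2)))"
      using A mA \<delta> sq by (intro mult_left_mono add_mono) auto
    also have "\<dots> = k\<^sup>2 * (A * (2 * (cosh a + sinh a)\<^sup>2) + (A * cosh a + E) * (2 * cosh a)) * S\<^sup>2"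
      by (simp add: algebra_simps)
    also have "\<dots> \<le> k\<^sup>2 * (A * (2 * (cosh a + sinh a)\<^sup>2) + (A * cosh a + E) * (2 * cosh a)) * ((cosh a)\<^sup>2 * t\<^sup>2)"
      using S2 A mA by (intro mult_left_mono) auto
    finally show "\<bar>q (a + t) + q (a - t)\<bar> \<le> C * t\<^sup>2" by (simp add: C_def mult_ac)
    have "(sinh (a + t))\<^sup>2 - (sinh (a - t))\<^sup>2 = 4 * cosh a * sinh a * cosh t * S"
      by (simp add: sinh_add sinh_diff S_def power2_eq_square algebra_simps)
    then have "(d (a + t))\<^sup>2 - (d (a - t))\<^sup>2 = k\<^sup>2 * h\<^sup>2 * (4 * cosh a * sinh a * cosh t * S)"
      unfolding d_def power_mult_distrib right_diff_distrib[symmetric] by simp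
    then have "\<bar>(d (a + t))\<^sup>2 - (d (a - t))\<^sup>2\<bar> = k\<^sup>2 * h\<^sup>2 * (4 * cosh a * sinh a * cosh t * S)"
      using a S by (simp add: abs_mult)
    also have "\<dots> \<le> k\<^sup>2 * h\<^sup>2 * (4 * cosh a * sinh a * cosh a * (t * cosh a))"
      using a S t cosh_real_nonneg_le_iff[of t a] by (intro mult_left_mono mult_mono) auto
    finally show "\<bar>(d (a + t))\<^sup>2 - (d (a - t))\<^sup>2\<bar> \<le> D * t" by (simp add: D_def mult_ac)
  qed
  define M where "M = 2 * (2 * (C + 2) / \<kappa> + 2 * D * (1 + 1 / \<kappa>) / \<kappa>)"
  have pair: "\<bar>\<gamma> \<epsilon> (a + t) + \<gamma> \<epsilon> (a - t)\<bar> \<le> M" if e: "\<epsilon> > 0" and t: "0 < t" "t \<le> a" for \<epsilon> t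
    unfolding \<gamma>_def M_def
  proof (rule paired_kernel_bound[OF e t(1) r r \<kappa>])
    have "(l * t)\<^sup>2 \<le> \<bar>q (a + t)\<bar>\<^sup>2" "(l * t)\<^sup>2 \<le> \<bar>q (a - t)\<bar>\<^sup>2"
      using power_mono[OF q_near(1)[OF t], of 2] power_mono[OF q_near(2)[OF t], of 2] l t by simp_all
    moreover have "\<kappa> * t\<^sup>2 \<le> l\<^sup>2 * t\<^sup>2" by (intro mult_right_mono) (auto simp: \<kappa>_def)
    ultimately show "\<kappa> * t\<^sup>2 \<le> (q (a + t) + (d (a + t))\<^sup>2 - (d (a + t))\<^sup>2)\<^sup>2" "\<kappa> * t\<^sup>2 \<le> (q (a - t) + (d (a - t))\<^sup>2 - (d (a - t))\<^sup>2)\<^sup>2"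
      by (simp_all add: power_mult_distrib)
    show "\<kappa> \<le> 2 * (q (a + t) + (d (a + t))\<^sup>2 + (d (a + t))\<^sup>2)" "\<kappa> \<le> 2 * (q (a - t) + (d (a - t))\<^sup>2 + (d (a - t))\<^sup>2)"
      using p(2)[of "a + t"] p(2)[of "a - t"] t by (simp_all add: \<kappa>_def min_le_iff_disj)
    show "\<bar>q (a + t) + (d (a + t))\<^sup>2 - (d (a + t))\<^sup>2 + (q (a - t) + (d (a - t))\<^sup>2 - (d (a - t))\<^sup>2)\<bar> \<le> C * t\<^sup>2"
      using near(1)[OF t] by simp
  qed (use near(2)[OF t] CD in auto)
  have M: "0 \<le> M" using CD \<kappa> by (auto simp: M_def)
  have main: "spectral_limit (\<lambda>\<epsilon> \<tau>. \<gamma> \<epsilon> (\<tau> / k))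
    (\<lambda>\<omega>. \<integral>t. (\<Sum>j\<in>{0,1,2,3}. c0 j t *\<^sub>R exp (\<i> * of_real \<omega> * of_real (x j t))) \<partial>half_line) 0"
  proof (rule spectral_limit_of_kernel[where c=c, OF sigma_finite_half_line])
    show "c \<epsilon> j \<in> borel_measurable half_line" "c0 j \<in> borel_measurable half_line" "x j \<in> borel_measurable half_line" for \<epsilon> j
      unfolding c_def c0_def x_def by measurable
    let ?C = "k * (2 * M + 8 * k / l)" and ?D = "4 * k / l'"
    show "integrable half_line (\<lambda>s. (?C * exp a + ?D) * exp (- 1 * s))"
      by (rule integrable_half_line_exp) simp
    show "AE t in half_line. \<forall>j\<in>{0,1,2,3}. ((\<lambda>\<epsilon>. c \<epsilon> j t) \<longlongrightarrow> c0 j t) (at_right 0)"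
      by (rule AE_half_line[of 0]) (use q_ne q_ne' in \<open>auto simp: c_def c0_def intro!: tendsto_mult_left lim\<close>)
    fix \<epsilon> :: real assume e: "\<epsilon> > 0"
    {
      fix \<phi> B and t :: real assume t: "t \<in> space half_line" and \<phi>: "C2_bounded \<phi> B"
      have B: "0 \<le> B" using C2_bounded_nonneg[OF \<phi>] .
      define \<psi> where "\<psi> = (\<lambda>s. \<phi> (k * s) + \<phi> (- (k * s)))"
      have \<psi>: "norm (\<psi> s) \<le> 2 * B" for s
        unfolding \<psi>_def using norm_triangle_ineq[of "\<phi> (k * s)" "\<phi> (- (k * s))"] C2_bounded_norm[OF \<phi>, of "k * s"]
          C2_bounded_norm[OF \<phi>, of "- (k * s)"] by linarith
      have \<psi>L: "norm (\<psi> (a + t) - \<psi> (a - t)) \<le> 4 * k * B * t" if "t > 0" for t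
      proof -
        have "\<psi> (a + t) - \<psi> (a - t) = (\<phi> (k * (a + t)) - \<phi> (k * (a - t))) + (\<phi> (- (k * (a + t))) - \<phi> (- (k * (a - t))))"
          by (simp add: \<psi>_def)
        also have "norm \<dots> \<le> B * \<bar>k * (a + t) - k * (a - t)\<bar> + B * \<bar>- (k * (a + t)) - (- (k * (a - t)))\<bar>"
          by (intro order_trans[OF norm_triangle_ineq] add_mono C2_bounded_Lipschitz[OF \<phi>])
        also have "k * (a + t) - k * (a - t) = 2 * k * t" by (simp add: algebra_simps)
        also have "- (k * (a + t)) - (- (k * (a - t))) = - (2 * k * t)" by (simp add: algebra_simps)
        finally show ?thesis using k that by (simp add: abs_mult mult_ac)
      qed
      define K where "K = (\<lambda>t. (k * \<gamma> \<epsilon> (a + t)) *\<^sub>R \<psi> (a + t) + (if t \<le> a then (k * \<gamma> \<epsilon> (a - t)) *\<^sub>R \<psi> (a - t) else 0))"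
      have eq: "(\<Sum>j\<in>{0,1,2,3}. c \<epsilon> j t *\<^sub>R \<phi> (x j t)) = K t" for t
        unfolding sum4 by (simp add: K_def \<psi>_def c_def x_def scaleR_add_right)
      have "norm (K t) \<le> (?C * B * exp a + ?D * B) * exp (- t)"
      proof (rule exp_bound_cases[where a=a and f="\<lambda>t. norm (K t)"])
        fix t :: real assume t: "t > 0" "t \<le> a"
        \<comment> \<open>the sum of the kernels is bounded, and the difference of the values of \<open>\<psi>\<close> absorbs the remaining factor \<open>1 / t\<close>\<close>
        have "K t = k *\<^sub>R ((\<gamma> \<epsilon> (a + t) + \<gamma> \<epsilon> (a - t)) *\<^sub>R \<psi> (a + t) - \<gamma> \<epsilon> (a - t) *\<^sub>R (\<psi> (a + t) - \<psi> (a - t)))"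
          using t by (simp add: K_def algebra_simps)
        then have "norm (K t) \<le> k * (\<bar>\<gamma> \<epsilon> (a + t) + \<gamma> \<epsilon> (a - t)\<bar> * norm (\<psi> (a + t)) + \<bar>\<gamma> \<epsilon> (a - t)\<bar> * norm (\<psi> (a + t) - \<psi> (a - t)))"
          using k by (auto intro!: mult_left_mono order_trans[OF norm_triangle_ineq4])
        also have "\<dots> \<le> k * (M * (2 * B) + 2 / (l * t) * (4 * k * B * t))"
          using pair[OF e t] \<psi>[of "a + t"] \<psi>L[OF t(1)] \<gamma>_le[OF e q_near(2)[OF t]] l t k B M
          by (intro mult_left_mono add_mono mult_mono) auto
        also have "\<dots> = ?C * B" using t by (simp add: algebra_simps)
        finally show "norm (K t) \<le> ?C * B" .
      next
        fix t :: real assume t: "t > 0" "t > a"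
        have "norm (K t) = k * \<bar>\<gamma> \<epsilon> (a + t)\<bar> * norm (\<psi> (a + t))"
          using t k by (simp add: K_def abs_mult)
        also have "\<dots> \<le> k * (2 / (l' * exp t)) * (2 * B)"
          using t k \<psi>[of "a + t"] \<gamma>_le[OF e q_far, of t] l' by (intro mult_mono mult_left_mono) auto
        also have "\<dots> = ?D * B * exp (- t)" by (simp add: exp_minus field_simps)
        finally show "norm (K t) \<le> ?D * B * exp (- t)" .
      qed (use k l l' B M t in auto)
      then show "norm (\<Sum>j\<in>{0,1,2,3}. c \<epsilon> j t *\<^sub>R \<phi> (x j t)) \<le> (?C * exp a + ?D) * exp (- 1 * t) * B"
        unfolding eq by (simp add: algebra_simps)
    }
    fix \<phi> assume \<phi>: "schwartz \<phi>"
    have [measurable]: "\<phi> \<in> borel_measurable borel" using schwartz_measurable[OF \<phi>, of 0] by simp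
    have fold: "\<gamma> \<epsilon> \<in> borel_measurable borel" "\<And>s. \<gamma> \<epsilon> (- s) = \<gamma> \<epsilon> s" "\<And>s. \<bar>\<gamma> \<epsilon> s\<bar> \<le> 2 / \<epsilon>\<^sup>2"
        apply measurable
       apply (simp add: \<gamma>_def regularized_kernel_def q_def d_def)
      apply (simp only: \<gamma>_def regularized_kernel_bounds(2)[OF e r])
      done
    note fold = even_kernel_fold[OF k fold \<phi>]
    show "integrable lborel (\<lambda>s. complex_of_real (\<gamma> \<epsilon> (s / k)) * \<phi> s)" by (rule fold(1))
    let ?H = "\<lambda>s. (k * \<gamma> \<epsilon> s) *\<^sub>R \<phi> (k * s) + (k * \<gamma> \<epsilon> s) *\<^sub>R \<phi> (- (k * s))"
    have "(\<integral>s. ?H s \<partial>half_line) = (\<integral>t. ?H (a + t) + (if t \<le> a then ?H (a - t) else 0) \<partial>half_line)"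
      by (rule half_line_fold_at(1)[OF _ Bochner_Integration.integrable_add[OF fold(2,3)] a]) measurable
    also have "\<dots> = (\<integral>t. (\<Sum>j\<in>{0,1,2,3}. c \<epsilon> j t *\<^sub>R \<phi> (x j t)) \<partial>half_line)"
      unfolding sum4 by (rule half_line_cong) (simp add: c_def x_def)
    finally show "(\<integral>s. complex_of_real (\<gamma> \<epsilon> (s / k)) * \<phi> s \<partial>lborel) = (\<integral>t. (\<Sum>j\<in>{0,1,2,3}. c \<epsilon> j t *\<^sub>R \<phi> (x j t)) \<partial>half_line)"
      unfolding fold(4) .
  qed simp
  have "(\<integral>t. (\<Sum>j\<in>{0,1,2,3}. c0 j t *\<^sub>R exp (\<i> * of_real \<omega> * of_real (x j t))) \<partial>half_line)
     = of_real (2 * k * pv_cosine \<gamma>0 a (\<omega> * k))" for \<omega>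
  proof -
    let ?e = "\<lambda>y. exp (\<i> * of_real \<omega> * of_real y)"
    have "(\<Sum>j\<in>{0,1,2,3}. c0 j t *\<^sub>R ?e (x j t)) = of_real (2 * k * (\<gamma>0 (a + t) * cos (\<omega> * k * (a + t)) +
      (if t \<le> a then \<gamma>0 (a - t) * cos (\<omega> * k * (a - t)) else 0)))" for t
    proof -
      have "(\<Sum>j\<in>{0,1,2,3}. c0 j t *\<^sub>R ?e (x j t)) =
        of_real (k * \<gamma>0 (a + t)) * (?e (k * (a + t)) + ?e (- (k * (a + t)))) +
        (if t \<le> a then of_real (k * \<gamma>0 (a - t)) * (?e (k * (a - t)) + ?e (- (k * (a - t)))) else 0)"
        unfolding sum4 by (simp add: c0_def x_def scaleR_conv_of_real distrib_left)
      then show ?thesis unfolding cosine_pair by (simp add: mult_ac distrib_left)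
    qed
    then show ?thesis unfolding pv_cosine_def by (simp only: integral_complex_of_real) simp
  qed
  with main show ?thesis by (simp add: \<gamma>_def \<gamma>0_def)
qed

section \<open>The integrals of the spectrum\<close>

lemma half_line_integrable_cong:
  assumes "\<And>s. s > 0 \<Longrightarrow> f s = g s" shows "integrable half_line f \<Longrightarrow> integrable half_line g"
  using Bochner_Integration.integrable_cong[of half_line half_line f g] assms by simp

lemma half_line_scale:
  fixes f :: "real \<Rightarrow> real"
  assumes "c > 0"
  shows "(\<integral>s. c * f (c * s) \<partial>half_line) = (\<integral>s. f s \<partial>half_line)"
    and "integrable half_line f \<Longrightarrow> integrable half_line (\<lambda>s. c * f (c * s))"
proof -
  have i: "(\<lambda>s. indicator {0<..} (0 + c * s) *\<^sub>R f (0 + c * s)) = (\<lambda>s. indicator {0<..} s *\<^sub>R f (c * s))"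
    using assms by (auto simp: indicator_def fun_eq_iff zero_less_mult_iff)
  have "(\<integral>s. f s \<partial>half_line) = c * (\<integral>s. indicator {0<..} s *\<^sub>R f (c * s) \<partial>lborel)"
    unfolding integral_half_line using lborel_integral_real_affine[of c "\<lambda>s. indicator {0<..} s *\<^sub>R f s" 0] assms i by simp
  also have "\<dots> = (\<integral>s. c * f (c * s) \<partial>half_line)"
    unfolding integral_half_line integral_mult_right_zero[symmetric] by (rule Bochner_Integration.integral_cong) auto
  finally show "(\<integral>s. c * f (c * s) \<partial>half_line) = (\<integral>s. f s \<partial>half_line)" by simp
  assume "integrable half_line f"
  then show "integrable half_line (\<lambda>s. c * f (c * s))"
    unfolding integrable_half_line_iff
    using lborel_integrable_real_affine[of "\<lambda>s. indicator {0<..} s *\<^sub>R f s" c 0] assms i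
      integrable_mult_right[of c lborel "\<lambda>s. indicator {0<..} s *\<^sub>R f (c * s)"]
    by (simp add: mult.left_commute)
qed

lemma half_line_shift:
  fixes f :: "real \<Rightarrow> real"
  assumes [measurable]: "f \<in> borel_measurable borel" and f: "integrable half_line f" and b: "b > 0"
  shows "(\<integral>t. (if t > b then f (t - b) else 0) \<partial>half_line) = (\<integral>s. f s \<partial>half_line)"
    and "integrable half_line (\<lambda>t. if t > b then f (t - b) else 0)"
proof -
  let ?f = "\<lambda>s. indicator {0<..} s *\<^sub>R f s"
  have f': "integrable lborel ?f" using f by (simp add: integrable_half_line_iff)
  have eq: "(\<lambda>t. indicator {0<..} t *\<^sub>R (if t > b then f (t - b) else 0)) = (\<lambda>t. ?f (- b + 1 * t))"
    using b by (auto simp: indicator_def fun_eq_iff)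
  show "integrable half_line (\<lambda>t. if t > b then f (t - b) else 0)"
    unfolding integrable_half_line_iff eq by (rule lborel_integrable_real_affine[OF f']) simp
  show "(\<integral>t. (if t > b then f (t - b) else 0) \<partial>half_line) = (\<integral>s. f s \<partial>half_line)"
    unfolding integral_half_line eq using lborel_integral_real_affine[of 1 ?f "- b"] by simp
qed

lemma hyperbolic_of_real:
  "sinh (complex_of_real x) = of_real (sinh x)" "cosh (complex_of_real x) = of_real (cosh x)"
  by (simp_all add: sinh_def cosh_def exp_of_real[symmetric] scaleR_conv_of_real)

text \<open>
  The derivative of \<open>rGamma z * rGamma (1 - z) = sin (\<pi> z) / \<pi>\<close> at \<open>z = i \<mu>\<close> expresses
  \<open>\<pi> cot (\<pi> z)\<close> as a difference of two values of the Digamma function, whose series is the one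
  below.
\<close>

lemma sums_coth:
  fixes \<mu> :: real assumes "\<mu> \<noteq> 0"
  shows "(\<lambda>n. \<mu> / ((real n + 1)\<^sup>2 + \<mu>\<^sup>2)) sums (pi / 2 * (cosh (pi * \<mu>) / sinh (pi * \<mu>)) - 1 / (2 * \<mu>))"
proof -
  let ?z = "\<i> * complex_of_real \<mu>"
  have z: "?z \<noteq> 0" "?z \<notin> \<int>" "1 - ?z \<noteq> 0" "1 + ?z \<noteq> 0"
    using assms by (auto simp: complex_eq_iff elim!: Ints_cases)
  have nonpos: "?z \<notin> \<int>\<^sub>\<le>\<^sub>0" "1 - ?z \<notin> \<int>\<^sub>\<le>\<^sub>0"
    using assms by (auto simp: complex_eq_iff elim!: nonpos_Ints_cases)
  have refl: "Digamma (1 - ?z) - Digamma ?z = of_real pi * cos (of_real pi * ?z) / sin (of_real pi * ?z)"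
  proof -
    have d1: "((\<lambda>z. rGamma z * rGamma (1 - z)) has_field_derivative
        (- rGamma ?z * Digamma ?z) * rGamma (1 - ?z) + (- rGamma (1 - ?z) * Digamma (1 - ?z)) * (- 1) * rGamma ?z) (at ?z)"
      using nonpos by (auto intro!: derivative_eq_intros)
    have fn: "(\<lambda>z::complex. rGamma z * rGamma (1 - z)) = (\<lambda>z. sin (of_real pi * z) / of_real pi)"
      by (simp add: rGamma_reflection_complex fun_eq_iff)
    have d2: "((\<lambda>z. sin (of_real pi * z) / of_real pi) has_field_derivative cos (of_real pi * ?z)) (at ?z)"
      by (auto intro!: derivative_eq_intros)
    have "(- rGamma ?z * Digamma ?z) * rGamma (1 - ?z) + (- rGamma (1 - ?z) * Digamma (1 - ?z)) * (- 1) * rGamma ?z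
       = cos (of_real pi * ?z)" by (rule DERIV_unique[OF d1[unfolded fn] d2])
    then have "(rGamma ?z * rGamma (1 - ?z)) * (Digamma (1 - ?z) - Digamma ?z) = cos (of_real pi * ?z)"
      by (simp add: algebra_simps)
    then have *: "sin (of_real pi * ?z) / of_real pi * (Digamma (1 - ?z) - Digamma ?z) = cos (of_real pi * ?z)"
      by (simp add: rGamma_reflection_complex)
    moreover have "sin (of_real pi * ?z) \<noteq> 0"
    proof
      assume "sin (of_real pi * ?z) = 0"
      then have "sinh (complex_of_real (pi * \<mu>)) = 0" by (simp add: sinh_conv_sin mult_ac)
      then have "sinh (pi * \<mu>) = 0" unfolding hyperbolic_of_real of_real_eq_0_iff .
      then show False using assms by simp
    qed
    ultimately show ?thesis by (simp add: field_simps)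
  qed
  have dig: "(\<lambda>m. of_real (ln (real m)) - (\<Sum>n<m. inverse (w + of_nat n))) \<longlonglongrightarrow> Digamma w" if "w \<noteq> 0" for w :: complex
    by (rule Digamma_LIMSEQ[OF that])
  have "(\<lambda>m. (of_real (ln (real m)) - (\<Sum>n<m. inverse (1 - ?z + of_nat n))) - (of_real (ln (real m)) - (\<Sum>n<m. inverse (1 + ?z + of_nat n))))
     \<longlonglongrightarrow> Digamma (1 - ?z) - Digamma (1 + ?z)"
    by (intro tendsto_diff dig z)
  moreover have "(of_real (ln (real m)) - (\<Sum>n<m. inverse (1 - ?z + of_nat n))) - (of_real (ln (real m)) - (\<Sum>n<m. inverse (1 + ?z + of_nat n)))
     = - (2 * \<i>) * of_real (\<Sum>n<m. \<mu> / ((real n + 1)\<^sup>2 + \<mu>\<^sup>2))" for m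
  proof -
    have "inverse (1 + ?z + of_nat n) - inverse (1 - ?z + of_nat n) = - (2 * \<i>) * of_real (\<mu> / ((real n + 1)\<^sup>2 + \<mu>\<^sup>2))" for n
    proof -
      have p: "(real n + 1)\<^sup>2 + \<mu>\<^sup>2 > 0" by (simp add: add_pos_nonneg)
      have c: "(1 + ?z + of_nat n) * (1 - ?z + of_nat n) = of_real ((real n + 1)\<^sup>2 + \<mu>\<^sup>2)"
        by (simp add: power2_eq_square algebra_simps complex_eq_iff)
      have "(1 + ?z + of_nat n) * (1 - ?z + of_nat n) \<noteq> 0"
        unfolding c of_real_eq_0_iff using p by simp
      then have nz: "1 + ?z + of_nat n \<noteq> 0" "1 - ?z + of_nat n \<noteq> 0"
        by (simp_all only: mult_eq_0_iff de_Morgan_disj simp_thms)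
      have "inverse (1 + ?z + of_nat n) - inverse (1 - ?z + of_nat n) =
         ((1 - ?z + of_nat n) - (1 + ?z + of_nat n)) / ((1 + ?z + of_nat n) * (1 - ?z + of_nat n))"
        using nz by (simp add: inverse_eq_divide diff_frac_eq)
      also have "\<dots> = - (2 * \<i>) * of_real (\<mu> / ((real n + 1)\<^sup>2 + \<mu>\<^sup>2))" unfolding c by simp
      finally show ?thesis .
    qed
    then show ?thesis by (simp add: sum_subtractf[symmetric] sum_distrib_left)
  qed
  moreover have "Digamma (1 - ?z) - Digamma (1 + ?z) = - (2 * \<i>) * of_real (pi / 2 * (cosh (pi * \<mu>) / sinh (pi * \<mu>)) - 1 / (2 * \<mu>))"
  proof -
    have "Digamma (1 + ?z) = Digamma ?z + 1 / ?z" using Digamma_plus1[OF z(1)] by (simp add: add.commute)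
    moreover have "cos (of_real pi * ?z) = of_real (cosh (pi * \<mu>))"
      using cosh_conv_cos[of "complex_of_real (pi * \<mu>)"] unfolding hyperbolic_of_real by (simp add: mult_ac)
    moreover have "sin (of_real pi * ?z) = \<i> * of_real (sinh (pi * \<mu>))"
      using sinh_conv_sin[of "complex_of_real (pi * \<mu>)"] unfolding hyperbolic_of_real by (simp add: mult_ac)
    moreover have div_i: "x / (\<i> * y) = - \<i> * (x / y)" for x y :: complex
      by (cases "y = 0") (auto simp: field_simps)
    ultimately have "Digamma (1 - ?z) - Digamma (1 + ?z) =
        - \<i> * (of_real pi * of_real (cosh (pi * \<mu>)) / of_real (sinh (pi * \<mu>))) - (- \<i> * (1 / of_real \<mu>))"
      using refl by (simp only: div_i diff_diff_eq[symmetric])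
    then show ?thesis by (simp add: algebra_simps)
  qed
  ultimately have "(\<lambda>m. - (2 * \<i>) * of_real (\<Sum>n<m. \<mu> / ((real n + 1)\<^sup>2 + \<mu>\<^sup>2)))
      \<longlonglongrightarrow> - (2 * \<i>) * of_real (pi / 2 * (cosh (pi * \<mu>) / sinh (pi * \<mu>)) - 1 / (2 * \<mu>))"
    by simp
  then have "(\<lambda>m. \<i> / 2 * (- (2 * \<i>) * of_real (\<Sum>n<m. \<mu> / ((real n + 1)\<^sup>2 + \<mu>\<^sup>2))))
      \<longlonglongrightarrow> \<i> / 2 * (- (2 * \<i>) * of_real (pi / 2 * (cosh (pi * \<mu>) / sinh (pi * \<mu>)) - 1 / (2 * \<mu>)))"
    by (rule tendsto_mult_left)
  then have "(\<lambda>m. complex_of_real (\<Sum>n<m. \<mu> / ((real n + 1)\<^sup>2 + \<mu>\<^sup>2)))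
      \<longlonglongrightarrow> of_real (pi / 2 * (cosh (pi * \<mu>) / sinh (pi * \<mu>)) - 1 / (2 * \<mu>))"
    by (simp only: mult.assoc[symmetric]) simp
  then show ?thesis unfolding sums_def by (simp only: tendsto_of_real_iff)
qed

lemma laplace_sine:
  assumes "(n::real) > 0"
  shows "integrable half_line (\<lambda>s. exp (- n * s) * sin (\<mu> * s))"
    and "(\<integral>s. exp (- n * s) * sin (\<mu> * s) \<partial>half_line) = \<mu> / (n\<^sup>2 + \<mu>\<^sup>2)"
proof -
  let ?z = "Complex n (- \<mu>)"
  have z: "Re ?z > 0" using assms by simp
  have eq: "exp (- n * s) * sin (\<mu> * s) = Im (exp (- (of_real s * ?z)))" for s
    by (simp add: Im_exp mult.commute)
  have i: "integrable half_line (\<lambda>s. exp (- (complex_of_real s * ?z)))" by (rule laplace_exp[OF z])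
  show "integrable half_line (\<lambda>s. exp (- n * s) * sin (\<mu> * s))" unfolding eq using i by (rule integrable_Im)
  have "(\<integral>s. exp (- n * s) * sin (\<mu> * s) \<partial>half_line) = Im (1 / ?z)"
    unfolding eq integral_Im[OF i] laplace_exp(2)[OF z] ..
  also have "\<dots> = \<mu> / (n\<^sup>2 + \<mu>\<^sup>2)" by (simp add: Im_divide)
  finally show "(\<integral>s. exp (- n * s) * sin (\<mu> * s) \<partial>half_line) = \<mu> / (n\<^sup>2 + \<mu>\<^sup>2)" .
qed

lemma sine_over_expm1_le:
  assumes "s > (0::real)" shows "\<bar>sin (\<mu> * s) / (exp s - 1)\<bar> \<le> \<bar>\<mu>\<bar>"
proof -
  have "s \<le> exp s - 1" using exp_ge_add_one_self[of s] by linarith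
  moreover have "\<bar>sin (\<mu> * s)\<bar> \<le> \<bar>\<mu>\<bar> * s" using abs_sin_x_le_abs_x[of "\<mu> * s"] assms by (simp add: abs_mult)
  ultimately have "\<bar>sin (\<mu> * s)\<bar> \<le> \<bar>\<mu>\<bar> * (exp s - 1)" using mult_left_mono[of s "exp s - 1" "\<bar>\<mu>\<bar>"] by linarith
  then show ?thesis using assms by (simp add: abs_divide pos_divide_le_eq)
qed

text \<open>
  Expanding \<open>1 / (exp s - 1)\<close> into \<open>N\<close> terms of the geometric series leaves a remainder of at most
  \<open>|\<mu>| / N\<close>, and the terms integrate to the partial fractions of \<open>coth\<close>.
\<close>

lemma planck_sine:
  fixes \<mu> :: real assumes "\<mu> \<noteq> 0"
  shows "integrable half_line (\<lambda>s. sin (\<mu> * s) / (exp s - 1))"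
    and "(\<integral>s. sin (\<mu> * s) / (exp s - 1) \<partial>half_line) = pi / 2 * (cosh (pi * \<mu>) / sinh (pi * \<mu>)) - 1 / (2 * \<mu>)"
proof -
  let ?f = "\<lambda>s. sin (\<mu> * s) / (exp s - 1)"
  let ?r = "\<lambda>N s. exp (- real N * s) * ?f s"
  have r_le: "norm (?r N s) \<le> \<bar>\<mu>\<bar> * exp (- real N * s)" if "s > 0" for N s
    using mult_left_mono[OF sine_over_expm1_le[OF that, of \<mu>], of "exp (- real N * s)"]
    unfolding real_norm_def abs_mult abs_exp_cancel by (simp only: mult.commute[of "\<bar>\<mu>\<bar>"] exp_ge_zero simp_thms)
  have r_int: "integrable half_line (?r N)" if "N > 0" for N
    by (rule integrable_half_line_bound[OF _ _ r_le]) (use that in auto)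
  have step: "?f s = (\<Sum>n<N. exp (- (real n + 1) * s) * sin (\<mu> * s)) + ?r N s" if "s > 0" for N s
  proof (induction N)
    case (Suc N)
    have e: "exp s - 1 \<noteq> 0" using that by simp
    have "?r N s = exp (- (real N + 1) * s) * sin (\<mu> * s) + ?r (Suc N) s"
    proof -
      have "exp (- real N * s) = exp (- (real N + 1) * s) * exp s" by (simp add: algebra_simps flip: exp_add)
      then have "?r N s = exp (- (real N + 1) * s) * sin (\<mu> * s) * (exp s / (exp s - 1))" by simp
      also have "exp s / (exp s - 1) = 1 + 1 / (exp s - 1)" using e by (simp add: field_simps)
      finally show ?thesis by (simp add: algebra_simps)
    qed
    then show ?case using Suc.IH unfolding sum.lessThan_Suc by linarith
  qed simp
  have geo: "integrable half_line (\<lambda>s. exp (- (real n + 1) * s) * sin (\<mu> * s))"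
    "(\<integral>s. exp (- (real n + 1) * s) * sin (\<mu> * s) \<partial>half_line) = \<mu> / ((real n + 1)\<^sup>2 + \<mu>\<^sup>2)" for n
    using laplace_sine[of "real n + 1" \<mu>] by simp_all
  have "integrable half_line (\<lambda>s. (\<Sum>n<1. exp (- (real n + 1) * s) * sin (\<mu> * s)) + ?r 1 s)"
    by (intro Bochner_Integration.integrable_add Bochner_Integration.integrable_sum geo r_int) simp
  then show int: "integrable half_line ?f"
    by (rule half_line_integrable_cong[rotated]) (rule step[symmetric])
  have eqN: "(\<integral>s. ?f s \<partial>half_line) - (\<Sum>n<N. \<mu> / ((real n + 1)\<^sup>2 + \<mu>\<^sup>2)) = (\<integral>s. ?r N s \<partial>half_line)" if "N > 0" for N
  proof -
    have "(\<integral>s. ?f s \<partial>half_line) = (\<integral>s. (\<Sum>n<N. exp (- (real n + 1) * s) * sin (\<mu> * s)) + ?r N s \<partial>half_line)"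
      by (rule half_line_cong) (rule step)
    also have "\<dots> = (\<Sum>n<N. \<mu> / ((real n + 1)\<^sup>2 + \<mu>\<^sup>2)) + (\<integral>s. ?r N s \<partial>half_line)"
      using geo r_int[OF that] by (subst Bochner_Integration.integral_add) (auto simp del: minus_add_distrib)
    finally show ?thesis by simp
  qed
  have bound: "norm ((\<integral>s. ?f s \<partial>half_line) - (\<Sum>n<N. \<mu> / ((real n + 1)\<^sup>2 + \<mu>\<^sup>2))) \<le> \<bar>\<mu>\<bar> / real N" if "N > 0" for N
  proof -
    have "(\<integral>s. \<bar>\<mu>\<bar> * exp (- real N * s) \<partial>half_line) = \<bar>\<mu>\<bar> / real N"
    proof -
      have "(\<integral>s. exp (- real N * s) \<partial>half_line) = Re (\<integral>s. exp (- (complex_of_real s * of_nat N)) \<partial>half_line)"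
        by (subst integral_Re[symmetric, OF laplace_exp(1)]) (use that in \<open>auto simp: Re_exp mult.commute\<close>)
      then show ?thesis using laplace_exp(2)[of "of_nat N"] that by (simp add: Re_divide power2_eq_square)
    qed
    moreover have "norm (\<integral>s. ?r N s \<partial>half_line) \<le> (\<integral>s. \<bar>\<mu>\<bar> * exp (- real N * s) \<partial>half_line)"
    proof (rule order_trans[OF integral_norm_bound], rule Bochner_Integration.integral_mono[OF integrable_norm[OF r_int[OF that]]])
      show "integrable half_line (\<lambda>s. \<bar>\<mu>\<bar> * exp (- real N * s))"
        by (rule integrable_half_line_exp) (use that in simp)
      show "norm (?r N s) \<le> \<bar>\<mu>\<bar> * exp (- real N * s)" if "s \<in> space half_line" for s
        by (rule r_le) (use that in simp)
    qed
    ultimately show ?thesis unfolding eqN[OF that] by simp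
  qed
  have "(\<lambda>N. \<Sum>n<N. \<mu> / ((real n + 1)\<^sup>2 + \<mu>\<^sup>2)) \<longlonglongrightarrow> (\<integral>s. ?f s \<partial>half_line)"
  proof (rule LIMSEQ_I)
    fix e :: real assume "e > 0"
    then obtain N0 :: nat where N0: "\<bar>\<mu>\<bar> / e < real N0" using reals_Archimedean2 by blast
    have "norm ((\<Sum>n<N. \<mu> / ((real n + 1)\<^sup>2 + \<mu>\<^sup>2)) - (\<integral>s. ?f s \<partial>half_line)) < e" if "N \<ge> Suc N0" for N
    proof -
      have "\<bar>\<mu>\<bar> / e < real N" using N0 that by linarith
      then have "\<bar>\<mu>\<bar> / real N < e" using \<open>e > 0\<close> that by (simp add: field_simps)
      then show ?thesis using bound[of N] that by (simp add: norm_minus_commute)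
    qed
    then show "\<exists>no. \<forall>N\<ge>no. norm ((\<Sum>n<N. \<mu> / ((real n + 1)\<^sup>2 + \<mu>\<^sup>2)) - (\<integral>s. ?f s \<partial>half_line)) < e" by blast
  qed
  then show "(\<integral>s. ?f s \<partial>half_line) = pi / 2 * (cosh (pi * \<mu>) / sinh (pi * \<mu>)) - 1 / (2 * \<mu>)"
    using sums_coth[OF assms] unfolding sums_def by (rule LIMSEQ_unique)
qed

lemma planck_sine_double:
  fixes \<mu> :: real assumes "\<mu> \<noteq> 0"
  shows "integrable half_line (\<lambda>s. 2 * sin (\<mu> * s) / (exp (2 * s) - 1))"
    and "(\<integral>s. 2 * sin (\<mu> * s) / (exp (2 * s) - 1) \<partial>half_line)
       = pi / 2 * (cosh (pi * \<mu> / 2) / sinh (pi * \<mu> / 2)) - 1 / \<mu>"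
  using half_line_scale[of 2 "\<lambda>s. sin (\<mu> / 2 * s) / (exp s - 1)"] planck_sine[of "\<mu> / 2"] assms
  by simp_all

text \<open>
  Since \<open>1 / (exp s + 1) = 1 / (exp s - 1) - 2 / (exp (2 s) - 1)\<close>, and by
  \<open>coth y - coth (y / 2) = - 1 / sinh y\<close>.
\<close>

lemma fermi_sine:
  fixes \<mu> :: real assumes "\<mu> \<noteq> 0"
  shows "integrable half_line (\<lambda>s. sin (\<mu> * s) * (2 / (exp s + 1)))"
    and "(\<integral>s. sin (\<mu> * s) * (2 / (exp s + 1)) \<partial>half_line) = 1 / \<mu> - pi / sinh (pi * \<mu>)"
proof -
  have eq: "sin (\<mu> * s) * (2 / (exp s + 1)) = 2 * (sin (\<mu> * s) / (exp s - 1)) - 2 * (2 * sin (\<mu> * s) / (exp (2 * s) - 1))"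
    if "s > 0" for s
  proof -
    have e: "exp s - 1 \<noteq> 0" "exp s + 1 \<noteq> 0" using that exp_gt_zero[of s] by (simp, linarith)
    have "exp (2 * s) - 1 = (exp s - 1) * (exp s + 1)" by (simp add: algebra_simps flip: exp_add)
    moreover have "S * (2 / (x + 1)) = 2 * (S / (x - 1)) - 2 * (2 * S / ((x - 1) * (x + 1)))"
      if "x - 1 \<noteq> 0" "x + 1 \<noteq> 0" for S x :: real
      using that by (simp add: divide_simps) (simp add: algebra_simps)
    ultimately show ?thesis using e by metis
  qed
  have i: "integrable half_line (\<lambda>s. 2 * (sin (\<mu> * s) / (exp s - 1)) - 2 * (2 * sin (\<mu> * s) / (exp (2 * s) - 1)))"
    using planck_sine[OF assms] planck_sine_double[OF assms]
    by (intro Bochner_Integration.integrable_diff integrable_mult_right)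
  then show "integrable half_line (\<lambda>s. sin (\<mu> * s) * (2 / (exp s + 1)))"
    by (rule half_line_integrable_cong[rotated]) (rule eq[symmetric])
  have "(\<integral>s. sin (\<mu> * s) * (2 / (exp s + 1)) \<partial>half_line) =
      (\<integral>s. 2 * (sin (\<mu> * s) / (exp s - 1)) - 2 * (2 * sin (\<mu> * s) / (exp (2 * s) - 1)) \<partial>half_line)"
    by (rule half_line_cong) (rule eq)
  also have "\<dots> = 2 * (pi / 2 * (cosh (pi * \<mu>) / sinh (pi * \<mu>)) - 1 / (2 * \<mu>))
      - 2 * (pi / 2 * (cosh (pi * \<mu> / 2) / sinh (pi * \<mu> / 2)) - 1 / \<mu>)"
    using planck_sine[OF assms] planck_sine_double[OF assms]
    by (simp only: Bochner_Integration.integral_diff integrable_mult_right integral_mult_right_zero)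
  also have "\<dots> = 1 / \<mu> - pi / sinh (pi * \<mu>)"
  proof -
    define y where "y = pi * \<mu> / 2"
    have nz: "sinh y \<noteq> 0" "cosh y \<noteq> 0" using assms by (auto simp: y_def)
    have "pi * \<mu> = 2 * y" by (simp add: y_def)
    then have d: "sinh (pi * \<mu>) = 2 * sinh y * cosh y" "cosh (pi * \<mu>) = 2 * (cosh y)\<^sup>2 - 1"
      using sinh_double[of y] cosh_double_cosh[of y] by simp_all
    have "cosh (pi * \<mu>) / sinh (pi * \<mu>) - cosh y / sinh y = - 1 / sinh (pi * \<mu>)"
      unfolding d using nz by (simp add: field_simps power2_eq_square)
    then have "pi * (cosh (pi * \<mu>) / sinh (pi * \<mu>) - cosh y / sinh y) = - pi / sinh (pi * \<mu>)" by simp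
    then show ?thesis unfolding y_def[symmetric] by (simp add: algebra_simps)
  qed
  finally show "(\<integral>s. sin (\<mu> * s) * (2 / (exp s + 1)) \<partial>half_line) = 1 / \<mu> - pi / sinh (pi * \<mu>)" .
qed

lemma integral_cos_interval:
  fixes b \<mu> :: real assumes "b > 0" "\<mu> \<noteq> 0"
  shows "integrable half_line (\<lambda>t. if t \<le> b then cos (\<mu> * (b - t)) else 0)"
    and "(\<integral>t. (if t \<le> b then cos (\<mu> * (b - t)) else 0) \<partial>half_line) = sin (\<mu> * b) / \<mu>"
proof -
  show "integrable half_line (\<lambda>t. if t \<le> b then cos (\<mu> * (b - t)) else 0)"
  proof (rule integrable_half_line_bound[where d=1 and C="exp b"])
    show "norm (if t \<le> b then cos (\<mu> * (b - t)) else 0) \<le> exp b * exp (- 1 * t)" for t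
      by (auto simp flip: exp_add intro: order_trans[OF abs_cos_le_one])
  qed auto
  have "(\<integral>t. (if t \<le> b then cos (\<mu> * (b - t)) else 0) \<partial>half_line) = (LBINT t:{0<..b}. cos (\<mu> * (b - t)))"
    unfolding integral_half_line set_lebesgue_integral_def
    by (rule Bochner_Integration.integral_cong) (auto simp: indicator_def)
  also have "\<dots> = (LBINT t=0..b. cos (\<mu> * (b - t)))"
    using assms interval_integral_Ioc[of 0 b "\<lambda>t. cos (\<mu> * (b - t))"] by (simp add: zero_ereal_def)
  also have "\<dots> = - sin (\<mu> * (b - b)) / \<mu> - (- sin (\<mu> * (b - 0)) / \<mu>)"
    unfolding zero_ereal_def
  proof (rule interval_integral_FTC_finite)
    show "((\<lambda>t. - sin (\<mu> * (b - t)) / \<mu>) has_vector_derivative cos (\<mu> * (b - x))) (at x within {min 0 b..max 0 b})" for x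
      unfolding has_real_derivative_iff_has_vector_derivative[symmetric]
      using assms by (auto intro!: derivative_eq_intros)
  qed (intro continuous_intros)
  finally show "(\<integral>t. (if t \<le> b then cos (\<mu> * (b - t)) else 0) \<partial>half_line) = sin (\<mu> * b) / \<mu>" by simp
qed

text \<open>
  The hypotheses say that \<open>\<kappa> s = n (s - b) - n (s + b)\<close>, where \<open>n\<close> is extended to negative arguments
  by \<open>n (- x) = 2 \<theta> - n x\<close>. Folded about \<open>b\<close>, the values \<open>n t\<close> carry the factor
  \<open>cos (\<mu> (b + t)) - cos (\<mu> (b - t)) = - 2 sin (\<mu> b) sin (\<mu> t)\<close> for \<open>t \<le> b\<close>. For \<open>t > b\<close> the partner is
  missing; adding it costs the integral of \<open>n t * cos (\<mu> (t - b))\<close> over \<open>t > b\<close>, which is exactly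
  the contribution of \<open>n (s + b)\<close>. A sine transform of \<open>n\<close> and an integral over \<open>(0, b)\<close> remain. The Planck factor satisfies this with
  \<open>\<theta> = - 1\<close> and the Fermi factor with \<open>\<theta> = 1\<close>.
\<close>

lemma pv_cosine_of_shifted:
  fixes n \<kappa> :: "real \<Rightarrow> real"
  assumes b: "b > 0" and \<mu>: "\<mu> \<noteq> 0" and n [measurable]: "n \<in> borel_measurable borel"
    and decay: "\<And>s. s > b \<Longrightarrow> \<bar>n s\<bar> \<le> C * exp (- s)"
    and right: "\<And>t. t > 0 \<Longrightarrow> \<kappa> (b + t) = n t - n (2 * b + t)"
    and left: "\<And>t. t > 0 \<Longrightarrow> t \<le> b \<Longrightarrow> \<kappa> (b - t) = 2 * \<theta> - n t - n (2 * b - t)"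
    and int: "integrable half_line (\<lambda>t. sin (\<mu> * t) * n t)"
  shows "integrable half_line (\<lambda>t. \<kappa> (b + t) * cos (\<mu> * (b + t)) + (if t \<le> b then \<kappa> (b - t) * cos (\<mu> * (b - t)) else 0))"
    and "pv_cosine \<kappa> b \<mu> = 2 * sin (\<mu> * b) * (\<theta> / \<mu> - (\<integral>t. sin (\<mu> * t) * n t \<partial>half_line))"
proof -
  define G where "G = (\<lambda>s. cos (\<mu> * s) * n (b + s))"
  have [measurable]: "G \<in> borel_measurable borel" unfolding G_def by measurable
  have C: "0 \<le> C"
  proof -
    have "0 \<le> C * exp (- (b + 1))" using decay[of "b + 1"] by (intro order_trans[OF abs_ge_zero]) simp
    then show ?thesis by (simp add: zero_le_mult_iff)
  qed
  have G: "integrable half_line G"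
  proof (rule integrable_half_line_bound[where d=1 and C=C])
    fix s :: real assume "s > 0"
    then have "\<bar>n (b + s)\<bar> \<le> C * exp (- (b + s))" using decay[of "b + s"] by simp
    also have "\<dots> \<le> C * exp (- 1 * s)" using C b by (intro mult_left_mono) auto
    finally have "\<bar>n (b + s)\<bar> \<le> C * exp (- 1 * s)" .
    moreover have "\<bar>cos (\<mu> * s)\<bar> * \<bar>n (b + s)\<bar> \<le> 1 * \<bar>n (b + s)\<bar>" by (intro mult_right_mono) auto
    ultimately show "norm (G s) \<le> C * exp (- 1 * s)" by (simp add: G_def abs_mult)
  qed auto
  \<comment> \<open>\<open>?P2\<close> and \<open>?P3\<close> are two forms of the integral of \<open>G\<close>: translated by \<open>b\<close> and folded about \<open>b\<close>\<close>
  let ?P1 = "\<lambda>t. (- 2 * sin (\<mu> * b)) * (sin (\<mu> * t) * n t)"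
  let ?P2 = "\<lambda>t. if t > b then G (t - b) else 0"
  let ?P3 = "\<lambda>t. G (b + t) + (if t \<le> b then G (b - t) else 0)"
  let ?P4 = "\<lambda>t. (2 * \<theta>) * (if t \<le> b then cos (\<mu> * (b - t)) else 0)"
  have i: "integrable half_line ?P1" "integrable half_line ?P2" "integrable half_line ?P3" "integrable half_line ?P4"
    using int half_line_shift(2)[OF _ G b] half_line_fold_at(2)[OF _ G b] integral_cos_interval(1)[OF b \<mu>]
    by (auto simp del: mult_minus_left)
  have pt: "\<kappa> (b + t) * cos (\<mu> * (b + t)) + (if t \<le> b then \<kappa> (b - t) * cos (\<mu> * (b - t)) else 0)
     = ?P1 t + ?P2 t - ?P3 t + ?P4 t" if t: "t > 0" for t
  proof -
    have c: "cos (\<mu> * (b + t)) = cos (\<mu> * (b - t)) - 2 * sin (\<mu> * b) * sin (\<mu> * t)"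
      by (simp add: distrib_left right_diff_distrib cos_add cos_diff)
    have c': "cos (\<mu> * (t - b)) = cos (\<mu> * (b - t))"
      using cos_minus[of "\<mu> * (b - t)"] by (simp add: algebra_simps)
    show ?thesis
    proof (cases "t \<le> b")
      case True
      have G1: "G (b + t) = cos (\<mu> * (b + t)) * n (2 * b + t)" "G (b - t) = cos (\<mu> * (b - t)) * n (2 * b - t)"
        by (simp_all add: G_def algebra_simps)
      show ?thesis using True unfolding right[OF t] left[OF t True] G1 if_P[OF True] c by (simp add: algebra_simps)
    next
      case False
      have G1: "G (b + t) = cos (\<mu> * (b + t)) * n (2 * b + t)" "G (t - b) = cos (\<mu> * (t - b)) * n t"
        by (simp_all add: G_def algebra_simps)
      show ?thesis using False unfolding right[OF t] G1 c c' by (simp add: algebra_simps)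
    qed
  qed
  have "integrable half_line (\<lambda>t. ?P1 t + ?P2 t - ?P3 t + ?P4 t)"
    by (intro Bochner_Integration.integrable_add Bochner_Integration.integrable_diff i)
  then show "integrable half_line (\<lambda>t. \<kappa> (b + t) * cos (\<mu> * (b + t)) + (if t \<le> b then \<kappa> (b - t) * cos (\<mu> * (b - t)) else 0))"
    by (rule half_line_integrable_cong[rotated]) (rule pt[symmetric])
  have "pv_cosine \<kappa> b \<mu> = (\<integral>t. ?P1 t + ?P2 t - ?P3 t + ?P4 t \<partial>half_line)"
    unfolding pv_cosine_def by (rule half_line_cong) (rule pt)
  also have "\<dots> = integral\<^sup>L half_line ?P1 + integral\<^sup>L half_line ?P2 - integral\<^sup>L half_line ?P3 + integral\<^sup>L half_line ?P4"
    by (simp only: Bochner_Integration.integral_add Bochner_Integration.integral_diff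
        Bochner_Integration.integrable_add Bochner_Integration.integrable_diff i)
  also have "integral\<^sup>L half_line ?P2 = integral\<^sup>L half_line ?P3"
    using half_line_shift(1)[OF _ G b] half_line_fold_at(1)[OF _ G b] by simp
  also have "integral\<^sup>L half_line ?P1 = (- 2 * sin (\<mu> * b)) * (\<integral>t. sin (\<mu> * t) * n t \<partial>half_line)"
    by (rule integral_mult_right_zero)
  also have "integral\<^sup>L half_line ?P4 = 2 * \<theta> * (sin (\<mu> * b) / \<mu>)"
    unfolding integral_mult_right_zero integral_cos_interval(2)[OF b \<mu>] ..
  finally show "pv_cosine \<kappa> b \<mu> = 2 * sin (\<mu> * b) * (\<theta> / \<mu> - (\<integral>t. sin (\<mu> * t) * n t \<partial>half_line))"
    by (simp add: algebra_simps)
qed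

text \<open>
  Partial fractions in \<open>exp s\<close>; likewise for the sum.
\<close>

lemma two_sinh_over_cosh_diff:
  fixes s a :: real
  assumes "s \<noteq> a" "s + a \<noteq> 0"
  shows "2 * sinh a / (cosh s - cosh a) = 2 / (exp (s - a) - 1) - 2 / (exp (s + a) - 1)"
proof -
  define x y where "x = exp s" and "y = exp a"
  have p: "x > 0" "y > 0" "x \<noteq> y" "x * y \<noteq> 1"
    using assms by (auto simp: x_def y_def simp flip: exp_add)
  have c: "cosh s - cosh a = (x - y) * (x * y - 1) / (2 * x * y)" "2 * sinh a = (y\<^sup>2 - 1) / y"
    using p by (simp_all add: cosh_def sinh_def exp_minus x_def[symmetric] y_def[symmetric] field_simps power2_eq_square)
  have e: "exp (s - a) - 1 = (x - y) / y" "exp (s + a) - 1 = x * y - 1"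
    using p by (simp_all add: exp_diff exp_add x_def[symmetric] y_def[symmetric] field_simps)
  show ?thesis unfolding c e using p by (simp add: divide_simps) (simp add: algebra_simps power2_eq_square)
qed

lemma two_sinh_over_cosh_sum:
  fixes s b :: real
  shows "2 * sinh b / (cosh s + cosh b) = 2 / (exp (s - b) + 1) - 2 / (exp (s + b) + 1)"
proof -
  define x y where "x = exp s" and "y = exp b"
  have p: "x > 0" "y > 0" by (auto simp: x_def y_def)
  have p': "x + y > 0" "x * y + 1 > 0" using p by (auto intro: add_pos_pos)
  have c: "cosh s + cosh b = (x + y) * (x * y + 1) / (2 * x * y)" "2 * sinh b = (y\<^sup>2 - 1) / y"
    using p by (simp_all add: cosh_def sinh_def exp_minus x_def[symmetric] y_def[symmetric] field_simps power2_eq_square)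
  have e: "exp (s - b) + 1 = (x + y) / y" "exp (s + b) + 1 = x * y + 1"
    using p by (simp_all add: exp_diff exp_add x_def[symmetric] y_def[symmetric] field_simps)
  show ?thesis unfolding c e using p p' by (simp add: divide_simps) (simp add: algebra_simps power2_eq_square)
qed

lemma pv_cosine_cosh_diff:
  fixes a \<mu> :: real
  assumes a: "a > 0" and \<mu>: "\<mu> \<noteq> 0"
  defines "\<kappa> \<equiv> \<lambda>s. 2 * sinh a / (cosh s - cosh a)"
  shows "integrable half_line (\<lambda>t. \<kappa> (a + t) * cos (\<mu> * (a + t)) + (if t \<le> a then \<kappa> (a - t) * cos (\<mu> * (a - t)) else 0))"
    and "pv_cosine \<kappa> a \<mu> = - (2 * pi * sin (\<mu> * a) * (cosh (pi * \<mu>) / sinh (pi * \<mu>)))"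
proof -
  let ?n = "\<lambda>s::real. 2 / (exp s - 1)"
  have n: "?n \<in> borel_measurable borel" by measurable
  have decay: "\<bar>?n s\<bar> \<le> 2 / (1 - exp (- a)) * exp (- s)" if "s > a" for s
  proof -
    have "exp s * (1 - exp (- a)) \<le> exp s - 1"
      using that by (simp add: right_diff_distrib flip: exp_add)
    then have "2 / (exp s - 1) \<le> 2 / (exp s * (1 - exp (- a)))"
      using that a by (intro divide_left_mono) (auto intro!: mult_pos_pos)
    then show ?thesis using that a by (simp add: exp_minus field_simps)
  qed
  have right: "\<kappa> (a + t) = ?n t - ?n (2 * a + t)" if "t > 0" for t
    unfolding \<kappa>_def using two_sinh_over_cosh_diff[of "a + t" a] that a by (simp add: algebra_simps)
  have left: "\<kappa> (a - t) = 2 * (- 1) - ?n t - ?n (2 * a - t)" if "t > 0" "t \<le> a" for t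
  proof -
    have "\<kappa> (a - t) = 2 / (exp (- t) - 1) - ?n (2 * a - t)"
      unfolding \<kappa>_def using two_sinh_over_cosh_diff[of "a - t" a] that a by (simp add: algebra_simps)
    also have "2 / (exp (- t) - 1) = - 2 - ?n t" using that by (simp add: exp_minus divide_simps) (simp add: algebra_simps)
    finally show ?thesis by simp
  qed
  have eq: "sin (\<mu> * t) * ?n t = 2 * (sin (\<mu> * t) / (exp t - 1))" for t by simp
  have int: "integrable half_line (\<lambda>t. sin (\<mu> * t) * ?n t)"
    unfolding eq using planck_sine(1)[OF \<mu>] by (rule integrable_mult_right)
  note * = pv_cosine_of_shifted[where \<kappa>=\<kappa> and n="?n" and \<theta>="- 1", OF a \<mu> n decay right left int]
  show "integrable half_line (\<lambda>t. \<kappa> (a + t) * cos (\<mu> * (a + t)) + (if t \<le> a then \<kappa> (a - t) * cos (\<mu> * (a - t)) else 0))"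
    by (rule *(1))
  show "pv_cosine \<kappa> a \<mu> = - (2 * pi * sin (\<mu> * a) * (cosh (pi * \<mu>) / sinh (pi * \<mu>)))"
    using *(2) unfolding eq integral_mult_right_zero planck_sine(2)[OF \<mu>] by (simp add: algebra_simps)
qed

lemma pv_cosine_cosh_sum:
  fixes a b \<mu> :: real
  assumes a: "a > 0" and \<mu>: "\<mu> \<noteq> 0" 
  shows "integrable half_line (\<lambda>s. cos (\<mu> * s) / (cosh s + cosh b))"
    and "pv_cosine (\<lambda>s. 1 / (cosh s + cosh b)) a \<mu> = (\<integral>s. cos (\<mu> * s) / (cosh s + cosh b) \<partial>half_line)"
    and "integrable half_line (\<lambda>t. 1 / (cosh (a + t) + cosh b) * cos (\<mu> * (a + t)) + (if t \<le> a then 1 / (cosh (a - t) + cosh b) * cos (\<mu> * (a - t)) else 0))"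
proof -
  have pos: "cosh s + cosh b > 0" for s using cosh_real_pos[of s] cosh_real_pos[of b] by linarith
  show i: "integrable half_line (\<lambda>s. cos (\<mu> * s) / (cosh s + cosh b))"
  proof (rule integrable_half_line_bound[where d=1 and C=2])
    fix s :: real assume "s > 0"
    have "exp s / 2 \<le> cosh s + cosh b" using cosh_real_pos[of b] by (simp add: cosh_def[of s] add_increasing2)
    then have "1 / (cosh s + cosh b) \<le> 1 / (exp s / 2)" using pos by (intro divide_left_mono) (auto intro!: mult_pos_pos)
    also have "\<dots> = 2 * exp (- 1 * s)" by (simp add: exp_minus field_simps)
    finally show "norm (cos (\<mu> * s) / (cosh s + cosh b)) \<le> 2 * exp (- 1 * s)"
      using pos[of s] divide_right_mono[OF abs_cos_le_one, of "cosh s + cosh b" "\<mu> * s"]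
      by (simp add: abs_divide)
  qed measurable
  have eq: "1 / (cosh s + cosh b) * cos (\<mu> * s) = cos (\<mu> * s) / (cosh s + cosh b)" for s by simp
  show "integrable half_line (\<lambda>t. 1 / (cosh (a + t) + cosh b) * cos (\<mu> * (a + t)) + (if t \<le> a then 1 / (cosh (a - t) + cosh b) * cos (\<mu> * (a - t)) else 0))"
    using half_line_fold_at(2)[OF _ i a] unfolding eq by simp
  show "pv_cosine (\<lambda>s. 1 / (cosh s + cosh b)) a \<mu> = (\<integral>s. cos (\<mu> * s) / (cosh s + cosh b) \<partial>half_line)"
    unfolding pv_cosine_def eq by (rule half_line_fold_at(1)[OF _ i a, symmetric]) measurable
qed

text \<open>
  For \<open>b = 0\<close> the difference of two translates degenerates to a derivative of the Fermi
  factor, and an integration by parts takes the place of the fold.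
\<close>

lemma integral_cos_over_cosh_sum:
  fixes b \<mu> :: real
  assumes b: "b \<ge> 0" and \<mu>: "\<mu> \<noteq> 0"
  shows "(\<integral>s. cos (\<mu> * s) / (cosh s + cosh b) \<partial>half_line) =
     (if b = 0 then \<mu> else sin (\<mu> * b) / sinh b) * (pi / sinh (pi * \<mu>))"
proof (cases "b = 0")
  case False
  with b have b: "b > 0" by simp
  let ?n = "\<lambda>s::real. 2 / (exp s + 1)"
  let ?\<kappa> = "\<lambda>s. 2 * sinh b / (cosh s + cosh b)"
  have n: "?n \<in> borel_measurable borel" by measurable
  have decay: "\<bar>?n s\<bar> \<le> 2 * exp (- s)" for s
  proof -
    have "2 / (exp s + 1) \<le> 2 / exp s" by (intro divide_left_mono) (auto intro!: mult_pos_pos add_pos_pos)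
    then show ?thesis by (simp add: exp_minus divide_inverse add_nonneg_nonneg)
  qed
  have right: "?\<kappa> (b + t) = ?n t - ?n (2 * b + t)" for t
    using two_sinh_over_cosh_sum[of b "b + t"] by (simp add: algebra_simps)
  have left: "?\<kappa> (b - t) = 2 * 1 - ?n t - ?n (2 * b - t)" for t
  proof -
    have "?\<kappa> (b - t) = 2 / (exp (- t) + 1) - ?n (2 * b - t)"
      using two_sinh_over_cosh_sum[of b "b - t"] by (simp add: algebra_simps)
    also have "2 / (exp (- t) + 1) = 2 - ?n t"
    proof -
      have "1 + exp t \<noteq> 0" "exp t + 1 \<noteq> 0" using exp_gt_zero[of t] by linarith+
      then show ?thesis by (simp add: exp_minus divide_simps)
    qed
    finally show ?thesis by simp
  qed
  have "pv_cosine ?\<kappa> b \<mu> = 2 * sin (\<mu> * b) * (1 / \<mu> - (1 / \<mu> - pi / sinh (pi * \<mu>)))"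
    using pv_cosine_of_shifted(2)[where \<kappa>="?\<kappa>" and n="?n" and \<theta>=1, OF b \<mu> n decay right left fermi_sine(1)[OF \<mu>]] fermi_sine(2)[OF \<mu>] by simp
  moreover have "pv_cosine ?\<kappa> b \<mu> = 2 * sinh b * pv_cosine (\<lambda>s. 1 / (cosh s + cosh b)) b \<mu>"
    unfolding pv_cosine_def integral_mult_right_zero[symmetric]
    by (rule half_line_cong) (simp add: algebra_simps)
  ultimately have "2 * sinh b * (\<integral>s. cos (\<mu> * s) / (cosh s + cosh b) \<partial>half_line) = 2 * sin (\<mu> * b) * (pi / sinh (pi * \<mu>))"
    unfolding pv_cosine_cosh_sum(2)[OF b \<mu>] by simp
  then have "(\<integral>s. cos (\<mu> * s) / (cosh s + cosh b) \<partial>half_line) = sin (\<mu> * b) * (pi / sinh (pi * \<mu>)) / sinh b"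
  proof -
    have "I = Z * Y / S" if "2 * S * I = 2 * Z * Y" "S > 0" for I Z Y S :: real
    proof -
      have "I * S = Z * Y" using that(1) by (simp add: mult.commute)
      then show ?thesis using that(2) by (simp add: eq_divide_eq)
    qed
    from this[OF \<open>2 * sinh b * _ = _\<close>] show ?thesis using b by simp
  qed
  then show ?thesis using b by simp
next
  case True
  let ?F = "\<lambda>s. - cos (\<mu> * s) * (2 / (exp s + 1))"
  have pos: "cosh s + 1 > 0" for s :: real using cosh_real_pos[of s] by linarith
  have half: "2 * exp s / (exp s + 1)\<^sup>2 = 1 / (cosh s + 1)" for s :: real
  proof -
    have "cosh s + 1 = (exp s + 1)\<^sup>2 / (2 * exp s)"
      by (simp add: cosh_def exp_minus field_simps power2_eq_square)
    then show ?thesis by simp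
  qed
  have i: "integrable half_line (\<lambda>s. cos (\<mu> * s) / (cosh s + 1))"
    using pv_cosine_cosh_sum(1)[OF zero_less_one \<mu>, of 0] by simp
  have "(\<integral>s. \<mu> * (sin (\<mu> * s) * (2 / (exp s + 1))) + cos (\<mu> * s) / (cosh s + 1) \<partial>half_line) = 0 - (- 1)"
  proof (rule half_line_FTC[where F="?F"])
    fix s :: real assume "s > 0"
    have e: "exp s + 1 \<noteq> 0" using exp_gt_zero[of s] by linarith
    have "(?F has_real_derivative - cos (\<mu> * s) * (- (2 * exp s) / (exp s + 1)\<^sup>2) + \<mu> * sin (\<mu> * s) * (2 / (exp s + 1))) (at s)"
    proof -
      have "((\<lambda>s. 2 / (exp s + 1)) has_real_derivative - (2 * exp s) / (exp s + 1)\<^sup>2) (at s)"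
        using e by (auto intro!: derivative_eq_intros simp: power2_eq_square)
      moreover have "((\<lambda>s. - cos (\<mu> * s)) has_real_derivative \<mu> * sin (\<mu> * s)) (at s)"
        by (auto intro!: derivative_eq_intros)
      ultimately show ?thesis by (rule DERIV_mult'[rotated])
    qed
    then show "(?F has_vector_derivative (\<mu> * (sin (\<mu> * s) * (2 / (exp s + 1))) + cos (\<mu> * s) / (cosh s + 1))) (at s)"
      unfolding has_real_derivative_iff_has_vector_derivative[symmetric]
    proof (rule DERIV_cong)
      have "- cos (\<mu> * s) * (- (2 * exp s) / (exp s + 1)\<^sup>2) = cos (\<mu> * s) * (2 * exp s / (exp s + 1)\<^sup>2)" by simp
      then show "- cos (\<mu> * s) * (- (2 * exp s) / (exp s + 1)\<^sup>2) + \<mu> * sin (\<mu> * s) * (2 / (exp s + 1))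
        = \<mu> * (sin (\<mu> * s) * (2 / (exp s + 1))) + cos (\<mu> * s) / (cosh s + 1)"
        unfolding half by simp
    qed
    show "isCont (\<lambda>s. \<mu> * (sin (\<mu> * s) * (2 / (exp s + 1))) + cos (\<mu> * s) / (cosh s + 1)) s"
      using e pos[of s] by (intro continuous_intros) auto
  next
    have "isCont ?F 0" by (intro continuous_intros) auto
    then show "(?F \<longlongrightarrow> - 1) (at_right 0)" by (auto simp: isCont_def filterlim_at_split)
    show "(?F \<longlongrightarrow> 0) at_top"
    proof (rule Lim_null_comparison)
      show "((\<lambda>s::real. 2 / (exp s + 1)) \<longlongrightarrow> 0) at_top" by real_asymp
      show "\<forall>\<^sub>F s in at_top. norm (?F s) \<le> 2 / (exp s + 1)"
      proof (rule always_eventually, rule allI)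
        fix s :: real
        have "\<bar>cos (\<mu> * s)\<bar> * (2 / (exp s + 1)) \<le> 1 * (2 / (exp s + 1))"
          by (intro mult_right_mono) (auto intro: add_nonneg_nonneg)
        moreover have "norm (?F s) = \<bar>cos (\<mu> * s)\<bar> * (2 / (exp s + 1))"
          using exp_gt_zero[of s] by (simp add: abs_mult abs_divide add_pos_pos)
        ultimately show "norm (?F s) \<le> 2 / (exp s + 1)" by simp
      qed
    qed
  qed (intro Bochner_Integration.integrable_add integrable_mult_right fermi_sine \<mu> i)
  then have "\<mu> * (1 / \<mu> - pi / sinh (pi * \<mu>)) + (\<integral>s. cos (\<mu> * s) / (cosh s + 1) \<partial>half_line) = 1"
    using fermi_sine[OF \<mu>] i by (subst (asm) Bochner_Integration.integral_add) (auto simp del: times_divide_eq_right)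
  then show ?thesis using True \<mu> by (simp add: right_diff_distrib)
qed

text \<open>
  An antiderivative of \<open>1 / sinh\<^sup>2 s\<close> is \<open>1 - coth s = - 2 / (exp (2 s) - 1)\<close>; integrating by parts
  against \<open>cosh s - cos (\<mu> s)\<close> leaves \<open>exp (- s)\<close> and a Planck factor.
\<close>

lemma integral_cosh_minus_cos_over_sinh_squared:
  fixes \<mu> :: real
  assumes \<mu>: "\<mu> \<noteq> 0"
  shows "(\<integral>s. (cosh s - cos (\<mu> * s)) / (sinh s)\<^sup>2 \<partial>half_line) = pi * \<mu> / 2 * (cosh (pi * \<mu> / 2) / sinh (pi * \<mu> / 2))"
proof -
  let ?f = "\<lambda>s. (cosh s - cos (\<mu> * s)) / (sinh s)\<^sup>2"
  let ?F = "\<lambda>s. - (exp (- s) / sinh s) * (cosh s - cos (\<mu> * s))"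
  have num: "0 \<le> cosh s - cos (\<mu> * s)" "cosh s - cos (\<mu> * s) \<le> (1 + \<mu>\<^sup>2) * (sinh s)\<^sup>2" "cosh s - cos (\<mu> * s) \<le> 2 * exp s"
    if "s > 0" for s
  proof -
    show "0 \<le> cosh s - cos (\<mu> * s)" using cosh_real_ge_1[of s] cos_le_one[of "\<mu> * s"] by linarith
    have "1 - cos (\<mu> * s) \<le> (\<mu> * s)\<^sup>2"
    proof -
      have "1 - cos (\<mu> * s) = 2 * (sin (\<mu> * s / 2))\<^sup>2" using cos_double_sin[of "\<mu> * s / 2"] by simp
      also have "(sin (\<mu> * s / 2))\<^sup>2 \<le> (\<mu> * s / 2)\<^sup>2"
        using abs_sin_x_le_abs_x[of "\<mu> * s / 2"] by (simp add: abs_le_square_iff[symmetric])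
      also have "2 * (\<mu> * s / 2)\<^sup>2 = (\<mu> * s)\<^sup>2 / 2" by (simp add: power_divide)
      finally show ?thesis using zero_le_power2[of "\<mu> * s"] by linarith
    qed
    also have "\<dots> \<le> \<mu>\<^sup>2 * (sinh s)\<^sup>2"
      unfolding power_mult_distrib using sinh_ge_self[of s] that by (intro mult_left_mono power_mono) auto
    finally show "cosh s - cos (\<mu> * s) \<le> (1 + \<mu>\<^sup>2) * (sinh s)\<^sup>2"
      using cosh_minus_one_le[of s] by (simp add: distrib_right)
    show "cosh s - cos (\<mu> * s) \<le> 2 * exp s"
      using cosh_le_exp[of s] cos_ge_minus_one[of "\<mu> * s"] that exp_ge_add_one_self[of s] by linarith
  qed
  have int: "integrable half_line ?f"
  proof (rule integrable_half_line_bound[where d=1 and C="(1 + \<mu>\<^sup>2) * exp 1 + 32"])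
    fix s :: real assume s: "s > 0"
    have "norm (?f s) \<le> ((1 + \<mu>\<^sup>2) * exp 1 + 32) * exp (- s)"
    proof (rule exp_bound_cases[where a=1 and f="\<lambda>s. norm (?f s)"])
      fix s :: real assume s: "s > 0"
      show "norm (?f s) \<le> 1 + \<mu>\<^sup>2"
        using num[OF s] s by (simp add: abs_divide pos_divide_le_eq)
    next
      fix s :: real assume s: "s > 0" "s > 1"
      have "norm (?f s) = (cosh s - cos (\<mu> * s)) / (sinh s)\<^sup>2" using num(1)[OF s(1)] by (simp add: abs_divide)
      also have "\<dots> \<le> 2 * exp s / (exp s / 4)\<^sup>2"
        using num[OF s(1)] sinh_ge_exp[of s] s by (intro frac_le power_mono) auto
      also have "\<dots> = 32 * exp (- s)" by (simp add: power2_eq_square exp_minus field_simps)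
      finally show "norm (?f s) \<le> 32 * exp (- s)" .
    qed (use s in auto)
    then show "norm (?f s) \<le> ((1 + \<mu>\<^sup>2) * exp 1 + 32) * exp (- 1 * s)" by simp
  qed measurable
  have e1: "integrable half_line (\<lambda>s. exp (- 1 * s))" "(\<integral>s. exp (- 1 * s) \<partial>half_line) = 1"
  proof -
    show "integrable half_line (\<lambda>s. exp (- 1 * s))" using integrable_half_line_exp[of 1 1] by simp
    have "(\<integral>s. exp (- 1 * s) \<partial>half_line) = Re (\<integral>s. exp (- (complex_of_real s * 1)) \<partial>half_line)"
      by (subst integral_Re[symmetric, OF laplace_exp(1)]) (auto simp: Re_exp)
    then show "(\<integral>s. exp (- 1 * s) \<partial>half_line) = 1" using laplace_exp(2)[of 1] by simp
  qed
  let ?p = "\<lambda>s. 2 * sin (\<mu> * s) / (exp (2 * s) - 1)"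
  have coth1: "exp (- s) / sinh s = 2 / (exp (2 * s) - 1)" if "s > 0" for s :: real
  proof -
    have "exp (2 * s) = exp s * exp s" by (simp flip: exp_add)
    then show ?thesis using that by (simp add: sinh_def exp_minus divide_simps)
  qed
  have "(\<integral>s. ?f s - exp (- 1 * s) - \<mu> * ?p s \<partial>half_line) = 0 - 0"
  proof (rule half_line_FTC[where F="?F"])
    fix s :: real assume s: "s > 0"
    have sh: "sinh s \<noteq> 0" using s by simp
    have d: "(?F has_real_derivative - ((- exp (- s) * sinh s - exp (- s) * cosh s) / (sinh s * sinh s)) * (cosh s - cos (\<mu> * s))
        + - (exp (- s) / sinh s) * (sinh s + sin (\<mu> * s) * \<mu>)) (at s)"
      using sh by (intro DERIV_mult' DERIV_minus DERIV_divide derivative_eq_intros refl) auto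
    have A: "- exp (- s) * sinh s - exp (- s) * cosh s = - 1"
    proof -
      have "exp (- s) * (sinh s + cosh s) = 1" unfolding sinh_plus_cosh by (simp add: exp_minus)
      then show ?thesis by (simp add: algebra_simps)
    qed
    have R: "- (exp (- s) / sinh s) * (sinh s + sin (\<mu> * s) * \<mu>) = - exp (- 1 * s) - \<mu> * ?p s"
    proof -
      have "- (exp (- s) / sinh s) * (sinh s + sin (\<mu> * s) * \<mu>) = - exp (- s) - (exp (- s) / sinh s) * (sin (\<mu> * s) * \<mu>)"
        using sh by (simp add: algebra_simps)
      also have "\<dots> = - exp (- 1 * s) - \<mu> * ?p s" unfolding coth1[OF s] by simp
      finally show ?thesis .
    qed
    have eq: "- (- 1 / (sinh s * sinh s)) * x + (- y - z) = x / (sinh s)\<^sup>2 - y - z" for x y z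
      by (simp add: power2_eq_square)
    show "(?F has_vector_derivative (?f s - exp (- 1 * s) - \<mu> * ?p s)) (at s)"
      using d unfolding has_real_derivative_iff_has_vector_derivative[symmetric] A R eq .
    show "isCont (\<lambda>s. ?f s - exp (- 1 * s) - \<mu> * ?p s) s"
      using s sh by (intro continuous_intros) auto
  next
    show "(?F \<longlongrightarrow> 0) (at_right 0)"
    proof (rule Lim_null_comparison)
      have "((\<lambda>s. exp (- s) * ((1 + \<mu>\<^sup>2) * sinh s)) \<longlongrightarrow> exp (- 0) * ((1 + \<mu>\<^sup>2) * sinh 0)) (at_right 0)"
        by (intro tendsto_intros)
      then show "((\<lambda>s. exp (- s) * ((1 + \<mu>\<^sup>2) * sinh s)) \<longlongrightarrow> 0) (at_right 0)" by simp
      show "\<forall>\<^sub>F s in at_right 0. norm (?F s) \<le> exp (- s) * ((1 + \<mu>\<^sup>2) * sinh s)"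
      proof (rule eventually_mono[OF eventually_at_right_less])
        fix s :: real assume s: "0 < s"
        have "norm (?F s) = exp (- s) * ((cosh s - cos (\<mu> * s)) / sinh s)" using s num(1)[OF s] by (simp add: abs_mult)
        also have "(cosh s - cos (\<mu> * s)) / sinh s \<le> (1 + \<mu>\<^sup>2) * sinh s"
          using num(2)[OF s] s by (simp add: pos_divide_le_eq power2_eq_square mult.assoc)
        finally show "norm (?F s) \<le> exp (- s) * ((1 + \<mu>\<^sup>2) * sinh s)" by simp
      qed
    qed
    show "(?F \<longlongrightarrow> 0) at_top"
    proof (rule Lim_null_comparison)
      show "((\<lambda>s::real. 8 * exp (- s)) \<longlongrightarrow> 0) at_top" by real_asymp
      show "\<forall>\<^sub>F s in at_top. norm (?F s) \<le> 8 * exp (- s)"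
      proof (rule eventually_mono[OF eventually_gt_at_top[of 1]])
        fix s :: real assume s: "1 < s"
        have "norm (?F s) = exp (- s) * ((cosh s - cos (\<mu> * s)) / sinh s)" using s num(1)[of s] by (simp add: abs_mult)
        also have "(cosh s - cos (\<mu> * s)) / sinh s \<le> 2 * exp s / (exp s / 4)"
          using num[of s] sinh_ge_exp[of s] s by (intro frac_le) auto
        finally show "norm (?F s) \<le> 8 * exp (- s)" by simp
      qed
    qed
  qed (intro Bochner_Integration.integrable_diff integrable_mult_right int e1 planck_sine_double \<mu>)
  then have "integral\<^sup>L half_line ?f - 1 - \<mu> * (pi / 2 * (cosh (pi * \<mu> / 2) / sinh (pi * \<mu> / 2)) - 1 / \<mu>) = 0"
    using int e1 planck_sine_double[OF \<mu>]
    by (simp only: Bochner_Integration.integral_diff Bochner_Integration.integrable_diff integral_mult_right_zero integrable_mult_right)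
  then show ?thesis using \<mu> by (simp add: right_diff_distrib)
qed

section \<open>A constant kernel\<close>

lemma fourier_deriv:
  assumes \<phi>: "schwartz \<phi>" and n: "n < 4"
  shows "fourier (iter_deriv (Suc n) \<phi>) s = - (\<i> * of_real s) * fourier (iter_deriv n \<phi>) s"
proof -
  let ?\<psi> = "iter_deriv n \<phi>" and ?\<psi>' = "iter_deriv (Suc n) \<phi>"
  let ?e = "\<lambda>\<omega>::real. exp (\<i> * \<omega> * s)"
  have meas: "?e \<in> borel_measurable borel" by measurable
  have e1: "norm (?e \<omega>) \<le> 1 * (1 + \<omega>\<^sup>2)" for \<omega> by simp
  have i: "integrable lborel (\<lambda>\<omega>. ?e \<omega> * ?\<psi> \<omega>)" "integrable lborel (\<lambda>\<omega>. ?e \<omega> * ?\<psi>' \<omega>)"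
    using schwartz_integrable_times[OF \<phi> _ meas e1, of n] schwartz_integrable_times[OF \<phi> _ meas e1, of "Suc n"] n by simp_all
  let ?f = "\<lambda>\<omega>. ?\<psi>' \<omega> * ?e \<omega> + (\<i> * of_real s) * (?\<psi> \<omega> * ?e \<omega>)"
  have f: "integrable lborel ?f"
    using i by (intro Bochner_Integration.integrable_add integrable_mult_right) (simp_all add: mult.commute)
  have lim: "((\<lambda>\<omega>. ?\<psi> \<omega> * ?e \<omega>) \<longlongrightarrow> 0) F" if F: "((\<lambda>\<omega>. 4 * schwartz_size \<phi> * (1 / (1 + \<omega>\<^sup>2))) \<longlongrightarrow> 0) F" for F
  proof (rule Lim_null_comparison[OF always_eventually F], rule allI)
    fix \<omega> :: real
    have "norm (?\<psi> \<omega> * ?e \<omega>) = 1 * norm (?\<psi> \<omega>)" by (simp add: norm_mult)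
    also have "\<dots> \<le> (1 + \<omega>\<^sup>2) * norm (?\<psi> \<omega>)" by (intro mult_right_mono) auto
    also have "\<dots> \<le> 4 * schwartz_size \<phi> * (1 / (1 + \<omega>\<^sup>2))" using schwartz_decay[OF \<phi>, of n \<omega>] n by simp
    finally show "norm (?\<psi> \<omega> * ?e \<omega>) \<le> 4 * schwartz_size \<phi> * (1 / (1 + \<omega>\<^sup>2))" .
  qed
  have lim0: "((\<lambda>\<omega>. C * (1 / (1 + \<omega>\<^sup>2))) \<longlongrightarrow> 0) at_top" "((\<lambda>\<omega>. C * (1 / (1 + \<omega>\<^sup>2))) \<longlongrightarrow> 0) at_bot" for C :: real
  proof -
    have "((\<lambda>\<omega>::real. 1 / (1 + \<omega>\<^sup>2)) \<longlongrightarrow> 0) at_top" "((\<lambda>\<omega>::real. 1 / (1 + \<omega>\<^sup>2)) \<longlongrightarrow> 0) at_bot" by real_asymp+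
    from tendsto_mult_left[OF this(1), of C] tendsto_mult_left[OF this(2), of C]
    show "((\<lambda>\<omega>. C * (1 / (1 + \<omega>\<^sup>2))) \<longlongrightarrow> 0) at_top" "((\<lambda>\<omega>. C * (1 / (1 + \<omega>\<^sup>2))) \<longlongrightarrow> 0) at_bot" by simp_all
  qed
  have "(LBINT \<omega>=-\<infinity>..\<infinity>. ?f \<omega>) = 0 - 0"
  proof (rule interval_integral_FTC_integrable[where F="\<lambda>\<omega>. ?\<psi> \<omega> * ?e \<omega>"])
    fix \<omega> :: real
    have "(?e has_vector_derivative ?e \<omega> * (\<i> * of_real s)) (at \<omega>)"
      by (rule has_vector_derivative_real_field[where f="\<lambda>w. exp (\<i> * w * of_real s)"])
         (auto intro!: derivative_eq_intros)
    from has_vector_derivative_mult[OF schwartz_has_vector_derivative[OF \<phi>, of n \<omega>] this]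
    show "((\<lambda>\<omega>. ?\<psi> \<omega> * ?e \<omega>) has_vector_derivative ?f \<omega>) (at \<omega>)" by (simp add: mult_ac add.commute)
    show "isCont ?f \<omega>" by (intro continuous_intros schwartz_continuous[OF \<phi>])
  next
    show "set_integrable lborel (einterval (- \<infinity>) \<infinity>) ?f" using f by (simp add: set_integrable_def)
    show "(((\<lambda>\<omega>. ?\<psi> \<omega> * ?e \<omega>) \<circ> real_of_ereal) \<longlongrightarrow> 0) (at_right (- \<infinity>))"
      using lim[OF lim0(2)] by (simp add: ereal_tendsto_simps)
    show "(((\<lambda>\<omega>. ?\<psi> \<omega> * ?e \<omega>) \<circ> real_of_ereal) \<longlongrightarrow> 0) (at_left \<infinity>)"
      using lim[OF lim0(1)] by (simp add: ereal_tendsto_simps)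
  qed simp
  then have "integral\<^sup>L lborel ?f = 0"
    by (simp add: interval_lebesgue_integral_def set_lebesgue_integral_def)
  moreover have "integral\<^sup>L lborel ?f = fourier ?\<psi>' s + (\<i> * of_real s) * fourier ?\<psi> s"
    unfolding fourier_def using i by (subst Bochner_Integration.integral_add) (auto simp: mult.commute)
  ultimately show ?thesis by (simp add: add_eq_0_iff)
qed

lemma fourier_measurable:
  assumes \<phi>: "schwartz \<phi>" shows "fourier \<phi> \<in> borel_measurable borel"
proof -
  have [measurable]: "\<phi> \<in> borel_measurable borel" using schwartz_measurable[OF \<phi>, of 0] by simp
  have "(\<lambda>(s, \<omega>). \<phi> \<omega> * exp (\<i> * of_real \<omega> * of_real s)) \<in> borel_measurable (borel \<Otimes>\<^sub>M lborel)"
    by measurable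
  then have "(\<lambda>s. \<integral>\<omega>. \<phi> \<omega> * exp (\<i> * of_real \<omega> * of_real s) \<partial>lborel) \<in> borel_measurable borel"
    by (intro sigma_finite_measure.borel_measurable_lebesgue_integral[OF sigma_finite_lborel]) simp
  then show ?thesis unfolding fourier_def[abs_def] .
qed

lemma fourier_integrable:
  assumes \<phi>: "schwartz \<phi>" shows "integrable lborel (fourier \<phi>)"
proof -
  define C where "C = (\<integral>\<omega>. norm (\<phi> \<omega>) \<partial>lborel) + (\<integral>\<omega>. norm (iter_deriv 2 \<phi> \<omega>) \<partial>lborel)"
  have le: "norm (fourier \<psi> s) \<le> (\<integral>\<omega>. norm (\<psi> \<omega>) \<partial>lborel)" for \<psi> s
    unfolding fourier_def by (rule order_trans[OF integral_norm_bound]) (simp add: norm_mult)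
  have "norm (fourier \<phi> s) \<le> C * (1 / (1 + s\<^sup>2))" for s
  proof -
    have "fourier (iter_deriv 2 \<phi>) s = - of_real (s\<^sup>2) * fourier \<phi> s"
    proof -
      have "fourier (iter_deriv 2 \<phi>) s = - (\<i> * of_real s) * (- (\<i> * of_real s) * fourier \<phi> s)"
        using fourier_deriv[OF \<phi>, of 0 s] fourier_deriv[OF \<phi>, of 1 s] by (simp add: numeral_2_eq_2)
      also have "\<dots> = (\<i> * \<i>) * of_real (s\<^sup>2) * fourier \<phi> s" by (simp only: power2_eq_square of_real_mult minus_mult_minus mult_minus_left mult_minus_right minus_minus mult_ac)
      finally show ?thesis by simp
    qed
    then have "norm (fourier (iter_deriv 2 \<phi>) s) = s\<^sup>2 * norm (fourier \<phi> s)" by (simp add: norm_mult norm_power)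
    then have "(1 + s\<^sup>2) * norm (fourier \<phi> s) \<le> C"
      using le[of \<phi> s] le[of "iter_deriv 2 \<phi>" s] by (simp add: C_def distrib_right)
    then show ?thesis by (simp add: pos_le_divide_eq add_pos_nonneg mult.commute)
  qed
  then have "AE s in lborel. norm (fourier \<phi> s) \<le> norm (C * (1 / (1 + s\<^sup>2)))"
    unfolding real_norm_def by (intro AE_I2 order_trans[OF _ abs_ge_self])
  then show ?thesis
    by (intro Bochner_Integration.integrable_bound[OF integrable_inverse_square[of C]])
       (use fourier_measurable[OF \<phi>] in simp_all)
qed

text \<open>
  Fourier inversion at \<open>0\<close>. The factor \<open>exp (- \<delta> |s|)\<close> makes Fubini applicable and turns into the
  Poisson kernel, which concentrates at \<open>0\<close> as \<open>\<delta> \<rightarrow> 0\<close>.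
\<close>

lemma integral_fourier:
  fixes \<phi> :: "real \<Rightarrow> complex"
  assumes \<phi>: "schwartz \<phi>" shows "(\<integral>s. fourier \<phi> s \<partial>lborel) = 2 * pi * \<phi> 0"
proof -
  have [measurable]: "\<phi> \<in> borel_measurable borel" using schwartz_measurable[OF \<phi>, of 0] by simp
  have [measurable]: "fourier \<phi> \<in> borel_measurable borel" by (rule fourier_measurable[OF \<phi>])
  define p where "p = (\<lambda>u::real. 2 * (1 / (1 + u\<^sup>2)))"
  have p_int: "integrable lborel p" unfolding p_def by (rule integrable_inverse_square)
  have p_val: "(\<integral>u. p u \<partial>lborel) = 2 * pi"
  proof -
    have "(\<integral>u. 1 / (1 + (u::real)\<^sup>2) \<partial>lborel) = pi"
      using LBINT_inverse_1_plus_square by (simp add: interval_lebesgue_integral_def set_lebesgue_integral_def inverse_eq_divide)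
    then show ?thesis unfolding p_def integral_mult_right_zero by simp
  qed
  have reg: "(\<integral>s. exp (- \<delta> * \<bar>s\<bar>) *\<^sub>R fourier \<phi> s \<partial>lborel) = (\<integral>u. p u *\<^sub>R \<phi> (\<delta> * u) \<partial>lborel)" if \<delta>: "\<delta> > 0" for \<delta>
  proof -
    have exp_int: "integrable lborel (\<lambda>s. exp (- \<delta> * \<bar>s\<bar>))"
    proof (subst integral_lborel_fold(1))
      have "integrable half_line (\<lambda>s. 1 * exp (- \<delta> * s))" by (rule integrable_half_line_exp[OF \<delta>])
      then have "integrable half_line (\<lambda>s. exp (- \<delta> * \<bar>s\<bar>))"
        by (rule half_line_integrable_cong[rotated]) simp
      then show "integrable half_line (\<lambda>s. exp (- \<delta> * \<bar>s\<bar>)) \<and> integrable half_line (\<lambda>s. exp (- \<delta> * \<bar>- s\<bar>))" by simp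
    qed measurable
    have kernel: "(\<integral>s. exp (- \<delta> * \<bar>s\<bar>) *\<^sub>R exp (\<i> * of_real \<omega> * of_real s) \<partial>lborel) = of_real (2 * \<delta> / (\<delta>\<^sup>2 + \<omega>\<^sup>2))" for \<omega>
    proof -
      let ?f = "\<lambda>s. exp (- \<delta> * \<bar>s\<bar>) *\<^sub>R exp (\<i> * of_real \<omega> * of_real s)"
      have i: "integrable lborel ?f"
        by (rule Bochner_Integration.integrable_bound[OF exp_int]) auto
      have z: "Re (Complex \<delta> x) > 0" for x using \<delta> by simp
      have "integral\<^sup>L lborel ?f = (\<integral>s. ?f s + ?f (- s) \<partial>half_line)" by (rule integral_lborel_fold(2)[OF _ i]) measurable
      also have "\<dots> = (\<integral>s. exp (- (of_real s * Complex \<delta> (- \<omega>))) + exp (- (of_real s * Complex \<delta> \<omega>)) \<partial>half_line)"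
        by (rule half_line_cong)
           (simp add: scaleR_conv_of_real exp_of_real[symmetric] Complex_eq algebra_simps flip: exp_add)
      also have "\<dots> = 1 / Complex \<delta> (- \<omega>) + 1 / Complex \<delta> \<omega>"
        by (subst Bochner_Integration.integral_add[OF laplace_exp(1)[OF z] laplace_exp(1)[OF z]]) (simp only: laplace_exp(2)[OF z])
      also have "\<dots> = of_real (2 * \<delta> / (\<delta>\<^sup>2 + \<omega>\<^sup>2))"
      proof -
        have "Complex \<delta> (- \<omega>) * Complex \<delta> \<omega> = of_real (\<delta>\<^sup>2 + \<omega>\<^sup>2)" "Complex \<delta> (- \<omega>) + Complex \<delta> \<omega> = of_real (2 * \<delta>)"
          by (simp_all add: complex_eq_iff power2_eq_square)
        moreover have "Complex \<delta> (- \<omega>) \<noteq> 0" "Complex \<delta> \<omega> \<noteq> 0" using \<delta> by (auto simp: complex_eq_iff)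
        then have "1 / Complex \<delta> (- \<omega>) + 1 / Complex \<delta> \<omega>
            = (Complex \<delta> (- \<omega>) + Complex \<delta> \<omega>) / (Complex \<delta> (- \<omega>) * Complex \<delta> \<omega>)"
          by (simp add: add_frac_eq add.commute)
        ultimately show ?thesis by (simp only: of_real_divide)
      qed
      finally show ?thesis .
    qed
    have "(\<integral>s. (\<Sum>j\<in>{()}. exp (- \<delta> * \<bar>s\<bar>) *\<^sub>R fourier \<phi> s) \<partial>lborel) =
      (\<integral>\<omega>. (\<integral>s. (\<Sum>j\<in>{()}. exp (- \<delta> * \<bar>s\<bar>) *\<^sub>R exp (\<i> * of_real \<omega> * of_real s)) \<partial>lborel) * \<phi> \<omega> \<partial>lborel)"
      by (rule kernel_duality[OF sigma_finite_lborel _ _ exp_int _ \<phi>]) auto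
    then have "(\<integral>s. exp (- \<delta> * \<bar>s\<bar>) *\<^sub>R fourier \<phi> s \<partial>lborel) = (\<integral>\<omega>. of_real (2 * \<delta> / (\<delta>\<^sup>2 + \<omega>\<^sup>2)) * \<phi> \<omega> \<partial>lborel)"
      by (simp add: kernel[unfolded mult_minus_left] del: of_real_divide of_real_mult)
    also have "\<dots> = \<bar>\<delta>\<bar> *\<^sub>R (\<integral>u. of_real (2 * \<delta> / (\<delta>\<^sup>2 + (0 + \<delta> * u)\<^sup>2)) * \<phi> (0 + \<delta> * u) \<partial>lborel)"
      by (rule lborel_integral_real_affine) (use \<delta> in simp)
    also have "\<dots> = (\<integral>u. \<bar>\<delta>\<bar> *\<^sub>R (of_real (2 * \<delta> / (\<delta>\<^sup>2 + (0 + \<delta> * u)\<^sup>2)) * \<phi> (0 + \<delta> * u)) \<partial>lborel)"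
      by (rule integral_scaleR_right[symmetric]) 
    also have "\<dots> = (\<integral>u. p u *\<^sub>R \<phi> (\<delta> * u) \<partial>lborel)"
    proof (rule Bochner_Integration.integral_cong)
      fix u
      have "\<delta>\<^sup>2 + (0 + \<delta> * u)\<^sup>2 = \<delta>\<^sup>2 * (1 + u\<^sup>2)" by (simp add: power_mult_distrib algebra_simps)
      then have "\<bar>\<delta>\<bar> * (2 * \<delta> / (\<delta>\<^sup>2 + (0 + \<delta> * u)\<^sup>2)) = p u"
        using \<delta> by (simp add: p_def power2_eq_square)
      then show "\<bar>\<delta>\<bar> *\<^sub>R (of_real (2 * \<delta> / (\<delta>\<^sup>2 + (0 + \<delta> * u)\<^sup>2)) * \<phi> (0 + \<delta> * u)) = p u *\<^sub>R \<phi> (\<delta> * u)"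
        by (metis add_0 mult_scaleR_left of_real_def scaleR_conv_of_real scaleR_scaleR)
    qed simp
    finally show ?thesis .
  qed
  define \<delta> where "\<delta> = (\<lambda>n. 1 / real (Suc n))"
  have \<delta>: "\<delta> n > 0" "\<delta> \<longlonglongrightarrow> 0" for n
    unfolding \<delta>_def using LIMSEQ_Suc[OF lim_inverse_n'] by auto
  have "(\<lambda>n. \<integral>s. exp (- \<delta> n * \<bar>s\<bar>) *\<^sub>R fourier \<phi> s \<partial>lborel) \<longlonglongrightarrow> (\<integral>s. fourier \<phi> s \<partial>lborel)"
  proof (rule integral_dominated_convergence[where w="\<lambda>s. norm (fourier \<phi> s)"])
    show "integrable lborel (\<lambda>s. norm (fourier \<phi> s))" using fourier_integrable[OF \<phi>] by (rule integrable_norm)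
    have "(\<lambda>n. exp (- \<delta> n * \<bar>s\<bar>) *\<^sub>R fourier \<phi> s) \<longlonglongrightarrow> exp (- 0 * \<bar>s\<bar>) *\<^sub>R fourier \<phi> s" for s
      by (intro tendsto_intros \<delta>)
    then show "AE s in lborel. (\<lambda>n. exp (- \<delta> n * \<bar>s\<bar>) *\<^sub>R fourier \<phi> s) \<longlonglongrightarrow> fourier \<phi> s" by simp
    show "AE s in lborel. norm (exp (- \<delta> n * \<bar>s\<bar>) *\<^sub>R fourier \<phi> s) \<le> norm (fourier \<phi> s)" for n
      using \<delta>(1)[of n] by (auto intro!: mult_left_le_one_le)
  qed measurable
  moreover have "(\<lambda>n. \<integral>s. exp (- \<delta> n * \<bar>s\<bar>) *\<^sub>R fourier \<phi> s \<partial>lborel) \<longlonglongrightarrow> (\<integral>u. p u *\<^sub>R \<phi> 0 \<partial>lborel)"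
    unfolding reg[OF \<delta>(1)]
  proof (rule integral_dominated_convergence[where w="\<lambda>u. p u * schwartz_size \<phi>"])
    show "integrable lborel (\<lambda>u. p u * schwartz_size \<phi>)" using p_int by simp
    have [measurable]: "p \<in> borel_measurable borel" unfolding p_def by measurable
    show "(\<lambda>u. p u *\<^sub>R \<phi> 0) \<in> borel_measurable lborel" "(\<lambda>u. p u *\<^sub>R \<phi> (\<delta> n * u)) \<in> borel_measurable lborel" for n
      by measurable
    have "(\<lambda>n. p u *\<^sub>R \<phi> (\<delta> n * u)) \<longlonglongrightarrow> p u *\<^sub>R \<phi> 0" for u
    proof (intro tendsto_intros isCont_tendsto_compose[where g=\<phi>])
      show "isCont \<phi> 0" using schwartz_continuous[OF \<phi>, of 0 0] by simp
      show "(\<lambda>n. \<delta> n * u) \<longlonglongrightarrow> 0" using tendsto_mult_right[OF \<delta>(2), of u] by simp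
    qed
    then show "AE u in lborel. (\<lambda>n. p u *\<^sub>R \<phi> (\<delta> n * u)) \<longlonglongrightarrow> p u *\<^sub>R \<phi> 0" by simp
    show "AE u in lborel. norm (p u *\<^sub>R \<phi> (\<delta> n * u)) \<le> p u * schwartz_size \<phi>" for n
    proof (rule AE_I2)
      fix u
      have "p u \<ge> 0" by (simp add: p_def)
      moreover have "norm (\<phi> (\<delta> n * u)) \<le> schwartz_size \<phi>" using schwartz_size_upper[OF \<phi>, of 0 0] by simp
      ultimately show "norm (p u *\<^sub>R \<phi> (\<delta> n * u)) \<le> p u * schwartz_size \<phi>" by (simp add: mult_left_mono)
    qed
  qed
  ultimately have "(\<integral>s. fourier \<phi> s \<partial>lborel) = (\<integral>u. p u *\<^sub>R \<phi> 0 \<partial>lborel)" by (rule LIMSEQ_unique)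
  also have "\<dots> = 2 * pi * \<phi> 0" using p_int p_val by (simp add: scaleR_conv_of_real)
  finally show ?thesis .
qed

text \<open>
  The kernels tend boundedly to the constant \<open>2 / q\<close>, whose transform is \<open>4 \<pi> / q\<close> times the
  Dirac mass.
\<close>

lemma constant_spectral_limit:
  fixes r d :: "real \<Rightarrow> real"
  assumes [measurable]: "r \<in> borel_measurable borel" "d \<in> borel_measurable borel"
    and r: "\<And>s. r s \<ge> 0" and q: "\<And>s. r s - (d s)\<^sup>2 = q" and q0: "q \<noteq> 0"
  shows "spectral_limit (\<lambda>\<epsilon> s. regularized_kernel \<epsilon> (r s) (d s)) (\<lambda>\<omega>. 0) (of_real (4 * pi / q))"
proof -
  define D where "D = (\<lambda>\<phi>::real \<Rightarrow> complex. of_real (2 / q) * (\<integral>s. \<phi> s \<partial>lborel) :: complex)"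
  have ne: "r s \<noteq> (d s)\<^sup>2" for s using q[of s] q0 by auto
  have b: "\<bar>regularized_kernel \<epsilon> (r s) (d s)\<bar> \<le> 2 / \<bar>q\<bar>" if "\<epsilon> > 0" for \<epsilon> s
    using regularized_kernel_bounds(3)[OF that r ne, of s] unfolding q .
  have td: "tempered_distribution D"
    unfolding tempered_distribution_def
  proof (intro conjI allI impI exI)
    fix \<phi> \<psi> a b assume "schwartz \<phi>" "schwartz \<psi>"
    then show "D (\<lambda>x. a * \<phi> x + b * \<psi> x) = a * D \<phi> + b * D \<psi>"
      unfolding D_def using schwartz_integrable by (simp add: algebra_simps)
  next
    fix \<phi> assume \<phi>: "schwartz \<phi>"
    have "norm (\<integral>s. \<phi> s \<partial>lborel) \<le> (\<integral>s. 4 * schwartz_size \<phi> * (1 / (1 + s\<^sup>2)) \<partial>lborel)"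
    proof (rule order_trans[OF integral_norm_bound], rule Bochner_Integration.integral_mono)
      fix s
      have "1 * norm (\<phi> s) \<le> (1 + s\<^sup>2) * norm (\<phi> s)" by (intro mult_right_mono) auto
      then show "norm (\<phi> s) \<le> 4 * schwartz_size \<phi> * (1 / (1 + s\<^sup>2))" using schwartz_decay[OF \<phi>, of 0 s] by simp
    qed (intro integrable_norm schwartz_integrable[OF \<phi>] integrable_inverse_square)+
    also have "\<dots> = (\<integral>s. 4 * (1 / (1 + (s::real)\<^sup>2)) \<partial>lborel) * schwartz_size \<phi>"
      unfolding integral_mult_left_zero[symmetric] by (rule Bochner_Integration.integral_cong) auto
    finally have "\<bar>2 / q\<bar> * norm (\<integral>s. \<phi> s \<partial>lborel) \<le> \<bar>2 / q\<bar> * ((\<integral>s. 4 * (1 / (1 + (s::real)\<^sup>2)) \<partial>lborel) * schwartz_size \<phi>)"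
      by (rule mult_left_mono) simp
    then show "norm (D \<phi>) \<le> (\<bar>2 / q\<bar> * (\<integral>s. 4 * (1 / (1 + (s::real)\<^sup>2)) \<partial>lborel)) * (\<Sum>k\<le>4. \<Sum>n\<le>4. schwartz_seminorm k n \<phi>)"
      unfolding D_def norm_mult norm_of_real schwartz_size_def[symmetric] by (simp only: mult.assoc)
  qed
  have "tempered_limit (\<lambda>\<epsilon> s. complex_of_real (regularized_kernel \<epsilon> (r s) (d s))) D (at_right 0)"
    unfolding tempered_limit_def
  proof (intro conjI allI impI td)
    fix \<phi> assume \<phi>: "schwartz \<phi>"
    have [measurable]: "\<phi> \<in> borel_measurable borel" using schwartz_measurable[OF \<phi>, of 0] by simp
    let ?g = "\<lambda>\<epsilon> s. complex_of_real (regularized_kernel \<epsilon> (r s) (d s)) * \<phi> s"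
    have w: "integrable lborel (\<lambda>s. 2 / \<bar>q\<bar> * norm (\<phi> s))" using schwartz_integrable[OF \<phi>] by (intro integrable_mult_right integrable_norm)
    have le: "norm (?g \<epsilon> s) \<le> 2 / \<bar>q\<bar> * norm (\<phi> s)" if "\<epsilon> > 0" for \<epsilon> s
      unfolding norm_mult norm_of_real using b[OF that] by (intro mult_right_mono) auto
    show "\<forall>\<^sub>F \<epsilon> in at_right 0. integrable lborel (?g \<epsilon>)"
    proof (rule eventually_mono[OF eventually_at_right_less])
      fix \<epsilon> :: real assume e: "0 < \<epsilon>"
      show "integrable lborel (?g \<epsilon>)"
      proof (rule Bochner_Integration.integrable_bound[OF w])
        show "AE s in lborel. norm (?g \<epsilon> s) \<le> norm (2 / \<bar>q\<bar> * norm (\<phi> s))"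
          unfolding real_norm_def[of "_ * norm _"] using le[OF e] by (intro AE_I2 order_trans[OF _ abs_ge_self])
      qed measurable
    qed
    show "((\<lambda>\<epsilon>. integral\<^sup>L lborel (?g \<epsilon>)) \<longlongrightarrow> D \<phi>) (at_right 0)"
    proof (unfold tendsto_at_iff_sequentially comp_def, intro allI impI)
      fix X :: "nat \<Rightarrow> real" assume X: "\<forall>i. X i \<in> {0<..} - {0}" "X \<longlonglongrightarrow> 0"
      then have Xr: "filterlim X (at_right 0) sequentially"
        by (auto simp: filterlim_at intro!: always_eventually less_imp_neq[THEN not_sym])
      have "(\<lambda>i. integral\<^sup>L lborel (?g (X i))) \<longlonglongrightarrow> (\<integral>s. of_real (2 / q) * \<phi> s \<partial>lborel)"
      proof (rule integral_dominated_convergence[OF _ _ w])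
        have "(\<lambda>i. ?g (X i) s) \<longlonglongrightarrow> of_real (2 / (r s - (d s)\<^sup>2)) * \<phi> s" for s
          by (intro tendsto_intros filterlim_compose[OF regularized_kernel_tendsto[OF ne] Xr])
        then show "AE s in lborel. (\<lambda>i. ?g (X i) s) \<longlonglongrightarrow> of_real (2 / q) * \<phi> s" unfolding q by simp
        show "AE s in lborel. norm (?g (X i) s) \<le> 2 / \<bar>q\<bar> * norm (\<phi> s)" for i
          using le X(1) by (intro AE_I2) auto
      qed measurable
      then show "(\<lambda>i. integral\<^sup>L lborel (?g (X i))) \<longlonglongrightarrow> D \<phi>" by (simp add: D_def)
    qed
  qed
  moreover have "D (fourier \<phi>) = (\<integral>\<omega>. 0 * \<phi> \<omega> \<partial>lborel) + of_real (4 * pi / q) * \<phi> 0" if "schwartz \<phi>" for \<phi>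
    unfolding D_def integral_fourier[OF that] by (simp add: field_simps)
  ultimately show ?thesis
    unfolding spectral_limit_def by (intro conjI exI[of _ D] exI[of _ 0]) auto
qed

section \<open>The correction and its extension by continuity\<close>

text \<open>
  The value at \<open>b = 0\<close> is the limit. With \<open>cosh b = |C_minus|\<close>, or \<open>cosh b = |C / B|\<close> if \<open>\<alpha> = 0\<close>, this
  is the quotient in the correction that can take the form \<open>0 / 0\<close> for \<open>\<nu> \<noteq> 0\<close>.
\<close>

definition sin_over_sinh :: "real \<Rightarrow> real \<Rightarrow> real" where
  "sin_over_sinh \<mu> b = (if b = 0 then \<mu> else sin (\<mu> * b) / sinh b)"

lemma continuous_sin_over_sinh [continuous_intros]:
  assumes "continuous_on S f" "continuous_on S g"
  shows "continuous_on S (\<lambda>x. sin_over_sinh (f x) (g x))"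
proof -
  define shc where "shc = (\<lambda>b::real. if b = 0 then 1 else sinh b / b)"
  have eq: "sin_over_sinh \<mu> b = \<mu> * sinc (\<mu> * b) / shc b" for \<mu> b
    by (auto simp: sin_over_sinh_def shc_def)
  have "isCont shc b" for b
  proof (cases "b = 0")
    case True
    have "(sinh has_real_derivative 1) (at 0)" by (auto intro!: derivative_eq_intros)
    then have "((\<lambda>b. sinh b / b) \<longlongrightarrow> (1::real)) (at 0)" by (simp add: has_field_derivative_iff)
    then have "(shc \<longlongrightarrow> 1) (at 0)"
      by (rule Lim_transform_eventually) (auto simp: shc_def eventually_at intro!: exI[of _ 1])
    then show ?thesis using True by (simp add: isCont_def shc_def)
  next
    case False
    have "isCont (\<lambda>b. sinh b / b) b" using False by (intro continuous_intros)
    moreover have "\<forall>\<^sub>F x in nhds b. sinh x / x = shc x"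
      using t1_space_nhds[OF False] by eventually_elim (simp add: shc_def)
    ultimately show ?thesis using isCont_cong[of "\<lambda>x. sinh x / x" shc b] by simp
  qed
  then have shc: "continuous_on S (\<lambda>x. shc (g x))"
    by (intro continuous_on_compose2[OF continuous_at_imp_continuous_on assms(2), of UNIV]) auto
  have shc0: "shc b \<noteq> 0" for b by (auto simp: shc_def)
  show ?thesis unfolding eq
    using assms shc shc0 by (intro continuous_intros) auto
qed

lemma extend_by_continuity_eq:
  fixes p :: "'a::t2_space"
  assumes eq: "\<And>x. x \<in> S \<Longrightarrow> f x = g x" and cont: "isCont g p" and lp: "p islimpt S"
  shows "extend_by_continuity S f p = g p"
proof (cases "p \<in> S")
  case True then show ?thesis by (simp add: extend_by_continuity_def eq)
next
  case False
  have "(g \<longlongrightarrow> g p) (at p within S)" using cont by (metis isCont_def tendsto_within_subset subset_UNIV)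
  then have "(f \<longlongrightarrow> g p) (at p within S)"
    by (rule Lim_transform_eventually) (auto simp: eventually_at_filter eq)
  then have "Lim (at p within S) f = g p"
    using lp by (intro tendsto_Lim) (auto simp: trivial_limit_within)
  then show ?thesis using False by (simp add: extend_by_continuity_def)
qed

lemma continuous_on_arcosh_compose:
  fixes f :: "'a::topological_space \<Rightarrow> real"
  assumes "continuous_on S f" "\<And>x. x \<in> S \<Longrightarrow> 1 \<le> f x"
  shows "continuous_on S (\<lambda>x. arcosh (f x))"
  by (rule continuous_on_compose2[OF continuous_on_arcosh[OF order_refl] assms(1)]) (use assms(2) in auto)

lemma sinh_arcosh_real: "x \<ge> 1 \<Longrightarrow> sinh (arcosh x) = sqrt (x\<^sup>2 - 1)" for x :: real
  using cosh_square_eq[of "arcosh x"] by (intro real_sqrt_unique[symmetric]) auto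

lemma sin_over_sinh_arcosh:
  assumes "x > (1::real)"
  shows "sin_over_sinh \<mu> (arcosh x) = sin (\<mu> * arcosh x) / sqrt (x\<^sup>2 - 1)"
  using assms sinh_arcosh_real[of x] by (auto simp: sin_over_sinh_def)

lemma cosh_larger_nearby:
  fixes \<eta> e :: real assumes "e > 0"
  obtains \<eta>' where "\<bar>\<eta>' - \<eta>\<bar> < e" "cosh \<eta>' > cosh \<eta>"
proof (cases "\<eta> \<ge> 0")
  case True
  then show ?thesis using assms cosh_real_nonneg_less_iff[of \<eta> "\<eta> + e / 2"] by (intro that[of "\<eta> + e / 2"]) auto
next
  case False
  then show ?thesis using assms cosh_real_nonpos_less_iff[of \<eta> "\<eta> - e / 2"] by (intro that[of "\<eta> - e / 2"]) auto
qed

text \<open>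
  The exceptional \<open>\<eta>\<close> are the solutions of an equation \<open>cosh \<eta> = const\<close>, and any increase of
  \<open>cosh \<eta>\<close> leaves them.
\<close>

lemma islimpt_of_cosh:
  fixes \<eta> \<nu> :: real
  assumes "\<nu> \<noteq> 0" and S: "\<And>\<eta>'. cosh \<eta>' > cosh \<eta> \<Longrightarrow> (\<eta>', \<nu>) \<in> S"
  shows "(\<eta>, \<nu>) islimpt S"
  unfolding islimpt_approachable
proof (intro allI impI)
  fix e :: real assume "e > 0"
  then obtain \<eta>' where h: "\<bar>\<eta>' - \<eta>\<bar> < e" "cosh \<eta>' > cosh \<eta>" by (rule cosh_larger_nearby)
  then have "(\<eta>', \<nu>) \<noteq> (\<eta>, \<nu>)" "dist (\<eta>', \<nu>) (\<eta>, \<nu>) < e"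
    by (auto simp: dist_prod_def dist_real_def)
  then show "\<exists>x'\<in>S. x' \<noteq> (\<eta>, \<nu>) \<and> dist x' (\<eta>, \<nu>) < e" using S[OF h(2)] by blast
qed

context
  fixes \<alpha> \<alpha>o :: real
  assumes cos_pos: "cos \<alpha> > 0" and alo: "\<alpha>o > - cos \<alpha>" and al: "sin \<alpha> \<noteq> 0"
begin

lemma coeff_A_pos: "coeff_A \<alpha> > 0" using al by (simp add: coeff_A_def)

lemma discr_pos: "discr \<alpha> \<alpha>o \<eta> > 0"
proof -
  have "coeff_C \<alpha> \<alpha>o \<eta> < 0"
    using zero_le_power2[of \<alpha>o] zero_le_power2[of "cos \<alpha> * sinh \<eta>"] unfolding power_mult_distrib coeff_C_def by linarith
  then have "coeff_A \<alpha> * coeff_C \<alpha> \<alpha>o \<eta> < 0" using coeff_A_pos by (simp add: mult_less_0_iff)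
  then show ?thesis unfolding discr_def using zero_le_power2[of "coeff_B \<alpha> \<alpha>o \<eta>"] by linarith
qed

lemma quadratic_factored:
  "coeff_A \<alpha> * x\<^sup>2 + coeff_B \<alpha> \<alpha>o \<eta> * x + coeff_C \<alpha> \<alpha>o \<eta> = coeff_A \<alpha> * ((x - C_plus \<alpha> \<alpha>o \<eta>) * (x - C_minus \<alpha> \<alpha>o \<eta>))"
proof -
  define A B C s where "A = coeff_A \<alpha>" and "B = coeff_B \<alpha> \<alpha>o \<eta>" and "C = coeff_C \<alpha> \<alpha>o \<eta>" and "s = sqrt (discr \<alpha> \<alpha>o \<eta>)"
  have A: "A > 0" using coeff_A_pos by (simp add: A_def)
  have s: "s * s = B\<^sup>2 - 4 * A * C" using discr_pos[of \<eta>] by (simp add: s_def discr_def A_def B_def C_def)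
  have "(x - (- B + s) / (2 * A)) * (x - (- B - s) / (2 * A)) = ((2 * A * x + B) - s) * ((2 * A * x + B) + s) / (4 * A * A)"
    using A by (simp add: field_simps)
  also have "((2 * A * x + B) - s) * ((2 * A * x + B) + s) = (2 * A * x + B)\<^sup>2 - s * s"
    by (simp add: power2_eq_square algebra_simps)
  also have "\<dots> = 4 * A * (A * x\<^sup>2 + B * x + C)" unfolding s by (simp add: power2_eq_square algebra_simps)
  finally have f: "(x - (- B + s) / (2 * A)) * (x - (- B - s) / (2 * A)) = 4 * A * (A * x\<^sup>2 + B * x + C) / (4 * A * A)" .
  have "A * ((x - (- B + s) / (2 * A)) * (x - (- B - s) / (2 * A))) = A * x\<^sup>2 + B * x + C"
    unfolding f using A by simp
  then show ?thesis unfolding C_plus_def C_minus_def A_def B_def C_def s_def by simp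
qed

lemma C_plus_minus_C_minus: "coeff_A \<alpha> * (C_plus \<alpha> \<alpha>o \<eta> - C_minus \<alpha> \<alpha>o \<eta>) = sqrt (discr \<alpha> \<alpha>o \<eta>)"
  using coeff_A_pos by (simp add: C_plus_def C_minus_def field_simps)

lemma quadratic_at_one:
  "coeff_A \<alpha> + coeff_B \<alpha> \<alpha>o \<eta> + coeff_C \<alpha> \<alpha>o \<eta> = - (\<alpha>o + cos \<alpha> * cosh \<eta>)\<^sup>2"
  "coeff_A \<alpha> - coeff_B \<alpha> \<alpha>o \<eta> + coeff_C \<alpha> \<alpha>o \<eta> = - (\<alpha>o - cos \<alpha> * cosh \<eta>)\<^sup>2"
  unfolding coeff_A_def coeff_B_def coeff_C_def sin_squared_eq sinh_square_eq
  by (simp_all add: power2_eq_square algebra_simps)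

text \<open>
  The parabola opens upwards, is negative at \<open>1\<close> and is at most \<open>0\<close> at \<open>- 1\<close>.
\<close>

lemma C_bounds: "C_plus \<alpha> \<alpha>o \<eta> > 1" "C_minus \<alpha> \<alpha>o \<eta> \<le> - 1"
  and C_minus_eq: "C_minus \<alpha> \<alpha>o \<eta> = - 1 \<Longrightarrow> \<alpha>o = cos \<alpha> * cosh \<eta>"
proof -
  let ?p = "C_plus \<alpha> \<alpha>o \<eta>" and ?m = "C_minus \<alpha> \<alpha>o \<eta>"
  have "\<alpha>o + cos \<alpha> * cosh \<eta> > 0"
    using alo mult_left_mono[OF cosh_real_ge_1[of \<eta>], of "cos \<alpha>"] cos_pos by linarith
  then have "(\<alpha>o + cos \<alpha> * cosh \<eta>)\<^sup>2 > 0" by simp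
  moreover have "coeff_A \<alpha> * ((1 - ?p) * (1 - ?m)) = - (\<alpha>o + cos \<alpha> * cosh \<eta>)\<^sup>2"
    using quadratic_factored[of 1 \<eta>] quadratic_at_one(1)[of \<eta>] by simp
  ultimately have "coeff_A \<alpha> * ((1 - ?p) * (1 - ?m)) < 0" by linarith
  then have p1: "(1 - ?p) * (1 - ?m) < 0" using coeff_A_pos by (simp add: mult_less_0_iff)
  have f2: "coeff_A \<alpha> * ((- 1 - ?p) * (- 1 - ?m)) = - (\<alpha>o - cos \<alpha> * cosh \<eta>)\<^sup>2"
    using quadratic_factored[of "- 1" \<eta>] quadratic_at_one(2)[of \<eta>] by simp
  have "coeff_A \<alpha> * (?p - ?m) > 0" unfolding C_plus_minus_C_minus using discr_pos by simp
  then have "?p > ?m" using coeff_A_pos by (simp add: zero_less_mult_iff)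
  then show p: "?p > 1" using p1 by (auto simp: mult_less_0_iff)
  have "coeff_A \<alpha> * ((- 1 - ?p) * (- 1 - ?m)) \<le> 0" unfolding f2 by simp
  then have "(- 1 - ?p) * (- 1 - ?m) \<le> 0" using coeff_A_pos by (simp add: mult_le_0_iff)
  then show "?m \<le> - 1" using p by (auto simp: mult_le_0_iff)
  assume "?m = - 1"
  then have "(\<alpha>o - cos \<alpha> * cosh \<eta>)\<^sup>2 = 0" using f2 by simp
  then show "\<alpha>o = cos \<alpha> * cosh \<eta>" by simp
qed

lemma continuous_discr_C:
  assumes "continuous_on S f"
  shows "continuous_on S (\<lambda>x. discr \<alpha> \<alpha>o (f x))" "continuous_on S (\<lambda>x. C_plus \<alpha> \<alpha>o (f x))" "continuous_on S (\<lambda>x. C_minus \<alpha> \<alpha>o (f x))"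
proof -
  have B: "continuous_on S (\<lambda>x. coeff_B \<alpha> \<alpha>o (f x))" "continuous_on S (\<lambda>x. coeff_C \<alpha> \<alpha>o (f x))"
    unfolding coeff_B_def coeff_C_def by (intro continuous_intros assms)+
  show D: "continuous_on S (\<lambda>x. discr \<alpha> \<alpha>o (f x))"
    unfolding discr_def by (intro continuous_intros B)
  have "2 * coeff_A \<alpha> \<noteq> 0" using coeff_A_pos by simp
  then show "continuous_on S (\<lambda>x. C_plus \<alpha> \<alpha>o (f x))" "continuous_on S (\<lambda>x. C_minus \<alpha> \<alpha>o (f x))"
    unfolding C_plus_def C_minus_def by (intro continuous_intros B D; simp)+
qed

lemma R_oblique_eq:
  assumes \<nu>: "\<nu> \<noteq> 0"
  shows "R_oblique \<alpha> \<alpha>o (\<eta>, \<nu>) =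
    tanh (pi * \<nu>) / (\<nu> * tanh (2 * pi * \<nu>)) * (sin_over_sinh (2 * \<nu>) (arcosh (C_plus \<alpha> \<alpha>o \<eta>)) / sqrt (discr \<alpha> \<alpha>o \<eta>)) +
    tanh (pi * \<nu>) / (\<nu> * sinh (2 * pi * \<nu>)) * (sin_over_sinh (2 * \<nu>) (arcosh \<bar>C_minus \<alpha> \<alpha>o \<eta>\<bar>) / sqrt (discr \<alpha> \<alpha>o \<eta>))"
proof -
  define g where "g = (\<lambda>(\<eta>, \<nu>).
    tanh (pi * \<nu>) / (\<nu> * tanh (2 * pi * \<nu>)) * (sin_over_sinh (2 * \<nu>) (arcosh (C_plus \<alpha> \<alpha>o \<eta>)) / sqrt (discr \<alpha> \<alpha>o \<eta>)) +
    tanh (pi * \<nu>) / (\<nu> * sinh (2 * pi * \<nu>)) * (sin_over_sinh (2 * \<nu>) (arcosh \<bar>C_minus \<alpha> \<alpha>o \<eta>\<bar>) / sqrt (discr \<alpha> \<alpha>o \<eta>)))"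
  have cp: "continuous_on S (\<lambda>x. arcosh (C_plus \<alpha> \<alpha>o (fst x)))" "continuous_on S (\<lambda>x. arcosh \<bar>C_minus \<alpha> \<alpha>o (fst x)\<bar>)"
    for S :: "(real \<times> real) set"
  proof -
    have ge: "C_plus \<alpha> \<alpha>o \<eta> \<ge> 1" "\<bar>C_minus \<alpha> \<alpha>o \<eta>\<bar> \<ge> 1" for \<eta> using C_bounds[of \<eta>] by linarith+
    have fst: "continuous_on S fst" by (intro continuous_intros)
    show "continuous_on S (\<lambda>x. arcosh (C_plus \<alpha> \<alpha>o (fst x)))"
      by (rule continuous_on_arcosh_compose[OF continuous_discr_C(2)[OF fst]]) (rule ge)
    show "continuous_on S (\<lambda>x. arcosh \<bar>C_minus \<alpha> \<alpha>o (fst x)\<bar>)"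
      by (rule continuous_on_arcosh_compose[OF continuous_on_rabs[OF continuous_discr_C(3)[OF fst]]]) (rule ge)
  qed
  have cont: "isCont g (\<eta>, \<nu>)"
  proof -
    have "continuous_on {(\<eta>, \<nu>). \<nu> \<noteq> 0} g"
      unfolding g_def split_beta
      using discr_pos less_imp_neq[OF discr_pos]
      by (intro continuous_intros cp continuous_discr_C) auto
    moreover have "open {(\<eta>::real, \<nu>::real). \<nu> \<noteq> 0}"
    proof -
      have "{(\<eta>::real, \<nu>::real). \<nu> \<noteq> 0} = UNIV \<times> (- {0})" by auto
      then show ?thesis by (simp add: open_Times open_Compl)
    qed
    ultimately show ?thesis using \<nu> by (subst (asm) continuous_on_eq_continuous_at) auto
  qed
  have lp: "(\<eta>, \<nu>) islimpt {(\<eta>, \<nu>). \<nu> \<noteq> 0 \<and> C_minus \<alpha> \<alpha>o \<eta> \<noteq> - 1}"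
  proof (cases "C_minus \<alpha> \<alpha>o \<eta> = - 1")
    case True
    show ?thesis
    proof (rule islimpt_of_cosh[OF \<nu>])
      fix \<eta>' assume "cosh \<eta>' > cosh \<eta>"
      then have "cos \<alpha> * cosh \<eta> < cos \<alpha> * cosh \<eta>'" using cos_pos by (rule mult_strict_left_mono)
      then have "\<alpha>o \<noteq> cos \<alpha> * cosh \<eta>'" using C_minus_eq[OF True] by linarith
      then show "(\<eta>', \<nu>) \<in> {(\<eta>, \<nu>). \<nu> \<noteq> 0 \<and> C_minus \<alpha> \<alpha>o \<eta> \<noteq> - 1}" using C_minus_eq[of \<eta>'] \<nu> by auto
    qed
  next
    case False
    have cm: "continuous_on UNIV (C_minus \<alpha> \<alpha>o)"
      using continuous_discr_C(3)[OF continuous_on_id] by simp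
    have "{(\<eta>::real, \<nu>::real). \<nu> \<noteq> 0 \<and> C_minus \<alpha> \<alpha>o \<eta> \<noteq> - 1} = ((C_minus \<alpha> \<alpha>o) -` (- {- 1})) \<times> (- {0})" by auto
    moreover have "open ((C_minus \<alpha> \<alpha>o) -` (- {- 1}))"
      using continuous_open_vimage[of "- {- 1}" "C_minus \<alpha> \<alpha>o"] cm by (auto simp: continuous_on_eq_continuous_at)
    ultimately have "open {(\<eta>::real, \<nu>::real). \<nu> \<noteq> 0 \<and> C_minus \<alpha> \<alpha>o \<eta> \<noteq> - 1}" by (simp add: open_Times open_Compl)
    then show ?thesis using False \<nu> by (intro interior_limit_point) (auto simp: interior_open)
  qed
  have "R_oblique \<alpha> \<alpha>o (\<eta>, \<nu>) = g (\<eta>, \<nu>)"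
    unfolding R_oblique_def
  proof (rule extend_by_continuity_eq[OF _ cont lp])
    fix x :: "real \<times> real" assume "x \<in> {(\<eta>, \<nu>). \<nu> \<noteq> 0 \<and> C_minus \<alpha> \<alpha>o \<eta> \<noteq> - 1}"
    then obtain \<eta> \<nu> where x: "x = (\<eta>, \<nu>)" "\<nu> \<noteq> 0" "C_minus \<alpha> \<alpha>o \<eta> \<noteq> - 1" by auto
    have "\<bar>C_minus \<alpha> \<alpha>o \<eta>\<bar> > 1" using C_bounds(2)[of \<eta>] x(3) by auto
    then show "(case x of (\<eta>, \<nu>) \<Rightarrow>
        tanh (pi * \<nu>) / (\<nu> * tanh (2 * pi * \<nu>)) *
          (sin (2 * \<nu> * arcosh (C_plus \<alpha> \<alpha>o \<eta>)) / (sqrt (discr \<alpha> \<alpha>o \<eta>) * sqrt ((C_plus \<alpha> \<alpha>o \<eta>)\<^sup>2 - 1))) +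
        tanh (pi * \<nu>) / (\<nu> * sinh (2 * pi * \<nu>)) *
          (sin (2 * \<nu> * arcosh \<bar>C_minus \<alpha> \<alpha>o \<eta>\<bar>) / (sqrt (discr \<alpha> \<alpha>o \<eta>) * sqrt ((C_minus \<alpha> \<alpha>o \<eta>)\<^sup>2 - 1)))) = g x"
      unfolding x g_def by (simp add: sin_over_sinh_arcosh C_bounds(1) mult.commute[of "sqrt (discr \<alpha> \<alpha>o \<eta>)"])
  qed
  then show ?thesis by (simp add: g_def)
qed

end

text \<open>
  Here \<open>C < 0\<close> and \<open>|C| - |B| = (cosh \<eta> - |\<alpha>\<^sub>o|)\<^sup>2\<close>.
\<close>

lemma normal_ratio:
  fixes \<alpha>o \<eta> :: real
  assumes "\<alpha>o \<noteq> 0"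
  shows "\<bar>coeff_B 0 \<alpha>o \<eta>\<bar> > 0" "\<bar>coeff_C 0 \<alpha>o \<eta> / coeff_B 0 \<alpha>o \<eta>\<bar> \<ge> 1"
    and "\<bar>coeff_C 0 \<alpha>o \<eta> / coeff_B 0 \<alpha>o \<eta>\<bar> = 1 \<Longrightarrow> cosh \<eta> = \<bar>\<alpha>o\<bar>"
    and "sqrt ((coeff_C 0 \<alpha>o \<eta>)\<^sup>2 - (coeff_B 0 \<alpha>o \<eta>)\<^sup>2) = \<bar>coeff_B 0 \<alpha>o \<eta>\<bar> * sqrt (\<bar>coeff_C 0 \<alpha>o \<eta> / coeff_B 0 \<alpha>o \<eta>\<bar>\<^sup>2 - 1)"
    and "coeff_C 0 \<alpha>o \<eta> = - (\<bar>coeff_B 0 \<alpha>o \<eta>\<bar> * \<bar>coeff_C 0 \<alpha>o \<eta> / coeff_B 0 \<alpha>o \<eta>\<bar>)"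
proof -
  let ?B = "coeff_B 0 \<alpha>o \<eta>" and ?C = "coeff_C 0 \<alpha>o \<eta>"
  have C: "?C = - ((cosh \<eta>)\<^sup>2 + \<alpha>o\<^sup>2)" by (simp add: coeff_C_def sinh_square_eq)
  have B: "\<bar>?B\<bar> = 2 * \<bar>\<alpha>o\<bar> * cosh \<eta>" by (simp add: coeff_B_def abs_mult)
  show B0: "\<bar>?B\<bar> > 0" unfolding B using assms by simp
  have aC: "\<bar>?C\<bar> = (cosh \<eta>)\<^sup>2 + \<alpha>o\<^sup>2" unfolding C by simp
  have diff: "\<bar>?C\<bar> - \<bar>?B\<bar> = (cosh \<eta> - \<bar>\<alpha>o\<bar>)\<^sup>2" unfolding aC B by (simp add: power2_diff)
  show ge: "\<bar>?C / ?B\<bar> \<ge> 1" 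
  proof -
    have "\<bar>?B\<bar> \<le> \<bar>?C\<bar>" using diff zero_le_power2[of "cosh \<eta> - \<bar>\<alpha>o\<bar>"] by linarith
    then show ?thesis using B0 by (simp add: abs_divide)
  qed
  show "cosh \<eta> = \<bar>\<alpha>o\<bar>" if "\<bar>?C / ?B\<bar> = 1"
  proof -
    have "\<bar>?C\<bar> = \<bar>?B\<bar>" using that B0 by (simp add: abs_divide)
    then have "(cosh \<eta> - \<bar>\<alpha>o\<bar>)\<^sup>2 = 0" using diff by simp
    then show ?thesis by simp
  qed
  have "?C\<^sup>2 - ?B\<^sup>2 = \<bar>?B\<bar>\<^sup>2 * (\<bar>?C / ?B\<bar>\<^sup>2 - 1)" using B0 by (simp add: power_divide right_diff_distrib)
  then have "sqrt (?C\<^sup>2 - ?B\<^sup>2) = sqrt (\<bar>?B\<bar>\<^sup>2) * sqrt (\<bar>?C / ?B\<bar>\<^sup>2 - 1)" by (simp only: real_sqrt_mult)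
  then show "sqrt (?C\<^sup>2 - ?B\<^sup>2) = \<bar>?B\<bar> * sqrt (\<bar>?C / ?B\<bar>\<^sup>2 - 1)" by (simp only: real_sqrt_abs abs_abs)
  have "\<bar>?B\<bar> * \<bar>?C / ?B\<bar> = \<bar>?C\<bar>" using B0 by (simp add: abs_divide)
  then show "?C = - (\<bar>?B\<bar> * \<bar>?C / ?B\<bar>)" using aC C by simp
qed

lemma R_normal_eq:
  assumes \<nu>: "\<nu> \<noteq> 0" and al: "\<alpha>o > - 1" "\<alpha>o \<noteq> 0"
  defines "x0 \<equiv> \<lambda>\<eta>. \<bar>coeff_C 0 \<alpha>o \<eta> / coeff_B 0 \<alpha>o \<eta>\<bar>"
  shows "R_normal \<alpha>o (\<eta>, \<nu>) = tanh (pi * \<nu>) / (if \<alpha>o < 0 then tanh (2 * pi * \<nu>) else sinh (2 * pi * \<nu>)) *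
      (sin_over_sinh (2 * \<nu>) (arcosh (x0 \<eta>)) / (\<nu> * \<bar>coeff_B 0 \<alpha>o \<eta>\<bar>))"
proof -
  define g where "g = (\<lambda>(\<eta>, \<nu>). tanh (pi * \<nu>) / (if \<alpha>o < 0 then tanh (2 * pi * \<nu>) else sinh (2 * pi * \<nu>)) *
      (sin_over_sinh (2 * \<nu>) (arcosh (x0 \<eta>)) / (\<nu> * \<bar>coeff_B 0 \<alpha>o \<eta>\<bar>)))"
  have N: "\<bar>coeff_B 0 \<alpha>o \<eta>\<bar> > 0" "x0 \<eta> \<ge> 1" "x0 \<eta> = 1 \<Longrightarrow> cosh \<eta> = \<bar>\<alpha>o\<bar>"
    "sqrt ((coeff_C 0 \<alpha>o \<eta>)\<^sup>2 - (coeff_B 0 \<alpha>o \<eta>)\<^sup>2) = \<bar>coeff_B 0 \<alpha>o \<eta>\<bar> * sqrt ((x0 \<eta>)\<^sup>2 - 1)" for \<eta>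
    unfolding x0_def by (fact normal_ratio[OF al(2)])+
  have B0: "coeff_B 0 \<alpha>o \<eta> \<noteq> 0" for \<eta> using N(1)[of \<eta>] by auto
  have contB: "continuous_on S (\<lambda>x. coeff_B 0 \<alpha>o (f x))" "continuous_on S (\<lambda>x. coeff_C 0 \<alpha>o (f x))"
    if "continuous_on S f" for S and f :: "'a::topological_space \<Rightarrow> real"
    unfolding coeff_B_def coeff_C_def by (intro continuous_intros that)+
  have contx0: "continuous_on S (\<lambda>x. x0 (f x))" if "continuous_on S f" for S and f :: "'a::topological_space \<Rightarrow> real"
    unfolding x0_def using B0 by (intro continuous_intros contB that) auto
  have cx: "continuous_on S (\<lambda>x. arcosh (x0 (fst x)))" for S :: "(real \<times> real) set"
    by (rule continuous_on_arcosh_compose[OF contx0[OF continuous_on_fst[OF continuous_on_id]]]) (rule N(2))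
  have cont: "isCont g (\<eta>, \<nu>)"
  proof -
    have "continuous_on {(\<eta>, \<nu>). \<nu> \<noteq> 0} g"
    proof (cases "\<alpha>o < 0")
      case True
      show ?thesis unfolding g_def split_beta if_P[OF True]
        using B0 by (intro continuous_intros cx contB) auto
    next
      case False
      show ?thesis unfolding g_def split_beta if_not_P[OF False]
        using B0 by (intro continuous_intros cx contB) auto
    qed
    moreover have "open {(\<eta>::real, \<nu>::real). \<nu> \<noteq> 0}"
    proof -
      have "{(\<eta>::real, \<nu>::real). \<nu> \<noteq> 0} = UNIV \<times> (- {0})" by auto
      then show ?thesis by (simp add: open_Times open_Compl)
    qed
    ultimately show ?thesis using \<nu> by (subst (asm) continuous_on_eq_continuous_at) auto
  qed
  let ?S = "{(\<eta>::real, \<nu>::real). \<nu> \<noteq> 0 \<and> x0 \<eta> \<noteq> 1}"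
  have lp: "(\<eta>, \<nu>) islimpt ?S"
  proof (cases "x0 \<eta> = 1")
    case True
    show ?thesis
    proof (rule islimpt_of_cosh[OF \<nu>])
      fix \<eta>' assume "cosh \<eta>' > cosh \<eta>"
      then show "(\<eta>', \<nu>) \<in> ?S" using N(3)[OF True] N(3)[of \<eta>'] \<nu> by auto
    qed
  next
    case False
    have eq: "?S = (x0 -` (- {1})) \<times> (- {0})" by auto
    have "open (x0 -` (- {1}))"
      using continuous_open_vimage[of "- {1}" x0] contx0[OF continuous_on_id, of UNIV] by (auto simp: continuous_on_eq_continuous_at)
    then have "open ?S" unfolding eq by (rule open_Times[OF _ open_Compl[OF closed_singleton]])
    then show ?thesis using False \<nu> by (intro interior_limit_point) (auto simp: interior_open)
  qed
  have x0: "\<bar>coeff_C 0 \<alpha>o \<eta> / coeff_B 0 \<alpha>o \<eta>\<bar> = x0 \<eta>" for \<eta> by (simp add: x0_def)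
  have "R_normal \<alpha>o (\<eta>, \<nu>) = g (\<eta>, \<nu>)"
    unfolding R_normal_def x0
  proof (rule extend_by_continuity_eq[OF _ cont lp])
    fix x :: "real \<times> real" assume "x \<in> ?S"
    then obtain \<eta> \<nu> where x: "x = (\<eta>, \<nu>)" "\<nu> \<noteq> 0" "x0 \<eta> \<noteq> 1" by auto
    have x1: "x0 \<eta> > 1" using N(2)[of \<eta>] x(3) by simp
    show "(case x of (\<eta>, \<nu>) \<Rightarrow>
        if \<alpha>o \<in> {-1<..<0} then
          tanh (pi * \<nu>) / tanh (2 * pi * \<nu>) *
            (sin (2 * \<nu> * arcosh (x0 \<eta>)) / (\<nu> * sqrt ((coeff_C 0 \<alpha>o \<eta>)\<^sup>2 - (coeff_B 0 \<alpha>o \<eta>)\<^sup>2)))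
        else if \<alpha>o > 0 then
          tanh (pi * \<nu>) / sinh (2 * pi * \<nu>) *
            (sin (2 * \<nu> * arcosh (x0 \<eta>)) / (\<nu> * sqrt ((coeff_C 0 \<alpha>o \<eta>)\<^sup>2 - (coeff_B 0 \<alpha>o \<eta>)\<^sup>2)))
        else 0) = g x"
      unfolding x g_def N(4) using al by (auto simp: sin_over_sinh_arcosh[OF x1])
  qed
  then show ?thesis by (simp add: g_def)
qed

section \<open>The recorded signal\<close>

lemma tempered_limit_cong:
  assumes "\<forall>\<^sub>F i in F. g i = g' i" "tempered_limit g D F" shows "tempered_limit g' D F"
  unfolding tempered_limit_def
proof (intro conjI allI impI)
  show "tempered_distribution D" using assms(2) by (simp add: tempered_limit_def)
  fix \<phi> assume "schwartz \<phi>"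
  then have *: "\<forall>\<^sub>F i in F. integrable lborel (\<lambda>s. g i s * \<phi> s)" "((\<lambda>i. \<integral>s. g i s * \<phi> s \<partial>lborel) \<longlongrightarrow> D \<phi>) F"
    using assms(2) by (auto simp: tempered_limit_def)
  show "\<forall>\<^sub>F i in F. integrable lborel (\<lambda>s. g' i s * \<phi> s)"
    using assms(1) *(1) by eventually_elim simp
  show "((\<lambda>i. \<integral>s. g' i s * \<phi> s \<partial>lborel) \<longlongrightarrow> D \<phi>) F"
    by (rule Lim_transform_eventually[OF *(2)]) (use assms(1) in eventually_elim, simp)
qed

text \<open>
  The function \<open>h\<close> is compared with the prescribed spectrum away from the null set \<open>{0}\<close>, and a Dirac
  mass is invisible to test functions that vanish near \<open>0\<close>.
\<close>

lemma wigner_transform_of_spectral_limit: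
  fixes hr :: "real \<Rightarrow> real" and m :: complex
  assumes lim: "spectral_limit g h m"
    and g: "\<And>\<epsilon> s. \<epsilon> > 0 \<Longrightarrow> autocorrelation (M \<epsilon>) (U \<epsilon>) \<tau> s = g \<epsilon> s"
    and hr: "\<And>\<omega>. \<omega> \<noteq> 0 \<Longrightarrow> h \<omega> = of_real (hr \<omega>)" and m: "m = 0 \<or> 0 \<notin> \<Omega>"
  shows "\<exists>W. is_wigner_transform M U \<tau> W \<and> equals_function_on W hr \<Omega>"
proof -
  obtain D K where D: "tempered_limit (\<lambda>\<epsilon> s. complex_of_real (g \<epsilon> s)) D (at_right 0)"
    "\<And>\<phi>. schwartz \<phi> \<Longrightarrow> D (fourier \<phi>) = (\<integral>\<omega>. h \<omega> * \<phi> \<omega> \<partial>lborel) + m * \<phi> 0"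
    and h [measurable]: "h \<in> borel_measurable borel" and K: "\<And>\<omega>. norm (h \<omega>) \<le> K * (1 + \<omega>\<^sup>2)"
    using lim unfolding spectral_limit_def by blast
  define W where "W = (\<lambda>\<phi>. (\<integral>\<omega>. h \<omega> * \<phi> \<omega> \<partial>lborel) + m * \<phi> 0)"
  have K0: "0 \<le> K" using order_trans[OF norm_ge_zero K[of 0]] by simp
  have int: "integrable lborel (\<lambda>\<omega>. h \<omega> * \<phi> \<omega>)" if "schwartz \<phi>" for \<phi>
    using schwartz_integrable_times[OF that, of 0 h K] K by simp
  have bound: "norm (W \<phi>) \<le> (4 * K * (\<integral>s. 1 / (1 + (s::real)\<^sup>2) \<partial>lborel) + norm m) * schwartz_size \<phi>" if \<phi>: "schwartz \<phi>" for \<phi>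
  proof -
    have "norm (\<integral>\<omega>. h \<omega> * \<phi> \<omega> \<partial>lborel) \<le> (\<integral>\<omega>. (K * (4 * schwartz_size \<phi>)) * (1 / (1 + \<omega>\<^sup>2)) \<partial>lborel)"
    proof (rule order_trans[OF integral_norm_bound], rule Bochner_Integration.integral_mono)
      fix \<omega>
      have "norm (h \<omega> * \<phi> \<omega>) \<le> K * (1 + \<omega>\<^sup>2) * norm (\<phi> \<omega>)"
        unfolding norm_mult using K by (rule mult_right_mono) simp
      also have "\<dots> \<le> K * (4 * schwartz_size \<phi> * (1 / (1 + \<omega>\<^sup>2)))"
        unfolding mult.assoc[of K] using schwartz_decay[OF \<phi>, of 0 \<omega>] K0 by (intro mult_left_mono) simp_all
      finally show "norm (h \<omega> * \<phi> \<omega>) \<le> (K * (4 * schwartz_size \<phi>)) * (1 / (1 + \<omega>\<^sup>2))" by simp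
    qed (intro integrable_norm int[OF \<phi>] integrable_inverse_square)+
    also have "\<dots> = (K * (4 * schwartz_size \<phi>)) * (\<integral>\<omega>. 1 / (1 + \<omega>\<^sup>2) \<partial>lborel)" by (rule integral_mult_right_zero)
    finally have "norm (\<integral>\<omega>. h \<omega> * \<phi> \<omega> \<partial>lborel) \<le> (K * (4 * schwartz_size \<phi>)) * (\<integral>\<omega>. 1 / (1 + \<omega>\<^sup>2) \<partial>lborel)" .
    moreover have "norm (m * \<phi> 0) \<le> norm m * schwartz_size \<phi>"
      unfolding norm_mult using schwartz_size_upper[OF \<phi>, of 0 0 0] by (intro mult_left_mono) simp_all
    ultimately show ?thesis
      unfolding W_def using norm_triangle_ineq[of "\<integral>\<omega>. h \<omega> * \<phi> \<omega> \<partial>lborel" "m * \<phi> 0"] by (simp add: algebra_simps)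
  qed
  have "tempered_distribution W"
    unfolding tempered_distribution_def
  proof (intro conjI allI impI)
    fix \<phi> \<psi> a b assume "schwartz \<phi>" "schwartz \<psi>"
    then have "(\<integral>\<omega>. a * (h \<omega> * \<phi> \<omega>) + b * (h \<omega> * \<psi> \<omega>) \<partial>lborel) = a * (\<integral>\<omega>. h \<omega> * \<phi> \<omega> \<partial>lborel) + b * (\<integral>\<omega>. h \<omega> * \<psi> \<omega> \<partial>lborel)"
      using int by simp
    then show "W (\<lambda>x. a * \<phi> x + b * \<psi> x) = a * W \<phi> + b * W \<psi>"
      by (simp add: W_def algebra_simps)
  next
    show "\<exists>K N. \<forall>\<phi>. schwartz \<phi> \<longrightarrow> norm (W \<phi>) \<le> K * (\<Sum>k\<le>N. \<Sum>n\<le>N. schwartz_seminorm k n \<phi>)"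
      using bound unfolding schwartz_size_def by blast
  qed
  moreover have "tempered_limit (\<lambda>\<epsilon> \<tau>'. complex_of_real (autocorrelation (M \<epsilon>) (U \<epsilon>) \<tau> \<tau>')) D (at_right 0)"
    by (rule tempered_limit_cong[OF _ D(1)])
       (rule eventually_mono[OF eventually_at_right_less], simp add: g)
  ultimately have "is_wigner_transform M U \<tau> W"
    unfolding is_wigner_transform_def using D(2) by (auto simp: W_def)
  moreover have "equals_function_on W hr \<Omega>"
    unfolding equals_function_on_def
  proof (intro allI impI)
    fix \<phi> assume \<phi>: "schwartz \<phi>" and supp: "closure {\<omega>. \<phi> \<omega> \<noteq> 0} \<subseteq> \<Omega>"
    have [measurable]: "\<phi> \<in> borel_measurable borel" using schwartz_measurable[OF \<phi>, of 0] by simp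
    have "m * \<phi> 0 = 0" using m supp closure_subset[of "{\<omega>. \<phi> \<omega> \<noteq> 0}"] by auto
    then have W: "W \<phi> = (\<integral>\<omega>. h \<omega> * \<phi> \<omega> \<partial>lborel)" by (simp add: W_def)
    have eq: "(\<lambda>\<omega>. complex_of_real (hr \<omega>) * \<phi> \<omega>) = (\<lambda>\<omega>. if \<omega> = 0 then complex_of_real (hr 0) * \<phi> 0 else h \<omega> * \<phi> \<omega>)"
      using hr by auto
    have meas: "(\<lambda>\<omega>. complex_of_real (hr \<omega>) * \<phi> \<omega>) \<in> borel_measurable borel"
      unfolding eq by measurable
    have ae: "AE \<omega> in lborel. h \<omega> * \<phi> \<omega> = complex_of_real (hr \<omega>) * \<phi> \<omega>"
      by (rule eventually_mono[OF AE_lborel_singleton[of 0]]) (simp add: hr)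
    show "integrable lborel (\<lambda>\<omega>. complex_of_real (hr \<omega>) * \<phi> \<omega>) \<and> W \<phi> = (\<integral>\<omega>. complex_of_real (hr \<omega>) * \<phi> \<omega> \<partial>lborel)"
    proof
      show "integrable lborel (\<lambda>\<omega>. complex_of_real (hr \<omega>) * \<phi> \<omega>)"
        by (rule Bochner_Integration.integrable_cong_AE_imp[OF int[OF \<phi>] _ ae]) (use meas in simp)
      show "W \<phi> = (\<integral>\<omega>. complex_of_real (hr \<omega>) * \<phi> \<omega> \<partial>lborel)"
        unfolding W by (rule integral_cong_AE[OF _ _ ae]) (use meas in simp_all)
    qed
  qed
  ultimately show ?thesis by blast
qed

lemma autocorrelation_regularized:
  fixes T :: "real \<Rightarrow> real" and X :: "real \<Rightarrow> real^3"
  assumes c: "c > 0" and e: "\<epsilon> > 0"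
    and field: "mirror_noise_field c (\<lambda>\<omega>. f * \<bar>\<omega>\<bar> * exp (- \<epsilon> * \<bar>\<omega>\<bar>)) M u"
    and X: "\<And>\<tau>. X \<tau> $ 3 > 0"
  shows "autocorrelation M (recorded_signal u T X) \<tau> s = f / (8 * pi\<^sup>2) *
    (regularized_kernel \<epsilon> ((norm (X (\<tau> + s / 2) - X (\<tau> - s / 2)) / c)\<^sup>2) (T (\<tau> + s / 2) - T (\<tau> - s / 2)) -
     regularized_kernel \<epsilon> ((norm (mirror_image (X (\<tau> + s / 2)) - X (\<tau> - s / 2)) / c)\<^sup>2) (T (\<tau> + s / 2) - T (\<tau> - s / 2)))"
proof -
  let ?x = "X (\<tau> + s / 2)" and ?x' = "X (\<tau> - s / 2)" and ?t = "T (\<tau> + s / 2)" and ?t' = "T (\<tau> - s / 2)"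
  define \<rho>0 \<rho>1 \<Delta> where "\<rho>0 = norm (?x - ?x') / c" and "\<rho>1 = norm (mirror_image ?x - ?x') / c" and "\<Delta> = ?t - ?t'"
  let ?I = "\<lambda>\<rho> \<omega>. complex_of_real (\<bar>\<omega>\<bar> * exp (- \<epsilon> * \<bar>\<omega>\<bar>) * sinc (\<omega> * \<rho>)) * exp (\<i> * \<omega> * \<Delta>)"
  have arg: "\<omega> / c * n = \<omega> * (n / c)" for \<omega> n by simp
  have "complex_of_real (autocorrelation M (recorded_signal u T X) \<tau> s) =
     1 / (8 * pi\<^sup>2) * (\<integral>\<omega>. complex_of_real (f * \<bar>\<omega>\<bar> * exp (- \<epsilon> * \<bar>\<omega>\<bar>) * (sinc (\<omega> / c * norm (?x - ?x'))
                       - sinc (\<omega> / c * norm (mirror_image ?x - ?x')))) * exp (\<i> * \<omega> * (?t - ?t')) \<partial>lborel)"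
  proof -
    have "\<forall>t x t' x'. x $ 3 > 0 \<longrightarrow> x' $ 3 > 0 \<longrightarrow>
        complex_of_real (prob_space.expectation M (\<lambda>w. u t x w * u t' x' w)) =
          1 / (8 * pi\<^sup>2) * (\<integral>\<omega>. complex_of_real (f * \<bar>\<omega>\<bar> * exp (- \<epsilon> * \<bar>\<omega>\<bar>) * (sinc (\<omega> / c * norm (x - x'))
                       - sinc (\<omega> / c * norm (mirror_image x - x')))) * exp (\<i> * \<omega> * (t - t')) \<partial>lborel)"
      using field unfolding mirror_noise_field_def by (elim conjE)
    from this[rule_format, OF X X] show ?thesis
      unfolding autocorrelation_def recorded_signal_def of_real_diff .
  qed
  also have "\<dots> = 1 / (8 * pi\<^sup>2) * (\<integral>\<omega>. of_real f * (?I \<rho>0 \<omega> - ?I \<rho>1 \<omega>) \<partial>lborel)"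
  proof -
    have "complex_of_real (f * \<bar>\<omega>\<bar> * exp (- \<epsilon> * \<bar>\<omega>\<bar>) * (sinc (\<omega> / c * norm (?x - ?x'))
           - sinc (\<omega> / c * norm (mirror_image ?x - ?x')))) * exp (\<i> * \<omega> * (?t - ?t'))
        = of_real f * (?I \<rho>0 \<omega> - ?I \<rho>1 \<omega>)" for \<omega>
    proof -
      have alg: "complex_of_real (f * a * b * (p - q)) * z = of_real f * (of_real (a * b * p) * z - of_real (a * b * q) * z)"
        for a b p q :: real and z :: complex by (simp add: algebra_simps)
      show ?thesis unfolding arg \<rho>0_def[symmetric] \<rho>1_def[symmetric] of_real_diff[symmetric] \<Delta>_def[symmetric] by (rule alg)
    qed
    then show ?thesis by (simp only:)
  qed
  also have "\<dots> = complex_of_real (1 / (8 * pi\<^sup>2)) * (complex_of_real f *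
      (complex_of_real (regularized_kernel \<epsilon> (\<rho>0\<^sup>2) \<Delta>) - complex_of_real (regularized_kernel \<epsilon> (\<rho>1\<^sup>2) \<Delta>)))"
    unfolding integral_mult_right_zero
    by (subst Bochner_Integration.integral_diff[OF power_spectrum_integrable[OF e] power_spectrum_integrable[OF e]])
       (simp only: power_spectrum_integral[OF e])
  also have "\<dots> = of_real (f / (8 * pi\<^sup>2) * (regularized_kernel \<epsilon> (\<rho>0\<^sup>2) \<Delta> - regularized_kernel \<epsilon> (\<rho>1\<^sup>2) \<Delta>))" by simp
  finally show ?thesis unfolding of_real_eq_iff \<rho>0_def \<rho>1_def \<Delta>_def .
qed

lemma norm_real3: "norm (x :: real^3) = sqrt ((x $ 1)\<^sup>2 + (x $ 2)\<^sup>2 + (x $ 3)\<^sup>2)"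
  by (simp add: norm_vec_def L2_set_def sum_3)

text \<open>
  Sum and difference formulas: the two instants have hyperbolic parameters \<open>\<eta> + s / k\<close> and
  \<open>\<eta> - s / k\<close>.
\<close>

lemma observer_geometry:
  fixes c \<xi> \<xi>o \<alpha> \<tau> s :: real
  assumes c: "c > 0" and \<xi>: "\<xi> > 0"
  defines "k \<equiv> 2 * \<xi> / c" and "\<eta> \<equiv> c * \<tau> / \<xi>" and "X \<equiv> observer_position c \<xi> \<xi>o \<alpha>"
  shows "observer_time c \<xi> (\<tau> + s / 2) - observer_time c \<xi> (\<tau> - s / 2) = k * cosh \<eta> * sinh (s / k)"
    and "(norm (X (\<tau> + s / 2) - X (\<tau> - s / 2)) / c)\<^sup>2 = (k * sinh \<eta> * sinh (s / k))\<^sup>2"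
    and "(norm (mirror_image (X (\<tau> + s / 2)) - X (\<tau> - s / 2)) / c)\<^sup>2 =
      k\<^sup>2 * ((sin \<alpha> * sinh \<eta> * sinh (s / k))\<^sup>2 + (\<xi>o / \<xi> + cos \<alpha> * cosh \<eta> * cosh (s / k))\<^sup>2)"
proof -
  define y where "y = s / k"
  have k: "k > 0" using c \<xi> by (simp add: k_def)
  have arg: "c * (\<tau> + s / 2) / \<xi> = \<eta> + y" "c * (\<tau> - s / 2) / \<xi> = \<eta> - y"
    using c \<xi> by (simp_all add: \<eta>_def y_def k_def field_simps)
  have ck: "c = 2 * \<xi> / k" using c \<xi> by (simp add: k_def)
  have X: "X (\<tau> + s / 2) $ 1 = \<xi> * cosh (\<eta> + y) * sin \<alpha>" "X (\<tau> + s / 2) $ 2 = 0" "X (\<tau> + s / 2) $ 3 = \<xi>o + \<xi> * cosh (\<eta> + y) * cos \<alpha>"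
    "X (\<tau> - s / 2) $ 1 = \<xi> * cosh (\<eta> - y) * sin \<alpha>" "X (\<tau> - s / 2) $ 2 = 0" "X (\<tau> - s / 2) $ 3 = \<xi>o + \<xi> * cosh (\<eta> - y) * cos \<alpha>"
    unfolding X_def observer_position_def arg by simp_all
  have d: "cosh (\<eta> + y) - cosh (\<eta> - y) = 2 * sinh \<eta> * sinh y" and p: "cosh (\<eta> + y) + cosh (\<eta> - y) = 2 * cosh \<eta> * cosh y"
    by (simp_all add: cosh_add cosh_diff)
  show "observer_time c \<xi> (\<tau> + s / 2) - observer_time c \<xi> (\<tau> - s / 2) = k * cosh \<eta> * sinh (s / k)"
    unfolding observer_time_def arg y_def[symmetric] by (simp add: k_def sinh_add sinh_diff algebra_simps)
  have "(norm (X (\<tau> + s / 2) - X (\<tau> - s / 2)))\<^sup>2 = (\<xi> * sin \<alpha> * (cosh (\<eta> + y) - cosh (\<eta> - y)))\<^sup>2 + (\<xi> * cos \<alpha> * (cosh (\<eta> + y) - cosh (\<eta> - y)))\<^sup>2"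
    unfolding norm_real3 by (simp add: X algebra_simps)
  also have "\<dots> = ((\<xi> * sin \<alpha>)\<^sup>2 + (\<xi> * cos \<alpha>)\<^sup>2) * (2 * sinh \<eta> * sinh y)\<^sup>2"
    unfolding d power_mult_distrib[of _ "2 * sinh \<eta> * sinh y"] by (simp only: distrib_right)
  also have "(\<xi> * sin \<alpha>)\<^sup>2 + (\<xi> * cos \<alpha>)\<^sup>2 = \<xi>\<^sup>2"
    unfolding power_mult_distrib distrib_left[symmetric] by simp
  finally show "(norm (X (\<tau> + s / 2) - X (\<tau> - s / 2)) / c)\<^sup>2 = (k * sinh \<eta> * sinh (s / k))\<^sup>2"
    unfolding power_divide y_def[symmetric] by (simp add: k_def power_mult_distrib power_divide)
  have "(norm (mirror_image (X (\<tau> + s / 2)) - X (\<tau> - s / 2)))\<^sup>2 =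
     (\<xi> * sin \<alpha> * (cosh (\<eta> + y) - cosh (\<eta> - y)))\<^sup>2 + (2 * \<xi>o + \<xi> * cos \<alpha> * (cosh (\<eta> + y) + cosh (\<eta> - y)))\<^sup>2"
    unfolding norm_real3 mirror_image_def
    by (simp add: X) (simp add: power2_eq_square algebra_simps)
  also have "\<dots> = (2 * \<xi>)\<^sup>2 * ((sin \<alpha> * sinh \<eta> * sinh y)\<^sup>2 + (\<xi>o / \<xi> + cos \<alpha> * cosh \<eta> * cosh y)\<^sup>2)"
  proof -
    have "\<xi> * sin \<alpha> * (2 * sinh \<eta> * sinh y) = 2 * \<xi> * (sin \<alpha> * sinh \<eta> * sinh y)"
      "2 * \<xi>o + \<xi> * cos \<alpha> * (2 * cosh \<eta> * cosh y) = 2 * \<xi> * (\<xi>o / \<xi> + cos \<alpha> * cosh \<eta> * cosh y)"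
      using \<xi> by (simp_all add: field_simps)
    then show ?thesis
      unfolding d p by (simp only: power_mult_distrib[of "2 * \<xi>"] distrib_left[of "(2 * \<xi>)\<^sup>2"])
  qed
  finally show "(norm (mirror_image (X (\<tau> + s / 2)) - X (\<tau> - s / 2)) / c)\<^sup>2 =
      k\<^sup>2 * ((sin \<alpha> * sinh \<eta> * sinh (s / k))\<^sup>2 + (\<xi>o / \<xi> + cos \<alpha> * cosh \<eta> * cosh (s / k))\<^sup>2)"
    unfolding power_divide y_def[symmetric] by (simp add: k_def power_divide)
qed

lemma mirror_quadratic:
  fixes \<alpha> \<alpha>o \<eta> y :: real
  shows "(sin \<alpha> * sinh \<eta> * sinh y)\<^sup>2 + (\<alpha>o + cos \<alpha> * cosh \<eta> * cosh y)\<^sup>2 - (cosh \<eta> * sinh y)\<^sup>2 =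
    - (coeff_A \<alpha> * (cosh y)\<^sup>2 + coeff_B \<alpha> \<alpha>o \<eta> * cosh y + coeff_C \<alpha> \<alpha>o \<eta>)"
proof -
  have "(sin \<alpha>)\<^sup>2 = 1 - (cos \<alpha>)\<^sup>2" "(sinh \<eta>)\<^sup>2 = (cosh \<eta>)\<^sup>2 - 1" "(sinh y)\<^sup>2 = (cosh y)\<^sup>2 - 1"
    by (simp_all add: sin_squared_eq sinh_square_eq)
  then show ?thesis
    unfolding coeff_A_def coeff_B_def coeff_C_def power_mult_distrib
    by (simp add: power_mult_distrib power2_sum) (simp add: algebra_simps power2_eq_square)
qed

lemma direct_spectrum:
  fixes k \<omega> :: real
  assumes k: "k > 0" and \<omega>: "\<omega> \<noteq> 0"
  shows "(\<integral>s. (4 / k) *\<^sub>R complex_of_real ((cosh s - cos (\<omega> * k * s)) / (sinh s)\<^sup>2) \<partial>half_line) =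
    of_real (2 * pi * \<omega> * (cosh (pi * (\<omega> * k / 2)) / sinh (pi * (\<omega> * k / 2))))"
proof -
  have "\<omega> * k \<noteq> 0" using assms by simp
  note I = integral_cosh_minus_cos_over_sinh_squared[OF this]
  have "(\<integral>s. (4 / k) *\<^sub>R complex_of_real ((cosh s - cos (\<omega> * k * s)) / (sinh s)\<^sup>2) \<partial>half_line)
     = of_real ((4 / k) * (\<integral>s. (cosh s - cos (\<omega> * k * s)) / (sinh s)\<^sup>2 \<partial>half_line))"
    unfolding integral_scaleR_right integral_complex_of_real unfolding scaleR_conv_of_real of_real_mult ..
  also have "(4 / k) * (\<integral>s. (cosh s - cos (\<omega> * k * s)) / (sinh s)\<^sup>2 \<partial>half_line) =
      2 * pi * \<omega> * (cosh (pi * (\<omega> * k) / 2) / sinh (pi * (\<omega> * k) / 2))"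
    unfolding I using k by simp
  finally show ?thesis by simp
qed

lemma pv_cosine_combination:
  assumes "a > 0"
    and i1: "integrable half_line (\<lambda>t. \<kappa>1 (a + t) * cos (\<mu> * (a + t)) + (if t \<le> a then \<kappa>1 (a - t) * cos (\<mu> * (a - t)) else 0))"
    and i2: "integrable half_line (\<lambda>t. \<kappa>2 (a + t) * cos (\<mu> * (a + t)) + (if t \<le> a then \<kappa>2 (a - t) * cos (\<mu> * (a - t)) else 0))"
    and eq: "\<And>s. cosh s \<noteq> cosh a \<Longrightarrow> \<kappa> s = p * \<kappa>1 s + r * \<kappa>2 s"
  shows "pv_cosine \<kappa> a \<mu> = p * pv_cosine \<kappa>1 a \<mu> + r * pv_cosine \<kappa>2 a \<mu>"
proof -
  have "pv_cosine \<kappa> a \<mu> = (\<integral>t. p * (\<kappa>1 (a + t) * cos (\<mu> * (a + t)) + (if t \<le> a then \<kappa>1 (a - t) * cos (\<mu> * (a - t)) else 0))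
     + r * (\<kappa>2 (a + t) * cos (\<mu> * (a + t)) + (if t \<le> a then \<kappa>2 (a - t) * cos (\<mu> * (a - t)) else 0)) \<partial>half_line)"
    unfolding pv_cosine_def
  proof (rule half_line_cong)
    fix t :: real assume t: "t > 0"
    have 1: "cosh (a + t) \<noteq> cosh a" using t assms(1) cosh_real_nonneg_less_iff[of a "a + t"] by auto
    have 2: "cosh (a - t) \<noteq> cosh a" if "t \<le> a" using t that cosh_real_nonneg_less_iff[of "a - t" a] by auto
    show "\<kappa> (a + t) * cos (\<mu> * (a + t)) + (if t \<le> a then \<kappa> (a - t) * cos (\<mu> * (a - t)) else 0) =
      p * (\<kappa>1 (a + t) * cos (\<mu> * (a + t)) + (if t \<le> a then \<kappa>1 (a - t) * cos (\<mu> * (a - t)) else 0))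
     + r * (\<kappa>2 (a + t) * cos (\<mu> * (a + t)) + (if t \<le> a then \<kappa>2 (a - t) * cos (\<mu> * (a - t)) else 0))"
      using eq[OF 1] eq[OF 2] by (cases "t \<le> a") (simp_all add: algebra_simps)
  qed
  then show ?thesis unfolding pv_cosine_def using i1 i2 by simp
qed

text \<open>
  The zeros of \<open>P\<close> on \<open>[1, \<infinity>)\<close> decide. If \<open>\<alpha> \<noteq> 0\<close>, there is one, \<open>C_plus > 1\<close>, and partial fractions
  split off the root \<open>C_minus \<le> - 1\<close>. If \<open>\<alpha> = 0\<close>, then \<open>P\<close> is affine: its zero exceeds \<open>1\<close> for
  \<open>\<alpha>\<^sub>o < 0\<close>, is at most \<open>- 1\<close> for \<open>\<alpha>\<^sub>o > 0\<close>, and \<open>P\<close> is constant for \<open>\<alpha>\<^sub>o = 0\<close>.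
\<close>

lemma mirror_spectral_limit:
  fixes \<alpha> \<alpha>o \<eta> k :: real
  assumes k: "k > 0" and \<alpha>: "\<alpha> \<in> {- pi / 2<..<pi / 2}" and \<alpha>o: "\<alpha>o > - cos \<alpha>"
  defines "r \<equiv> \<lambda>y. k\<^sup>2 * ((sin \<alpha> * sinh \<eta> * sinh y)\<^sup>2 + (\<alpha>o + cos \<alpha> * cosh \<eta> * cosh y)\<^sup>2)"
    and "d \<equiv> \<lambda>y. k * cosh \<eta> * sinh y"
  obtains h m where
    "spectral_limit (\<lambda>\<epsilon> \<tau>. regularized_kernel \<epsilon> (r (\<tau> / k)) (d (\<tau> / k))) h m"
    "m = 0 \<or> \<alpha> = 0 \<and> \<alpha>o = 0"
    "\<And>\<omega>. \<omega> \<noteq> 0 \<Longrightarrow> h \<omega> = of_real (2 * pi * \<omega> * (cosh (pi * (\<omega> * k / 2)) / sinh (pi * (\<omega> * k / 2))) *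
       R_corr \<alpha> \<alpha>o \<eta> (\<omega> * k / 2))"
proof -
  let ?P = "\<lambda>x. coeff_A \<alpha> * x\<^sup>2 + coeff_B \<alpha> \<alpha>o \<eta> * x + coeff_C \<alpha> \<alpha>o \<eta>"
  have cos: "cos \<alpha> > 0" using \<alpha> by (intro cos_gt_zero_pi) auto
  have rd: "r y - (d y)\<^sup>2 = - (k\<^sup>2 * ?P (cosh y))" for y
  proof -
    have "r y - (d y)\<^sup>2 = k\<^sup>2 * ((sin \<alpha> * sinh \<eta> * sinh y)\<^sup>2 + (\<alpha>o + cos \<alpha> * cosh \<eta> * cosh y)\<^sup>2 - (cosh \<eta> * sinh y)\<^sup>2)"
      unfolding r_def d_def mult.assoc[of k] power_mult_distrib[of k] right_diff_distrib ..
    then show ?thesis unfolding mirror_quadratic by (simp only: mult_minus_right)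
  qed
  have r0: "r y \<ge> 0" for y unfolding r_def by (intro mult_nonneg_nonneg add_nonneg_nonneg) auto
  have meas: "r \<in> borel_measurable borel" "d \<in> borel_measurable borel" unfolding r_def d_def by measurable
  have tanh_inv: "cosh y / sinh y * (tanh y * z) = z" if "y \<noteq> 0" for y z :: real
    using that by (simp add: tanh_def)
  show thesis
  proof (cases "\<alpha> = 0")
    case False
    have sin: "sin \<alpha> \<noteq> 0" using False \<alpha> by (subst sin_zero_pi_iff) auto
    define A where "A = coeff_A \<alpha>"
    define p where "p = C_plus \<alpha> \<alpha>o \<eta>"
    define n where "n = C_minus \<alpha> \<alpha>o \<eta>"
    define s where "s = sqrt (discr \<alpha> \<alpha>o \<eta>)"
    have A: "A > 0" unfolding A_def by (rule coeff_A_pos[OF cos \<alpha>o sin])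
    have p: "p > 1" and n: "n \<le> - 1" unfolding p_def n_def by (rule C_bounds[OF cos \<alpha>o sin])+
    have s: "s > 0" "A * (p - n) = s" unfolding s_def A_def p_def n_def using discr_pos[OF cos \<alpha>o sin] C_plus_minus_C_minus[OF cos \<alpha>o sin] by auto
    define a where "a = arcosh p"
    define b where "b = arcosh \<bar>n\<bar>"
    have a: "a > 0" "cosh a = p" using p by (auto simp: a_def)
    have b: "b \<ge> 0" "cosh b = - n" using n by (auto simp: b_def)
    have sa: "sinh a > 0" using a by simp
    have P: "?P (cosh y) = (cosh y - cosh a) * (A * cosh y + - (A * n))" for y
      unfolding quadratic_factored[OF cos \<alpha>o sin] a(2) A_def p_def n_def by (simp add: algebra_simps)
    have q: "- (k\<^sup>2 * ((cosh y - cosh a) * (A * cosh y + - (A * n)))) + (k * cosh \<eta> * sinh y)\<^sup>2 = r y" for y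
      using rd[of y] unfolding P d_def by simp
    let ?\<kappa> = "\<lambda>y. 2 / - (k\<^sup>2 * ((cosh y - cosh a) * (A * cosh y + - (A * n))))"
    have lim: "spectral_limit (\<lambda>\<epsilon> \<tau>. regularized_kernel \<epsilon> (r (\<tau> / k)) (d (\<tau> / k)))
      (\<lambda>\<omega>. of_real (2 * k * pv_cosine ?\<kappa> a (\<omega> * k))) 0"
      using singular_spectral_limit[of k a "cosh \<eta>" A "- (A * n)"] k a(1) A n r0 unfolding q d_def
      by (simp add: mult_pos_neg algebra_simps)
    have val: "complex_of_real (2 * k * pv_cosine ?\<kappa> a (\<omega> * k)) = of_real (2 * pi * \<omega> * (cosh (pi * (\<omega> * k / 2)) / sinh (pi * (\<omega> * k / 2))) *
       R_corr \<alpha> \<alpha>o \<eta> (\<omega> * k / 2))" if \<omega>: "\<omega> \<noteq> 0" for \<omega>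
    proof -
      define \<nu> where "\<nu> = \<omega> * k / 2"
      have \<nu>: "\<nu> \<noteq> 0" "\<omega> * k = 2 * \<nu>" "2 * \<nu> \<noteq> 0" using \<omega> k by (auto simp: \<nu>_def)
      have eq: "?\<kappa> y = (- 1 / (k\<^sup>2 * s * sinh a)) * (2 * sinh a / (cosh y - cosh a)) + (2 / (k\<^sup>2 * s)) * (1 / (cosh y + cosh b))"
        if "cosh y \<noteq> cosh a" for y
      proof -
        define x where "x = cosh y"
        have nz: "x - p \<noteq> 0" "x - n \<noteq> 0" "p - n \<noteq> 0" using that a(2) n p cosh_real_ge_1[of y] by (auto simp: x_def)
        have "1 / ((x - p) * (A * x + - (A * n))) = (1 / s) * (1 / (x - p) - 1 / (x - n))"
          unfolding s(2)[symmetric] using nz A by (simp add: divide_simps) (simp add: algebra_simps)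
        moreover have "2 / - (k\<^sup>2 * Z) = - (2 / k\<^sup>2) * (1 / Z)" for Z by simp
        moreover have "(- 1 / (k\<^sup>2 * s * sinh a)) * (2 * sinh a / v) = - (2 / k\<^sup>2) * ((1 / s) * (1 / v))" for v
          using sa by simp
        moreover have "(2 / (k\<^sup>2 * s)) * (1 / (x + - n)) = (2 / k\<^sup>2) * ((1 / s) * (1 / (x - n)))" by simp
        moreover have "- c * (v * (u - w)) = - c * (v * u) + c * (v * w)" for c v u w :: real
          by (simp add: algebra_simps)
        ultimately show ?thesis unfolding a(2) b(2) x_def[symmetric] by (simp only:)
      qed
      have "pv_cosine ?\<kappa> a (2 * \<nu>) = (- 1 / (k\<^sup>2 * s * sinh a)) * pv_cosine (\<lambda>y. 2 * sinh a / (cosh y - cosh a)) a (2 * \<nu>)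
          + (2 / (k\<^sup>2 * s)) * pv_cosine (\<lambda>y. 1 / (cosh y + cosh b)) a (2 * \<nu>)"
        by (rule pv_cosine_combination[OF a(1) pv_cosine_cosh_diff(1)[OF a(1) \<nu>(3)] pv_cosine_cosh_sum(3)[OF a(1) \<nu>(3)] eq])
      also have "\<dots> = (2 * pi / (k\<^sup>2 * s)) * (sin_over_sinh (2 * \<nu>) a * (cosh (2 * pi * \<nu>) / sinh (2 * pi * \<nu>)) + sin_over_sinh (2 * \<nu>) b / sinh (2 * pi * \<nu>))"
        unfolding pv_cosine_cosh_diff(2)[OF a(1) \<nu>(3)] pv_cosine_cosh_sum(2)[OF a(1) \<nu>(3)] integral_cos_over_cosh_sum[OF b(1) \<nu>(3)]
        unfolding sin_over_sinh_def[symmetric]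
        using a(1) by (simp add: sin_over_sinh_def[of _ a] distrib_left mult_ac)
      finally have "2 * k * pv_cosine ?\<kappa> a (2 * \<nu>) = (4 * pi / (k * s)) * (sin_over_sinh (2 * \<nu>) a * (cosh (2 * pi * \<nu>) / sinh (2 * pi * \<nu>)) + sin_over_sinh (2 * \<nu>) b / sinh (2 * pi * \<nu>))"
        using k by (simp add: power2_eq_square)
      also have "\<dots> = 2 * pi * \<omega> * (cosh (pi * \<nu>) / sinh (pi * \<nu>) * (tanh (pi * \<nu>) * (1 / (\<nu> * s) *
          (sin_over_sinh (2 * \<nu>) a * (cosh (2 * pi * \<nu>) / sinh (2 * pi * \<nu>)) + sin_over_sinh (2 * \<nu>) b / sinh (2 * pi * \<nu>)))))"
        using \<nu>(1) k \<omega> by (subst tanh_inv) (simp_all add: \<nu>_def)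
      also have "\<dots> = 2 * pi * \<omega> * (cosh (pi * \<nu>) / sinh (pi * \<nu>)) * R_corr \<alpha> \<alpha>o \<eta> \<nu>"
        using False unfolding R_corr_def if_P[OF False] R_oblique_eq[OF cos \<alpha>o sin \<nu>(1)]
          p_def[symmetric] n_def[symmetric] s_def[symmetric] a_def[symmetric] b_def[symmetric]
          tanh_def[of "2 * pi * \<nu>"]
        by (simp add: distrib_left add_divide_distrib mult_ac)
      finally show ?thesis unfolding \<nu>_def[symmetric] unfolding \<nu>(2) by (simp only:)
    qed
    show thesis by (rule that[OF lim]) (use val in auto)
  next
    case True
    have c1: "cos \<alpha> = 1" "coeff_A \<alpha> = 0" using True by (auto simp: coeff_A_def)
    have al1: "\<alpha>o > - 1" using \<alpha>o c1 by simp
    define B where "B = \<bar>coeff_B 0 \<alpha>o \<eta>\<bar>"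
    define x0 where "x0 = \<bar>coeff_C 0 \<alpha>o \<eta> / coeff_B 0 \<alpha>o \<eta>\<bar>"
    consider "\<alpha>o = 0" | "\<alpha>o < 0" | "\<alpha>o > 0" by linarith
    then show thesis
    proof cases
      case 1
      have q: "r y - (d y)\<^sup>2 = k\<^sup>2 * (1 + (sinh \<eta>)\<^sup>2)" for y
        unfolding rd using True 1 by (simp add: coeff_A_def coeff_B_def coeff_C_def algebra_simps)
      have "1 + (sinh \<eta>)\<^sup>2 > 0" by (simp add: add_pos_nonneg)
      then have q0: "k\<^sup>2 * (1 + (sinh \<eta>)\<^sup>2) \<noteq> 0" using k by simp
      have lim: "spectral_limit (\<lambda>\<epsilon> \<tau>. regularized_kernel \<epsilon> (r (\<tau> / k)) (d (\<tau> / k))) (\<lambda>\<omega>. 0) (of_real (4 * pi / (k\<^sup>2 * (1 + (sinh \<eta>)\<^sup>2))))"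
        by (rule constant_spectral_limit[OF _ _ r0 q q0]) (use meas in measurable)
      have "R_corr \<alpha> \<alpha>o \<eta> \<nu> = 0" if "\<nu> \<noteq> 0" for \<nu>
        using that True 1 by (simp add: R_corr_def R_normal_def extend_by_continuity_def coeff_B_def)
      then show thesis using True 1 k by (intro that[OF lim]) auto
    next
      case 2
      then have al0: "\<alpha>o \<noteq> 0" by simp
      note N = normal_ratio[OF al0, of \<eta>, folded B_def x0_def]
      have B: "B > 0" "coeff_B 0 \<alpha>o \<eta> = B" using N(1) 2 by (auto simp: B_def coeff_B_def mult_neg_pos abs_mult)
      have "x0 \<noteq> 1" using N(3) al1 2 cosh_real_ge_1[of \<eta>] by auto
      then have x0: "x0 > 1" using N(2) by simp
      define a where "a = arcosh x0"
      have a: "a > 0" "cosh a = x0" using x0 by (auto simp: a_def)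
      have sa: "sinh a > 0" using a by simp
      have P: "?P (cosh y) = (cosh y - cosh a) * (0 * cosh y + B)" for y
        using True N(5) B(2) unfolding c1(2) a(2) by (simp add: algebra_simps)
      have q: "- (k\<^sup>2 * ((cosh y - cosh a) * (0 * cosh y + B))) + (k * cosh \<eta> * sinh y)\<^sup>2 = r y" for y
        using rd[of y] unfolding P d_def by simp
      let ?\<kappa> = "\<lambda>y. 2 / - (k\<^sup>2 * ((cosh y - cosh a) * (0 * cosh y + B)))"
      have lim: "spectral_limit (\<lambda>\<epsilon> \<tau>. regularized_kernel \<epsilon> (r (\<tau> / k)) (d (\<tau> / k)))
        (\<lambda>\<omega>. of_real (2 * k * pv_cosine ?\<kappa> a (\<omega> * k))) 0"
        using singular_spectral_limit[of k a "cosh \<eta>" 0 B] k a(1) B(1) r0 unfolding q d_def by simp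
      have val: "complex_of_real (2 * k * pv_cosine ?\<kappa> a (\<omega> * k)) = of_real (2 * pi * \<omega> * (cosh (pi * (\<omega> * k / 2)) / sinh (pi * (\<omega> * k / 2))) *
         R_corr \<alpha> \<alpha>o \<eta> (\<omega> * k / 2))" if \<omega>: "\<omega> \<noteq> 0" for \<omega>
      proof -
        define \<nu> where "\<nu> = \<omega> * k / 2"
        have \<nu>: "\<nu> \<noteq> 0" "\<omega> * k = 2 * \<nu>" "2 * \<nu> \<noteq> 0" using \<omega> k by (auto simp: \<nu>_def)
        have "?\<kappa> y = (- 1 / (k\<^sup>2 * B * sinh a)) * (2 * sinh a / (cosh y - cosh a))" for y
          using sa by simp
        then have "pv_cosine ?\<kappa> a (2 * \<nu>) = (- 1 / (k\<^sup>2 * B * sinh a)) * pv_cosine (\<lambda>y. 2 * sinh a / (cosh y - cosh a)) a (2 * \<nu>)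
          + 0 * pv_cosine (\<lambda>y. 2 * sinh a / (cosh y - cosh a)) a (2 * \<nu>)"
          by (intro pv_cosine_combination[OF a(1) pv_cosine_cosh_diff(1)[OF a(1) \<nu>(3)] pv_cosine_cosh_diff(1)[OF a(1) \<nu>(3)]]) simp
        also have "\<dots> = (2 * pi / (k\<^sup>2 * B)) * (sin_over_sinh (2 * \<nu>) a * (cosh (2 * pi * \<nu>) / sinh (2 * pi * \<nu>)))"
          unfolding pv_cosine_cosh_diff(2)[OF a(1) \<nu>(3)] using a(1) by (simp add: sin_over_sinh_def mult_ac)
        finally have "2 * k * pv_cosine ?\<kappa> a (2 * \<nu>) = (4 * pi / (k * B)) * (sin_over_sinh (2 * \<nu>) a * (cosh (2 * pi * \<nu>) / sinh (2 * pi * \<nu>)))"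
          using k by (simp add: power2_eq_square)
        also have "\<dots> = 2 * pi * \<omega> * (cosh (pi * \<nu>) / sinh (pi * \<nu>) * (tanh (pi * \<nu>) * (1 / (\<nu> * B) *
          (sin_over_sinh (2 * \<nu>) a * (cosh (2 * pi * \<nu>) / sinh (2 * pi * \<nu>))))))"
          using \<nu>(1) k \<omega> by (subst tanh_inv) (simp_all add: \<nu>_def)
        also have "\<dots> = 2 * pi * \<omega> * (cosh (pi * \<nu>) / sinh (pi * \<nu>)) * R_corr \<alpha> \<alpha>o \<eta> \<nu>"
          using True 2 unfolding R_corr_def R_normal_eq[OF \<nu>(1) al1 al0] B_def[symmetric] x0_def[symmetric] a_def[symmetric]
            tanh_def[of "2 * pi * \<nu>"]
          by (simp add: mult_ac)
        finally show ?thesis unfolding \<nu>_def[symmetric] unfolding \<nu>(2) by (simp only:)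
      qed
      show thesis by (rule that[OF lim]) (use val in auto)
    next
      case 3
      then have al0: "\<alpha>o \<noteq> 0" by simp
      note N = normal_ratio[OF al0, of \<eta>, folded B_def x0_def]
      have B: "B > 0" "coeff_B 0 \<alpha>o \<eta> = - B" using N(1) 3 by (auto simp: B_def coeff_B_def abs_mult)
      define b where "b = arcosh x0"
      have b: "b \<ge> 0" "cosh b = x0" using N(2) by (auto simp: b_def)
      have q: "r y - (d y)\<^sup>2 = k\<^sup>2 * B * (cosh y + cosh b)" for y
        unfolding rd using True N(5) B(2) by (simp add: c1 b(2) algebra_simps coeff_A_def)
      have lower: "k\<^sup>2 * B / 2 * exp y \<le> \<bar>r y - (d y)\<^sup>2\<bar>" for y
      proof -
        have "exp y / 2 \<le> cosh y + cosh b" using cosh_real_pos[of b] by (simp add: cosh_def[of y] add_increasing2)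
        then have "k\<^sup>2 * B * (exp y / 2) \<le> k\<^sup>2 * B * (cosh y + cosh b)" using B by (intro mult_left_mono) auto
        then show ?thesis unfolding q by simp
      qed
      have lim: "spectral_limit (\<lambda>\<epsilon> \<tau>. regularized_kernel \<epsilon> (r (\<tau> / k)) (d (\<tau> / k)))
        (\<lambda>\<omega>. of_real (2 * k * (\<integral>s. 2 / (r s - (d s)\<^sup>2) * cos (\<omega> * k * s) \<partial>half_line))) 0"
      proof (rule regular_spectral_limit[OF k _ meas r0 _ _ lower])
        show "k\<^sup>2 * B / 2 > 0" using k B by simp
        show "r (- s) = r s" "(d (- s))\<^sup>2 = (d s)\<^sup>2" for s by (simp_all add: r_def d_def)
      qed
      have val: "complex_of_real (2 * k * (\<integral>s. 2 / (r s - (d s)\<^sup>2) * cos (\<omega> * k * s) \<partial>half_line)) = of_real (2 * pi * \<omega> * (cosh (pi * (\<omega> * k / 2)) / sinh (pi * (\<omega> * k / 2))) *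
         R_corr \<alpha> \<alpha>o \<eta> (\<omega> * k / 2))" if \<omega>: "\<omega> \<noteq> 0" for \<omega>
      proof -
        define \<nu> where "\<nu> = \<omega> * k / 2"
        have \<nu>: "\<nu> \<noteq> 0" "\<omega> * k = 2 * \<nu>" "2 * \<nu> \<noteq> 0" using \<omega> k by (auto simp: \<nu>_def)
        have "2 / (r s - (d s)\<^sup>2) * cos (2 * \<nu> * s) = (2 / (k\<^sup>2 * B)) * (cos (2 * \<nu> * s) / (cosh s + cosh b))" for s
          unfolding q by simp
        then have "(\<integral>s. 2 / (r s - (d s)\<^sup>2) * cos (2 * \<nu> * s) \<partial>half_line) = (2 / (k\<^sup>2 * B)) * (\<integral>s. cos (2 * \<nu> * s) / (cosh s + cosh b) \<partial>half_line)"
          by (simp only: integral_mult_right_zero)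
        also have "\<dots> = (2 * pi / (k\<^sup>2 * B)) * (sin_over_sinh (2 * \<nu>) b / sinh (2 * pi * \<nu>))"
          unfolding integral_cos_over_cosh_sum[OF b(1) \<nu>(3)] sin_over_sinh_def[symmetric] by (simp add: mult_ac)
        finally have "2 * k * (\<integral>s. 2 / (r s - (d s)\<^sup>2) * cos (2 * \<nu> * s) \<partial>half_line) = (4 * pi / (k * B)) * (sin_over_sinh (2 * \<nu>) b / sinh (2 * pi * \<nu>))"
          using k by (simp add: power2_eq_square)
        also have "\<dots> = 2 * pi * \<omega> * (cosh (pi * \<nu>) / sinh (pi * \<nu>) * (tanh (pi * \<nu>) * (1 / (\<nu> * B) *
          (sin_over_sinh (2 * \<nu>) b / sinh (2 * pi * \<nu>)))))"
          using \<nu>(1) k \<omega> by (subst tanh_inv) (simp_all add: \<nu>_def)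
        also have "\<dots> = 2 * pi * \<omega> * (cosh (pi * \<nu>) / sinh (pi * \<nu>)) * R_corr \<alpha> \<alpha>o \<eta> \<nu>"
          using True 3 unfolding R_corr_def R_normal_eq[OF \<nu>(1) al1 al0] B_def[symmetric] x0_def[symmetric] b_def[symmetric]
          by (simp add: mult_ac)
        finally show ?thesis unfolding \<nu>_def[symmetric] unfolding \<nu>(2) by (simp only:)
      qed
      show thesis by (rule that[OF lim]) (use val in auto)
    qed
  qed
qed

lemma W\<^sub>o_coth:
  assumes "c > 0" "\<xi> > 0" "\<omega> \<noteq> 0"
  shows "W\<^sub>o c f \<xi> \<omega> = f * \<omega> / (4 * pi) * (cosh (pi * (\<xi> * \<omega> / c)) / sinh (pi * (\<xi> * \<omega> / c)))"
proof -
  define y where "y = pi * \<xi> * \<bar>\<omega>\<bar> / c"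
  have y: "y > 0" using assms by (simp add: y_def)
  have e: "exp (2 * y) = exp y * exp y" by (simp flip: exp_add)
  have "exp (2 * y) \<noteq> 1" using y by simp
  with e have "1 + 2 / (exp (2 * y) - 1) = cosh y / sinh y"
    using y by (simp add: cosh_def sinh_def exp_minus divide_simps)
  then have "W\<^sub>o c f \<xi> \<omega> = f * \<bar>\<omega>\<bar> / (4 * pi) * (cosh y / sinh y)"
    using assms(3) unfolding W\<^sub>o_def extend_by_continuity_def by (simp add: y_def mult.assoc)
  also have "\<dots> = f * \<omega> / (4 * pi) * (cosh (pi * (\<xi> * \<omega> / c)) / sinh (pi * (\<xi> * \<omega> / c)))"
    by (cases "\<omega> > 0") (simp_all add: y_def mult.assoc)
  finally show ?thesis .
qed

theorem proposition7:
  fixes c\<^sub>o f\<^sub>o \<xi> \<alpha> \<xi>\<^sub>o :: real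
    and M :: "real \<Rightarrow> 'w measure"
    and u :: "real \<Rightarrow> real \<Rightarrow> real^3 \<Rightarrow> 'w \<Rightarrow> real"
  assumes "c\<^sub>o > 0" and "f\<^sub>o > 0" and "\<xi> > 0"
    and "\<alpha> \<in> {- pi / 2<..<pi / 2}"
    and "\<xi>\<^sub>o > - \<xi> * cos \<alpha>"
    and "\<And>\<epsilon>. \<epsilon> > 0 \<Longrightarrow>
           mirror_noise_field c\<^sub>o (\<lambda>\<omega>. f\<^sub>o * \<bar>\<omega>\<bar> * exp (- \<epsilon> * \<bar>\<omega>\<bar>)) (M \<epsilon>) (u \<epsilon>)"
  shows "\<forall>\<tau>. \<exists>W.
           is_wigner_transform M
             (\<lambda>\<epsilon>. recorded_signal (u \<epsilon>) (observer_time c\<^sub>o \<xi>) (observer_position c\<^sub>o \<xi> \<xi>\<^sub>o \<alpha>)) \<tau> W \<and>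
           equals_function_on W
             (\<lambda>\<omega>. W\<^sub>o c\<^sub>o f\<^sub>o \<xi> \<omega> * (1 - R_corr \<alpha> (\<xi>\<^sub>o / \<xi>) (c\<^sub>o * \<tau> / \<xi>) (\<xi> * \<omega> / c\<^sub>o)))
             (if \<alpha> = 0 \<and> \<xi>\<^sub>o / \<xi> = 0 then - {0} else UNIV)"
proof
  fix \<tau> :: real
  define k \<eta> \<alpha>o where "k = 2 * \<xi> / c\<^sub>o" and "\<eta> = c\<^sub>o * \<tau> / \<xi>" and "\<alpha>o = \<xi>\<^sub>o / \<xi>"
  have k: "k > 0" using assms(1,3) by (simp add: k_def)
  have \<alpha>o: "\<alpha>o > - cos \<alpha>" using assms(3,5) by (simp add: \<alpha>o_def pos_less_divide_eq mult.commute)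
  have cos: "cos \<alpha> > 0" using assms(4) by (intro cos_gt_zero_pi) auto
  have X: "observer_position c\<^sub>o \<xi> \<xi>\<^sub>o \<alpha> t $ 3 > 0" for t
  proof -
    have "\<xi> * cos \<alpha> * 1 \<le> \<xi> * cos \<alpha> * cosh (c\<^sub>o * t / \<xi>)"
      using assms(3) cos by (intro mult_left_mono cosh_real_ge_1) auto
    then show ?thesis using assms(5) by (simp add: observer_position_def mult_ac)
  qed
  let ?r0 = "\<lambda>y. (k * sinh \<eta> * sinh y)\<^sup>2" and ?d = "\<lambda>y. k * cosh \<eta> * sinh y"
  let ?r1 = "\<lambda>y. k\<^sup>2 * ((sin \<alpha> * sinh \<eta> * sinh y)\<^sup>2 + (\<alpha>o + cos \<alpha> * cosh \<eta> * cosh y)\<^sup>2)"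
  obtain h m where
    lim1: "spectral_limit (\<lambda>\<epsilon> s. regularized_kernel \<epsilon> (?r1 (s / k)) (?d (s / k))) h m"
    and m: "m = 0 \<or> \<alpha> = 0 \<and> \<alpha>o = 0"
    and h: "\<And>\<omega>. \<omega> \<noteq> 0 \<Longrightarrow> h \<omega> = of_real (2 * pi * \<omega> * (cosh (pi * (\<omega> * k / 2)) / sinh (pi * (\<omega> * k / 2))) *
       R_corr \<alpha> \<alpha>o \<eta> (\<omega> * k / 2))"
    using mirror_spectral_limit[OF k assms(4) \<alpha>o, of \<eta>] by blast
  let ?h0 = "\<lambda>\<omega>. \<integral>s. (4 / k) *\<^sub>R complex_of_real ((cosh s - cos (\<omega> * k * s)) / (sinh s)\<^sup>2) \<partial>half_line"
  have lim: "spectral_limit (\<lambda>\<epsilon> s. f\<^sub>o / (8 * pi\<^sup>2) * (regularized_kernel \<epsilon> (?r0 (s / k)) (?d (s / k)) - regularized_kernel \<epsilon> (?r1 (s / k)) (?d (s / k))))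
      (\<lambda>\<omega>. of_real (f\<^sub>o / (8 * pi\<^sup>2)) * (?h0 \<omega> - h \<omega>)) (of_real (f\<^sub>o / (8 * pi\<^sup>2)) * (0 - m))"
    by (rule spectral_limit_diff[OF direct_spectral_limit[OF k] lim1])
  show "\<exists>W. is_wigner_transform M
             (\<lambda>\<epsilon>. recorded_signal (u \<epsilon>) (observer_time c\<^sub>o \<xi>) (observer_position c\<^sub>o \<xi> \<xi>\<^sub>o \<alpha>)) \<tau> W \<and>
           equals_function_on W
             (\<lambda>\<omega>. W\<^sub>o c\<^sub>o f\<^sub>o \<xi> \<omega> * (1 - R_corr \<alpha> (\<xi>\<^sub>o / \<xi>) (c\<^sub>o * \<tau> / \<xi>) (\<xi> * \<omega> / c\<^sub>o)))
             (if \<alpha> = 0 \<and> \<xi>\<^sub>o / \<xi> = 0 then - {0} else UNIV)"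
  proof (rule wigner_transform_of_spectral_limit[OF lim])
    fix \<epsilon> s :: real assume e: "\<epsilon> > 0"
    show "autocorrelation (M \<epsilon>) (recorded_signal (u \<epsilon>) (observer_time c\<^sub>o \<xi>) (observer_position c\<^sub>o \<xi> \<xi>\<^sub>o \<alpha>)) \<tau> s =
      f\<^sub>o / (8 * pi\<^sup>2) * (regularized_kernel \<epsilon> (?r0 (s / k)) (?d (s / k)) - regularized_kernel \<epsilon> (?r1 (s / k)) (?d (s / k)))"
      unfolding autocorrelation_regularized[OF assms(1) e assms(6)[OF e] X] observer_geometry[OF assms(1,3)]
      unfolding k_def[symmetric] \<eta>_def[symmetric] \<alpha>o_def[symmetric] ..
  next
    fix \<omega> :: real assume \<omega>: "\<omega> \<noteq> 0"
    have \<nu>: "\<omega> * k / 2 = \<xi> * \<omega> / c\<^sub>o" by (simp add: k_def)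
    show "of_real (f\<^sub>o / (8 * pi\<^sup>2)) * (?h0 \<omega> - h \<omega>) =
       complex_of_real (W\<^sub>o c\<^sub>o f\<^sub>o \<xi> \<omega> * (1 - R_corr \<alpha> (\<xi>\<^sub>o / \<xi>) (c\<^sub>o * \<tau> / \<xi>) (\<xi> * \<omega> / c\<^sub>o)))"
      unfolding direct_spectrum[OF k \<omega>] h[OF \<omega>] W\<^sub>o_coth[OF assms(1,3) \<omega>] \<nu> \<alpha>o_def[symmetric] \<eta>_def[symmetric]
        of_real_diff[symmetric] of_real_mult[symmetric]
    proof (rule arg_cong[where f=of_real])
      show "f\<^sub>o / (8 * pi\<^sup>2) * (2 * pi * \<omega> * X - 2 * pi * \<omega> * X * R) = f\<^sub>o * \<omega> / (4 * pi) * X * (1 - R)" for X R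
        by (simp add: power2_eq_square field_simps)
    qed
  next
    show "of_real (f\<^sub>o / (8 * pi\<^sup>2)) * (0 - m) = 0 \<or> 0 \<notin> (if \<alpha> = 0 \<and> \<xi>\<^sub>o / \<xi> = 0 then - {0} else (UNIV :: real set))"
      using m by (auto simp: \<alpha>o_def)
  qed
qed

end
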